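(* Let $n\ge 1$. For $0\le i,j,k\le n-1$, $$[\phi_i\phi_j,\phi_k]=\sum_{\substack{0\le u\le i\\ 0\le v\le j}}(-1)^{i-u}(-1)^{j-v}\binom{n+1}{i-u}\binom{n+1}{j-v}\binom{uv+u+v+n-k}{n}.$$
   Context: For $\pi\in S_n$, $\ell(\pi)$ is the number of cycles of $\pi$ (fixed points included), and $C_i=\{\pi\in S_n\mid \ell(\pi)=i\}$ for $1\le i\le n$; in particular $C_1$ is the set of $n$-cycles. $\mathrm{CF}_\ell(S_n)$ is the complex vector space of all functions $\vartheta:S_n\to\mathbb{C}$ that depend only on $\ell$; for such $\vartheta$, $\vartheta(C_i)$ is the common value of $\vartheta$ on $C_i$. The inner product on $\mathrm{CF}_\ell(S_n)$ is $$[\vartheta,\psi]=\frac{1}{|S_n|}\sum_{i,j=1}^{n}\vartheta(C_i)\,\overline{\psi(C_j)}\;\mathbf{E}\,|\sigma C_i\cap\tau C_j|,$$ where $\sigma,\tau$ are independent and uniformly random elements of $C_1$, $\sigma C_i=\{\sigma x\mid x\in C_i\}$, and $\mathbf{E}$ is expectation. The product $\phi_i\phi_j$ is the pointwise product. For $0\le i\le n-1$, the Foulkes character $\phi_i$ of $S_n$ is the character afforded by the direct sum of the (skew) Specht modules $V_\beta$, one for each border shape $\beta$ (connected skew shape containing no $2\times 2$ square) with $n$ boxes and $i+1$ rows. Equivalently, $\phi_i(\pi)=\sum_{j=0}^{n-1}(-1)^{i-j}\binom{n+1}{i-j}(j+1)^{\ell(\pi)}$, with $\binom{a}{b}=0$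 for $b<0$. *)

theory Defs
  imports
    "HOL-Library.Function_Algebras"
    "HOL-Combinatorics.Permutations"
    "HOL-Combinatorics.Orbits"
    "HOL-Probability.Probability_Mass_Function"
begin

section \<open>Cycles, and the inner product on functions depending only on length\<close>

definition symgrp :: "nat \<Rightarrow> (nat \<Rightarrow> nat) set" where
  "symgrp n = {\<pi>. \<pi> permutes {1..n}}"

definition num_cycles :: "nat \<Rightarrow> (nat \<Rightarrow> nat) \<Rightarrow> nat" where
  "num_cycles n \<pi> = card (orbit \<pi> ` {1..n})"

definition cycle_class :: "nat \<Rightarrow> nat \<Rightarrow> (nat \<Rightarrow> nat) set" where
  "cycle_class n i = {\<pi> \<in> symgrp n. num_cycles n \<pi> = i}"

text \<open>The common value on \<open>cycle_class n i\<close> of a function on the symmetric group. It is meaningful only for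
  functions that are constant on \<open>cycle_class n i\<close> (otherwise it is an unspecified complex number).\<close>

definition class_value :: "nat \<Rightarrow> ((nat \<Rightarrow> nat) \<Rightarrow> complex) \<Rightarrow> nat \<Rightarrow> complex" where
  "class_value n \<theta> i = (THE c. \<forall>\<pi>\<in>cycle_class n i. \<theta> \<pi> = c)"

definition expected_overlap :: "nat \<Rightarrow> nat \<Rightarrow> nat \<Rightarrow> real" where
  "expected_overlap n i j =
     measure_pmf.expectation (pair_pmf (pmf_of_set (cycle_class n 1)) (pmf_of_set (cycle_class n 1)))
       (\<lambda>(\<sigma>, \<tau>). real (card ((\<lambda>x. \<sigma> \<circ> x) ` cycle_class n i \<inter> (\<lambda>x. \<tau> \<circ> x) ` cycle_class n j)))"

definition bracket ::
  "nat \<Rightarrow> ((nat \<Rightarrow> nat) \<Rightarrow> complex) \<Rightarrow> ((nat \<Rightarrow> nat) \<Rightarrow> complex) \<Rightarrow> complex" where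
  "bracket n \<theta> \<psi> =
     1 / of_nat (card (symgrp n)) *
     (\<Sum>i=1..n. \<Sum>j=1..n. class_value n \<theta> i * cnj (class_value n \<psi> j) * complex_of_real (expected_overlap n i j))"


section \<open>Skew shapes and border shapes\<close>

text \<open>A box is a pair (row, column), both counted from 0; rows are numbered downwards.\<close>

type_synonym box = "nat \<times> nat"

definition is_partition :: "(nat \<Rightarrow> nat) \<Rightarrow> bool" where
  "is_partition \<mu> \<longleftrightarrow> antimono \<mu> \<and> finite {r. \<mu> r \<noteq> 0}"

definition diagram :: "(nat \<Rightarrow> nat) \<Rightarrow> box set" where
  "diagram \<mu> = {(r, c). c < \<mu> r}"

definition skew_shape :: "box set \<Rightarrow> bool" where
  "skew_shape \<beta> \<longleftrightarrow> (\<exists>\<kappa> \<mu>. is_partition \<kappa> \<and> is_partition \<mu> \<and>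
     diagram \<mu> \<subseteq> diagram \<kappa> \<and> \<beta> = diagram \<kappa> - diagram \<mu>)"

text \<open>Two boxes are adjacent if they share an edge.\<close>

definition adjacent :: "box \<Rightarrow> box \<Rightarrow> bool" where
  "adjacent x y \<longleftrightarrow>
     (fst x = fst y \<and> (snd x = Suc (snd y) \<or> snd y = Suc (snd x))) \<or>
     (snd x = snd y \<and> (fst x = Suc (fst y) \<or> fst y = Suc (fst x)))"

definition connected_shape :: "box set \<Rightarrow> bool" where
  "connected_shape \<beta> \<longleftrightarrow>
     (\<forall>x\<in>\<beta>. \<forall>y\<in>\<beta>. (x, y) \<in> {(a, b). a \<in> \<beta> \<and> b \<in> \<beta> \<and> adjacent a b}\<^sup>*)"

definition contains_square :: "box set \<Rightarrow> bool" where
  "contains_square \<beta> \<longleftrightarrow>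
     (\<exists>r c. {(r, c), (r, Suc c), (Suc r, c), (Suc r, Suc c)} \<subseteq> \<beta>)"

text \<open>Shapes are considered up to translation. We use the representative that meets both row 0 and
  column 0.\<close>

definition border_shapes :: "nat \<Rightarrow> nat \<Rightarrow> box set set" where
  "border_shapes n m = {\<beta>. skew_shape \<beta> \<and> connected_shape \<beta> \<and> \<not> contains_square \<beta> \<and>
     0 \<in> fst ` \<beta> \<and> 0 \<in> snd ` \<beta> \<and> card \<beta> = n \<and> card (fst ` \<beta>) = m}"


section \<open>Skew Specht modules and their characters\<close>

text \<open>A tableau assigns the numbers 1 to n bijectively to the boxes. Off the shape it takes the
  value 0, which all permutations of 1, \dots, n fix; hence composing with such a permutation yields
  a tableau again.\<close>

type_synonym tableau = "box \<Rightarrow> nat"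

definition tableaux :: "nat \<Rightarrow> box set \<Rightarrow> tableau set" where
  "tableaux n \<beta> = {t. bij_betw t \<beta> {1..n} \<and> (\<forall>b. b \<notin> \<beta> \<longrightarrow> t b = 0)}"

definition row_group :: "nat \<Rightarrow> box set \<Rightarrow> tableau \<Rightarrow> (nat \<Rightarrow> nat) set" where
  "row_group n \<beta> t = {\<pi> \<in> symgrp n. \<forall>r. \<pi> ` t ` {b \<in> \<beta>. fst b = r} = t ` {b \<in> \<beta>. fst b = r}}"

definition column_group :: "nat \<Rightarrow> box set \<Rightarrow> tableau \<Rightarrow> (nat \<Rightarrow> nat) set" where
  "column_group n \<beta> t = {\<pi> \<in> symgrp n. \<forall>c. \<pi> ` t ` {b \<in> \<beta>. snd b = c} = t ` {b \<in> \<beta>. snd b = c}}"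

text \<open>The tabloid of a tableau is its class under reordering the entries within each row. Elements
  of the complex permutation module on tabloids are represented by their coefficient functions.\<close>

type_synonym tabloid = "tableau set"

definition tabloid_of :: "nat \<Rightarrow> box set \<Rightarrow> tableau \<Rightarrow> tabloid" where
  "tabloid_of n \<beta> t = (\<lambda>\<rho>. \<rho> \<circ> t) ` row_group n \<beta> t"

definition polytabloid :: "nat \<Rightarrow> box set \<Rightarrow> tableau \<Rightarrow> tabloid \<Rightarrow> complex" where
  "polytabloid n \<beta> t =
     (\<lambda>T. \<Sum>\<kappa>\<in>column_group n \<beta> t. of_int (sign \<kappa>) * of_bool (T = tabloid_of n \<beta> (\<kappa> \<circ> t)))"

text \<open>The linear extension of the action of a permutation on tabloids by \<open>T \<mapsto> {\<pi> \<circ> t | t \<in> T}\<close>.\<close>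

definition act :: "(nat \<Rightarrow> nat) \<Rightarrow> (tabloid \<Rightarrow> complex) \<Rightarrow> tabloid \<Rightarrow> complex" where
  "act \<pi> v = (\<lambda>T. v ((\<lambda>t. inv \<pi> \<circ> t) ` T))"

interpretation cfun: vector_space "\<lambda>(c :: complex) (v :: 'a \<Rightarrow> complex) x. c * v x"
  by unfold_locales (simp_all add: fun_eq_iff algebra_simps)

definition specht_module :: "nat \<Rightarrow> box set \<Rightarrow> (tabloid \<Rightarrow> complex) set" where
  "specht_module n \<beta> = cfun.span (polytabloid n \<beta> ` tableaux n \<beta>)"

text \<open>The trace of a linear operator on a finite-dimensional invariant subspace, computed in some
  basis of it.\<close>

definition trace_on ::
  "('a \<Rightarrow> complex) set \<Rightarrow> (('a \<Rightarrow> complex) \<Rightarrow> ('a \<Rightarrow> complex)) \<Rightarrow> complex" where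
  "trace_on V f =
     (let B = (SOME B. B \<subseteq> V \<and> cfun.independent B \<and> cfun.span B = V)
      in \<Sum>b\<in>B. cfun.representation B (f b) b)"

definition specht_character :: "nat \<Rightarrow> box set \<Rightarrow> (nat \<Rightarrow> nat) \<Rightarrow> complex" where
  "specht_character n \<beta> \<pi> = trace_on (specht_module n \<beta>) (act \<pi>)"

text \<open>The character of a direct sum of modules is the sum of their characters.\<close>

definition foulkes :: "nat \<Rightarrow> nat \<Rightarrow> (nat \<Rightarrow> nat) \<Rightarrow> complex" where
  "foulkes n i \<pi> = (\<Sum>\<beta>\<in>border_shapes n (i + 1). specht_character n \<beta> \<pi>)"

end

theory Submission
  imports
    Defs
    "HOL-Library.Poly_Mapping"
    "HOL-Computational_Algebra.Formal_Power_Series"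
begin

text \<open>
  Two expansions are combined. The first is
  \<open>x ^ \<ell>(\<pi>) = (\<Sum>i<n. \<phi>\<^sub>i(\<pi>) * ((x + n - 1 - i) choose n))\<close>. Its left side counts the words
  \<open>{1..n} \<rightarrow> {1..x}\<close> fixed by \<open>\<pi>\<close>; grouping words by their weakly increasing rearrangement turns the
  count into traces on spaces of functions invariant under Young subgroups. The space belonging to \<open>J\<close> is
  the direct sum of the ribbon Specht modules belonging to the supersets of \<open>J\<close>: polytabloids indexed by
  permutations with prescribed ascent set are triangular, hence independent, straightening bounds the
  dimension from the other side, and Specht modules are orthogonal to functions with more
  invariance. Inverting the expansion gives the explicit formula for the Foulkes characters.

  The second is \<open>[x ^ \<ell>, y ^ \<ell>] = (\<Sum>r<n. ((x + n - 1 - r) choose n) * ((y + n - 1 - r) choose n))\<close>. In the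
  group algebra, the elements \<open>X\<^sub>x = (\<Sum>g. x ^ (\<ell>(g) - 1) g)\<close> are central, factor over the
  Jucys-Murphy elements, act as scalars on the Young symmetrizers of hooks, and specialise at \<open>x = 0\<close> to
  the sum of all \<open>n\<close>-cycles. The bracket is, up to a factor, the identity coefficient of
  \<open>X\<^sub>0 X\<^sub>x X\<^sub>y X\<^sub>0\<close>, and expanding one factor \<open>X\<^sub>0\<close> into hook symmetrizers evaluates it.
\<close>

hide_const (open) Finite_Cartesian_Product.transpose


section \<open>Traces on finite-dimensional spaces of functions\<close>

text \<open>Both expansions run over the same polynomials \<open>(x + n - 1 - r) choose n\<close>,
  and read together they say that the Foulkes characters are orthonormal for the bracket. The
  theorem then extracts the coefficient of the \<open>k\<close>-th character from a product. Powers
  are the right test functions because they are closed under products: (u+1)^l (v+1)^l =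
  ((u+1)(v+1))^l, which is the origin of uv + u + v.

  Hooks suffice because the scalar of \<open>X\<^sub>0\<close> on a shape is the product of the
  contents of all boxes but the corner; a second diagonal box makes it vanish. Explicit hook
  symmetrizers keep the argument inside the group algebra, free of the classification of irreducible
  modules.

  On the character side the obstacle is that polytabloids span without being independent, and no
  dimension is known in advance. All ribbon modules are therefore placed side by side in the
  functions on \<open>symgrp n\<close>, where n! polytabloids, one for each permutation, turn out to
  be a basis compatible with every one of them.\<close>

lemma trace_on_basis:
  assumes B: "finite B" "cfun.independent B" "cfun.span B = V"
    and f: "Vector_Spaces.linear (\<lambda>c v x. c * v x) (\<lambda>c v x. c * v x) f"
    and inv: "\<And>b. b \<in> B \<Longrightarrow> f b \<in> V"
  shows "trace_on V f = (\<Sum>b\<in>B. cfun.representation B (f b) b)"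
proof -
  define C where "C = (SOME B. B \<subseteq> V \<and> cfun.independent B \<and> cfun.span B = V)"
  have "B \<subseteq> V" using B(3) cfun.span_superset by blast
  then have "\<exists>B. B \<subseteq> V \<and> cfun.independent B \<and> cfun.span B = V" using B by blast
  then have C: "C \<subseteq> V" "cfun.independent C" "cfun.span C = V"
    unfolding C_def by (metis (mono_tags, lifting) someI_ex)+
  have finC: "finite C"
    using cfun.independent_span_bound[OF B(1) C(2)] C(1) B(3) by blast
  interpret f: Vector_Spaces.linear "\<lambda>c v x. c * v x" "\<lambda>c v x. c * v x" f by (rule f)
  have fV: "f v \<in> V" if "v \<in> V" for v
  proof -
    have "f ` V = cfun.span (f ` B)" using f.span_image[of B] B(3) by simp
    also have "\<dots> \<subseteq> V" by (rule cfun.span_minimal) (use inv B(3) in auto)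
    finally show ?thesis using that by blast
  qed
  let ?rB = "cfun.representation B" and ?rC = "cfun.representation C"
  have expB: "v = (\<Sum>b\<in>B. (\<lambda>x. ?rB v b * b x))" if "v \<in> V" for v
    using cfun.sum_representation_eq[OF B(2) _ B(1) order_refl, of v] that B(3) by simp
  have expC: "v = (\<Sum>b\<in>C. (\<lambda>x. ?rC v b * b x))" if "v \<in> V" for v
    using cfun.sum_representation_eq[OF C(2) _ finC order_refl, of v] that C(3) by simp
  have rBsum: "?rB (\<Sum>c\<in>C. (\<lambda>x. a c * c x)) b = (\<Sum>c\<in>C. a c * ?rB c b)" for a b
  proof -
    have 1: "c \<in> cfun.span B" if "c \<in> C" for c using that C(1) B(3) by blast
    have 2: "(\<lambda>x. a c * c x) \<in> cfun.span B" if "c \<in> C" for c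
      by (rule cfun.span_scale) (rule 1[OF that])
    show ?thesis
      by (simp add: cfun.representation_sum[OF B(2) 2] cfun.representation_scale[OF B(2) 1])
  qed
  have rCsum: "?rC (\<Sum>c\<in>B. (\<lambda>x. a c * f c x)) b = (\<Sum>c\<in>B. a c * ?rC (f c) b)" for a b
  proof -
    have 1: "f c \<in> cfun.span C" if "c \<in> B" for c using inv[OF that] C(3) by blast
    have 2: "(\<lambda>x. a c * f c x) \<in> cfun.span C" if "c \<in> B" for c
      by (rule cfun.span_scale) (rule 1[OF that])
    show ?thesis
      by (simp add: cfun.representation_sum[OF C(2) 2] cfun.representation_scale[OF C(2) 1])
  qed
  \<comment> \<open>The coordinates of the \<open>f b\<close> in \<open>C\<close> and those of the
    elements of \<open>C\<close> in \<open>B\<close> form two rectangular matrices; both traces are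
    the trace of their product, taken in the two orders.\<close>
  have "(\<Sum>b\<in>B. ?rB (f b) b) = (\<Sum>b\<in>B. \<Sum>c\<in>C. ?rC (f b) c * ?rB c b)"
  proof (rule sum.cong[OF refl])
    fix b assume "b \<in> B"
    then show "?rB (f b) b = (\<Sum>c\<in>C. ?rC (f b) c * ?rB c b)"
      using rBsum[of "?rC (f b)" b] expC[OF inv, of b] by simp
  qed
  also have "\<dots> = (\<Sum>c\<in>C. \<Sum>b\<in>B. ?rB c b * ?rC (f b) c)"
    by (subst sum.swap) (simp add: mult.commute)
  also have "\<dots> = (\<Sum>c\<in>C. ?rC (f c) c)"
  proof (rule sum.cong[OF refl])
    fix c assume c: "c \<in> C"
    then have "f c = f (\<Sum>b\<in>B. (\<lambda>x. ?rB c b * b x))" using expB C(1) by auto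
    also have "\<dots> = (\<Sum>b\<in>B. (\<lambda>x. ?rB c b * f b x))" by (simp add: f.sum f.scale)
    finally show "(\<Sum>b\<in>B. ?rB c b * ?rC (f b) c) = ?rC (f c) c"
      using rCsum[of "?rB c" c] by simp
  qed
  finally show ?thesis unfolding trace_on_def Let_def C_def[symmetric] by simp
qed

text \<open>Carries the trace from functions on tabloids to functions on permutations. Injectivity
  and the intertwining relation are asked only on the span, since the map used later,
  \<open>ribbon_map\<close>, forgets values elsewhere.\<close>

lemma trace_on_transport:
  assumes fin: "finite S"
    and f: "Vector_Spaces.linear (\<lambda>c v x. c * v x) (\<lambda>c v x. c * v x) (f :: ('a \<Rightarrow> complex) \<Rightarrow> _)"
    and g: "Vector_Spaces.linear (\<lambda>c v x. c * v x) (\<lambda>c v x. c * v x) (g :: ('b \<Rightarrow> complex) \<Rightarrow> _)"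
    and \<phi>: "Vector_Spaces.linear (\<lambda>c v x. c * v x) (\<lambda>c v x. c * v x) \<phi>"
    and inj: "inj_on \<phi> (cfun.span S)"
    and inv: "\<And>b. b \<in> S \<Longrightarrow> f b \<in> cfun.span S"
    and comm: "\<And>v. v \<in> cfun.span S \<Longrightarrow> \<phi> (f v) = g (\<phi> v)"
  shows "trace_on (cfun.span S) f = trace_on (cfun.span (\<phi> ` S)) g"
proof -
  interpret f: Vector_Spaces.linear "\<lambda>c v x. c * v x" "\<lambda>c v x. c * v x" f by (rule f)
  interpret p: Vector_Spaces.linear "\<lambda>c v x. c * v x" "\<lambda>c v x. c * v x" \<phi> by (rule \<phi>)
  obtain B where B: "B \<subseteq> S" "cfun.independent B" "S \<subseteq> cfun.span B"
    using cfun.maximal_independent_subset by blast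
  have finB: "finite B" using fin B finite_subset by blast
  have spB: "cfun.span B = cfun.span S"
    using cfun.span_mono[OF B(1)] cfun.span_minimal[OF B(3) cfun.subspace_span] by blast
  have fV: "f v \<in> cfun.span S" if "v \<in> cfun.span S" for v
  proof -
    have "f ` cfun.span S = cfun.span (f ` S)" using f.span_image[of S] by simp
    also have "\<dots> \<subseteq> cfun.span S" by (rule cfun.span_minimal) (use inv in auto)
    finally show ?thesis using that by blast
  qed
  have BS: "b \<in> cfun.span S" if "b \<in> B" for b using that B(1) cfun.span_base by blast
  have injB: "inj_on \<phi> B" using inj BS by (meson inj_on_subset subsetI)
  have indep: "cfun.independent (\<phi> ` B)"
    using p.independent_injective_image[OF B(2)] inj spB by simp
  have sp: "cfun.span (\<phi> ` B) = cfun.span (\<phi> ` S)"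
    using p.span_image[of B] p.span_image[of S] spB by simp
  have "trace_on (cfun.span (\<phi> ` S)) g = (\<Sum>b\<in>\<phi> ` B. cfun.representation (\<phi> ` B) (g b) b)"
  proof (rule trace_on_basis[OF _ indep sp g])
    fix b assume "b \<in> \<phi> ` B"
    then obtain c where "b = \<phi> c" "c \<in> B" by blast
    then show "g b \<in> cfun.span (\<phi> ` S)"
      by (simp add: comm[OF BS, symmetric] p.span_image fV[OF BS])
  qed (use finB in simp)
  also have "\<dots> = (\<Sum>b\<in>B. cfun.representation (\<phi> ` B) (g (\<phi> b)) (\<phi> b))"
    by (simp add: sum.reindex[OF injB] o_def)
  also have "\<dots> = (\<Sum>b\<in>B. cfun.representation B (f b) b)"
  proof (rule sum.cong[OF refl])
    fix b assume b: "b \<in> B"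
    let ?r = "cfun.representation B (f b)"
    have "g (\<phi> b) = \<phi> (f b)" using comm[OF BS[OF b]] by simp
    also have "f b = (\<Sum>c\<in>B. (\<lambda>x. ?r c * c x))"
      using cfun.sum_representation_eq[OF B(2) _ finB order_refl, of "f b"] fV[OF BS[OF b]] spB by simp
    also have "\<phi> \<dots> = (\<Sum>c\<in>B. (\<lambda>x. ?r c * \<phi> c x))" by (simp add: p.sum p.scale)
    finally have e: "g (\<phi> b) = (\<Sum>c\<in>B. (\<lambda>x. ?r c * \<phi> c x))" .
    have 1: "\<phi> c \<in> cfun.span (\<phi> ` B)" if "c \<in> B" for c
      using that by (intro cfun.span_base imageI)
    have 2: "(\<lambda>x. ?r c * \<phi> c x) \<in> cfun.span (\<phi> ` B)" if "c \<in> B" for c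
      by (rule cfun.span_scale) (rule 1[OF that])
    have "cfun.representation (\<phi> ` B) (g (\<phi> b)) (\<phi> b) = (\<Sum>c\<in>B. ?r c * cfun.representation (\<phi> ` B) (\<phi> c) (\<phi> b))"
      unfolding e by (simp add: cfun.representation_sum[OF indep 2] cfun.representation_scale[OF indep 1])
    also have "\<dots> = (\<Sum>c\<in>B. ?r c * (if c = b then 1 else 0))"
      using injB b by (intro sum.cong) (auto simp: cfun.representation_basis[OF indep] inj_on_eq_iff)
    also have "\<dots> = (\<Sum>c\<in>B. if c = b then ?r b else 0)"
      by (rule sum.cong) auto
    also have "\<dots> = ?r b" using sum.delta[OF finB, of b "\<lambda>_. ?r b"] b by simp
    finally show "cfun.representation (\<phi> ` B) (g (\<phi> b)) (\<phi> b) = ?r b" .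
  qed
  also have "\<dots> = trace_on (cfun.span S) f"
    by (rule trace_on_basis[OF finB B(2) spB f, symmetric]) (use fV BS in auto)
  finally show ?thesis by simp
qed

lemma independent_Un:
  assumes "finite S" "finite T" "cfun.independent S" "cfun.independent T"
    and disj: "cfun.span S \<inter> cfun.span T \<subseteq> {0}"
  shows "cfun.independent (S \<union> T)" "S \<inter> T = {}"
proof -
  show ST: "S \<inter> T = {}"
  proof (rule ccontr)
    assume "S \<inter> T \<noteq> {}"
    then obtain x where x: "x \<in> S" "x \<in> T" by blast
    have "x \<in> cfun.span S \<inter> cfun.span T" using x by (intro IntI cfun.span_base)
    then have "0 \<in> S" using disj x by auto
    then show False using assms(3) cfun.dependent_zero[of S] by simp
  qed
  show "cfun.independent (S \<union> T)"
  proof (rule cfun.independent_if_scalars_zero)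
    show "finite (S \<union> T)" using assms by simp
    fix a x assume z: "(\<Sum>x\<in>S \<union> T. (\<lambda>y. a x * x y)) = 0" and x: "x \<in> S \<union> T"
    let ?s = "\<Sum>x\<in>S. (\<lambda>y. a x * x y)" and ?t = "\<Sum>x\<in>T. (\<lambda>y. a x * x y)"
    have st: "?s + ?t = 0" using z assms ST by (simp add: sum.union_disjoint)
    have s: "?s \<in> cfun.span S" by (intro cfun.span_sum cfun.span_scale cfun.span_base)
    have t: "?t \<in> cfun.span T" by (intro cfun.span_sum cfun.span_scale cfun.span_base)
    have "?s = - ?t" using st by (simp add: eq_neg_iff_add_eq_0)
    then have "?s \<in> cfun.span T" using cfun.span_neg[OF t] by simp
    then have "?s = 0" using s disj by auto
    moreover have "?t = 0" using calculation st by simp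
    ultimately show "a x = 0"
      using x cfun.independentD[OF assms(3) assms(1) order_refl] cfun.independentD[OF assms(4) assms(2) order_refl] by blast
  qed
qed

text \<open>A dependent \<open>S\<close> could lose one vector and keep its span, leaving fewer than
  \<open>card T\<close> vectors to span the independent set \<open>T\<close>.\<close>

lemma spanning_card_le_independent:
  assumes "finite S" "T \<subseteq> cfun.span S" "cfun.independent T" "card S \<le> card T"
  shows "cfun.independent S"
proof (rule ccontr)
  assume "\<not> cfun.independent S"
  then obtain a where a: "a \<in> S" "a \<in> cfun.span (S - {a})" unfolding cfun.dependent_def by blast
  have "cfun.span S = cfun.span (S - {a})"
    using cfun.span_redundant[OF a(2)] a(1) by (simp add: insert_absorb)
  then have "card T \<le> card (S - {a})"
    using cfun.independent_span_bound[of "S - {a}" T] assms by auto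
  then show False using assms a(1) by (meson card_Diff1_less leD le_less_trans)
qed

lemma independent_card_ge_spanning:
  assumes "finite S" "finite T" "T \<subseteq> cfun.span S" "cfun.independent T" "card S \<le> card T"
  shows "cfun.span T = cfun.span S"
proof -
  have "x \<in> cfun.span T" if x: "x \<in> cfun.span S" for x
  proof (rule ccontr)
    assume n: "x \<notin> cfun.span T"
    then have "cfun.independent (insert x T)" using assms cfun.independent_insertI by blast
    then have "card (insert x T) \<le> card S"
      using cfun.independent_span_bound[of S "insert x T"] assms x by auto
    moreover have "x \<notin> T" using n cfun.span_base[of x T] by argo
    ultimately show False using assms by simp
  qed
  then show ?thesis using assms(3) cfun.span_minimal[OF assms(3)] by auto
qed

section \<open>Counting cycles\<close>

text \<open>The ground set is arbitrary, not \<open>{1..n}\<close>, so that cycles can be counted by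
  inserting one point at a time.\<close>

definition cyc :: "'a set \<Rightarrow> ('a \<Rightarrow> 'a) \<Rightarrow> nat" where
  "cyc A p = card (orbit p ` A)"

lemma num_cycles_eq_cyc: "num_cycles n p = cyc {1..n} p"
  by (simp add: num_cycles_def cyc_def)

text \<open>An invariant colouring is a colouring of the set of cycles. Besides counting fixed
  words, this lets two cycle numbers be compared through colourings in two colours.\<close>

lemma card_invariant_colourings:
  assumes "finite A" "p permutes A"
  shows "card {f \<in> A \<rightarrow>\<^sub>E Y. \<forall>a\<in>A. f (p a) = f a} = card Y ^ cyc A p"
proof -
  let ?h = "\<lambda>g. \<lambda>a\<in>A. g (orbit p a)"
  have perm: "permutation p" by (rule permutes_imp_permutation[OF assms])
  have self: "a \<in> orbit p a" for a by (rule permutation_self_in_orbit[OF perm])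
  have orbA: "orbit p a \<subseteq> A" if "a \<in> A" for a
  proof
    fix b assume "b \<in> orbit p a"
    then show "b \<in> A" by induct (use that permutes_in_image[OF assms(2)] in auto)
  qed
  have const: "f b = f a" if "\<forall>a\<in>A. f (p a) = f a" "a \<in> A" "b \<in> orbit p a" for f :: "'a \<Rightarrow> 'b" and a b
    using that(3)
  proof induct
    case base then show ?case using that by blast
  next
    case (step y)
    then show ?case using that orbA[OF that(2)] by auto
  qed
  have "bij_betw ?h (orbit p ` A \<rightarrow>\<^sub>E Y) {f \<in> A \<rightarrow>\<^sub>E Y. \<forall>a\<in>A. f (p a) = f a}"
  proof (rule bij_betwI[where g = "\<lambda>f. \<lambda>K\<in>orbit p ` A. f (SOME a. a \<in> K)"])
    show "?h \<in> (orbit p ` A \<rightarrow>\<^sub>E Y) \<rightarrow> {f \<in> A \<rightarrow>\<^sub>E Y. \<forall>a\<in>A. f (p a) = f a}"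
      using permutes_in_image[OF assms(2)] by (auto simp: permutation_orbit_step[OF perm] PiE_def Pi_def)
    show "(\<lambda>f. \<lambda>K\<in>orbit p ` A. f (SOME a. a \<in> K)) \<in> {f \<in> A \<rightarrow>\<^sub>E Y. \<forall>a\<in>A. f (p a) = f a} \<rightarrow> (orbit p ` A \<rightarrow>\<^sub>E Y)"
    proof (intro Pi_I PiE_I, goal_cases)
      case (1 f K)
      then obtain a where a: "a \<in> A" "K = orbit p a" by blast
      have "(SOME a. a \<in> K) \<in> K" using self a by (metis someI)
      then show ?case using 1 a orbA[OF a(1)] by auto
    qed simp
  next
    fix g assume g: "g \<in> orbit p ` A \<rightarrow>\<^sub>E Y"
    show "(\<lambda>K\<in>orbit p ` A. ?h g (SOME a. a \<in> K)) = g"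
    proof (rule PiE_ext[OF _ g])
      show "(\<lambda>K\<in>orbit p ` A. ?h g (SOME a. a \<in> K)) \<in> orbit p ` A \<rightarrow>\<^sub>E Y"
      proof (intro PiE_I, goal_cases)
        case (1 K)
        then obtain a where a: "a \<in> A" "K = orbit p a" by blast
        have "(SOME a. a \<in> K) \<in> K" using self a by (metis someI)
        then show ?case using 1 a orbA[OF a(1)] g by auto
      qed simp
      fix K assume "K \<in> orbit p ` A"
      then obtain a where a: "a \<in> A" "K = orbit p a" by blast
      have s: "(SOME a. a \<in> K) \<in> K" using self a by (metis someI)
      have "orbit p b = K" if "b \<in> K" for b
        using that a self orbit_trans orbit_swap by (metis subsetI subset_antisym)
      then show "(\<lambda>K\<in>orbit p ` A. ?h g (SOME a. a \<in> K)) K = g K"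
        using s a orbA[OF a(1)] by auto
    qed
  next
    fix f assume f: "f \<in> {f \<in> A \<rightarrow>\<^sub>E Y. \<forall>a\<in>A. f (p a) = f a}"
    show "?h (\<lambda>K\<in>orbit p ` A. f (SOME a. a \<in> K)) = f"
    proof
      fix a
      show "?h (\<lambda>K\<in>orbit p ` A. f (SOME a. a \<in> K)) a = f a"
      proof (cases "a \<in> A")
        case True
        have "(SOME b. b \<in> orbit p a) \<in> orbit p a" using self by (metis someI)
        then have "f (SOME b. b \<in> orbit p a) = f a" using const[OF _ True] f by simp
        then show ?thesis using True by simp
      next
        case False
        then show ?thesis using f by (auto simp: PiE_def extensional_def)
      qed
    qed
  qed
  then have "card {f \<in> A \<rightarrow>\<^sub>E Y. \<forall>a\<in>A. f (p a) = f a} = card (orbit p ` A \<rightarrow>\<^sub>E Y)"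
    by (simp add: bij_betw_same_card)
  also have "\<dots> = card Y ^ cyc A p"
    using assms by (simp add: card_PiE cyc_def)
  finally show ?thesis .
qed

lemma cyc_conj:
  assumes "w permutes A" "finite A" "p permutes A"
  shows "cyc A (w \<circ> p \<circ> inv w) = cyc A p"
proof -
  have winv: "inv w (w a) = a" for a by (rule permutes_inverses(2)[OF assms(1)])
  define r where "r = w \<circ> p \<circ> inv w"
  have r: "r (w a) = w (p a)" for a by (simp add: r_def winv)
  have orb: "orbit r (w a) = w ` orbit p a" for a
  proof (intro equalityI subsetI)
    fix x assume "x \<in> orbit r (w a)"
    then show "x \<in> w ` orbit p a"
      by induct (auto simp: r intro: orbit.intros)
  next
    fix x assume "x \<in> w ` orbit p a"
    then obtain y where y: "x = w y" "y \<in> orbit p a" by blast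
    from y(2) have "w y \<in> orbit r (w a)"
      by induct (auto simp: r[symmetric] intro: orbit.intros)
    then show "x \<in> orbit r (w a)" using y by simp
  qed
  have "orbit r ` A = orbit r ` w ` A"
    using permutes_image[OF assms(1)] by simp
  also have "\<dots> = (`) w ` orbit p ` A" by (simp add: image_image orb)
  finally have "cyc A r = card ((`) w ` orbit p ` A)" by (simp add: cyc_def)
  also have "\<dots> = cyc A p"
    unfolding cyc_def using permutes_inj[OF assms(1)]
    by (intro card_image) (auto simp: inj_on_def inj_image_eq_iff)
  finally show ?thesis by (simp only: r_def)
qed

lemma cyc_inv:
  assumes "finite A" "p permutes A"
  shows "cyc A (inv p) = cyc A p"
  by (simp add: cyc_def orbit_inv_eq[OF permutes_imp_permutation[OF assms]] cong: image_cong)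

lemma cyc_comp_commute:
  assumes "finite A" "p permutes A" "q permutes A"
  shows "cyc A (p \<circ> q) = cyc A (q \<circ> p)"
proof -
  have "q \<circ> p = q \<circ> (p \<circ> q) \<circ> inv q"
    using permutes_inv_o(1)[OF assms(3)] by (simp add: comp_assoc)
  then show ?thesis
    using cyc_conj[OF assms(3,1) permutes_compose[OF assms(3,2)]] by simp
qed

lemma cyc_pos: "finite A \<Longrightarrow> A \<noteq> {} \<Longrightarrow> cyc A p \<ge> 1"
  by (simp add: cyc_def Suc_le_eq card_gt_0_iff)

lemma cyc_insert_fixed:
  assumes "finite A" "a \<notin> A" "p permutes A"
  shows "cyc (insert a A) p = Suc (cyc A p)"
proof -
  have a: "p a = a" using assms by (meson permutes_not_in)
  have oa: "b = a" if "b \<in> orbit p a" for b using that by induct (auto simp: a)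
  have "orbit p a \<notin> orbit p ` A"
  proof
    assume "orbit p a \<in> orbit p ` A"
    then obtain b where "b \<in> A" "orbit p a = orbit p b" by blast
    then have "b \<in> orbit p a"
      using permutation_self_in_orbit[OF permutes_imp_permutation[OF assms(1,3)], of b] by simp
    then show False using oa \<open>b \<in> A\<close> assms(2) by blast
  qed
  then show ?thesis using assms by (simp add: cyc_def)
qed

text \<open>Composing with \<open>transpose a b\<close> splices \<open>a\<close> into the cycle of
  \<open>b\<close>, immediately before \<open>b\<close>. Invariant 2-colourings correspond by giving
  \<open>a\<close> the colour of \<open>b\<close>, and 2^c determines c; no orbits have to be
  compared.\<close>

lemma cyc_insert_transpose:
  assumes "finite A" "a \<notin> A" "p permutes A" "b \<in> A"
  shows "cyc (insert a A) (transpose a b \<circ> p) = cyc A p"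
proof -
  let ?q = "transpose a b \<circ> p"
  let ?I = "\<lambda>A p. {f \<in> A \<rightarrow>\<^sub>E {..<2::nat}. \<forall>x\<in>A. f (p x) = f x}"
  have pa: "p a = a" using assms by (meson permutes_not_in)
  have q: "?q permutes insert a A"
    using assms permutes_swap_id[of a "insert a A" b] permutes_subset[OF assms(3), of "insert a A"]
    by (intro permutes_compose) auto
  have qa: "?q a = b" by (simp add: pa)
  have qx: "?q x = (if p x = b then a else p x)" if "x \<in> A" for x
    using that assms permutes_in_image[OF assms(3), of x] by (auto simp: Transposition.transpose_def)
  have bij: "bij_betw (\<lambda>f. f(a := f b)) (?I A p) (?I (insert a A) ?q)"
  proof (rule bij_betwI[where g = "\<lambda>f. restrict f A"])
    show "(\<lambda>f. f(a := f b)) \<in> ?I A p \<rightarrow> ?I (insert a A) ?q"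
    proof
      fix f assume f: "f \<in> ?I A p"
      have 1: "f(a := f b) \<in> insert a A \<rightarrow>\<^sub>E {..<2}"
        using f assms by (auto simp: PiE_def Pi_def extensional_def)
      have 2: "(f(a := f b)) (?q x) = (f(a := f b)) x" if "x \<in> insert a A" for x
      proof (cases "x = a")
        case True then show ?thesis using qa assms by simp
      next
        case False
        then have x: "x \<in> A" using that by simp
        have "f (p x) = f x" using f x by blast
        moreover have "p x \<in> A" using x permutes_in_image[OF assms(3)] by simp
        ultimately show ?thesis using qx[OF x] False x assms(2) by auto
      qed
      show "f(a := f b) \<in> ?I (insert a A) ?q" using 1 2 by blast
    qed
    show "(\<lambda>f. restrict f A) \<in> ?I (insert a A) ?q \<rightarrow> ?I A p"
    proof
      fix f assume f: "f \<in> ?I (insert a A) ?q"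
      have fab: "f a = f b" using f qa by (metis (mono_tags, lifting) insertI1 mem_Collect_eq)
      have "f (p x) = f x" if x: "x \<in> A" for x
      proof -
        have "f (?q x) = f x" using f x by blast
        then show ?thesis using qx[OF x] fab by (auto split: if_splits)
      qed
      then show "restrict f A \<in> ?I A p"
        using f permutes_in_image[OF assms(3)] by (auto simp: PiE_def Pi_def)
    qed
  next
    fix f assume "f \<in> ?I A p"
    then show "restrict (f(a := f b)) A = f"
      using assms by (auto simp: PiE_def extensional_def restrict_def)
  next
    fix f assume f: "f \<in> ?I (insert a A) ?q"
    have fab: "f a = f b" using f qa by (metis (mono_tags, lifting) insertI1 mem_Collect_eq)
    then show "(restrict f A)(a := restrict f A b) = f"
      using f assms by (auto simp: PiE_def extensional_def restrict_def fun_eq_iff)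
  qed
  have "(2::nat) ^ cyc A p = 2 ^ cyc (insert a A) ?q"
    using bij_betw_same_card[OF bij] card_invariant_colourings[OF assms(1,3), of "{..<2::nat}"]
      card_invariant_colourings[OF _ q, of "{..<2::nat}"] assms(1) by simp
  then show ?thesis by simp
qed

section \<open>The group algebra and products of single cycles\<close>

text \<open>Permutations are written additively because multiplication of
  \<open>poly_mapping\<close> adds keys; \<open>+\<close> is composition, so \<open>galg\<close> is
  the group algebra. Admitting all permutations of finite support puts the groups of all finite sets
  \<open>A\<close> into one ring, as the inductions on \<open>A\<close> require.\<close>

typedef fperm = "{p :: nat \<Rightarrow> nat. permutation p}"
  morphisms perm_fun Fperm
  by (rule exI[of _ id]) simp

setup_lifting type_definition_fperm

instantiation fperm :: group_add
begin
lift_definition zero_fperm :: fperm is id by simp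
lift_definition plus_fperm :: "fperm \<Rightarrow> fperm \<Rightarrow> fperm" is "(\<circ>)" by (rule permutation_compose)
lift_definition uminus_fperm :: "fperm \<Rightarrow> fperm" is inv by (rule permutation_inverse)
lift_definition minus_fperm :: "fperm \<Rightarrow> fperm \<Rightarrow> fperm" is "\<lambda>p q. p \<circ> inv q"
  by (intro permutation_compose permutation_inverse)
instance
proof
  fix a b c :: fperm
  show "a + b + c = a + (b + c)" by transfer (simp add: comp_assoc)
  show "0 + a = a" by transfer simp
  show "a + 0 = a" by transfer simp
  show "- a + a = 0" by transfer (simp add: inv_o_cancel bij_is_inj permutation_bijective)
  show "a + - b = a - b" by transfer simp
qed
end

type_synonym galg = "fperm \<Rightarrow>\<^sub>0 complex"

definition mon :: "complex \<Rightarrow> (nat \<Rightarrow> nat) \<Rightarrow> galg" where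
  "mon c p = Poly_Mapping.single (Fperm p) c"

lemma mon_mult:
  assumes "permutation p" "permutation q"
  shows "mon c p * mon d q = mon (c * d) (p \<circ> q)"
proof -
  have "Fperm p + Fperm q = Fperm (p \<circ> q)"
    using assms by (simp add: plus_fperm.abs_eq eq_onp_same_args)
  then show ?thesis by (simp add: mon_def mult_single)
qed

lemma mon_add: "mon (c + d) p = mon c p + mon d p"
  by (simp add: mon_def single_add)

lemma mon_uminus: "mon (- c) p = - mon c p"
  by (simp add: mon_def single_uminus)

lemma mon_one: "mon 1 id = 1"
  by (simp add: mon_def zero_fperm_def[symmetric])

definition id_coeff :: "galg \<Rightarrow> complex" where
  "id_coeff f = poly_mapping.lookup f 0"

lemma id_coeff_mon: "permutation p \<Longrightarrow> id_coeff (mon c p) = (if p = id then c else 0)"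
  by (auto simp add: id_coeff_def mon_def lookup_single zero_fperm_def Fperm_inject when_def)

text \<open>Scalars are multiples of the identity permutation, so scaling is ordinary ring
  multiplication and linear identities are ring identities.\<close>

definition sc :: "complex \<Rightarrow> galg" where "sc c = mon c id"

lemma sc_one: "sc 1 = 1" by (simp add: sc_def mon_one)

lemma sc_zero: "sc 0 = 0" by (simp add: sc_def mon_def)

lemma sc_add: "sc (c + d) = sc c + sc d" by (simp add: sc_def mon_add)

lemma sc_minus: "sc (- c) = - sc c" by (simp add: sc_def mon_def single_uminus)

lemma sc_mult: "sc c * sc d = sc (c * d)" by (simp add: sc_def mon_mult)

lemma sc_of_nat: "sc (of_nat k) = of_nat k"
  by (induct k) (simp_all add: sc_add sc_one sc_zero)

lemma sc_commute: "sc c * f = f * sc c"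
proof (induct f rule: update_induct)
  case const then show ?case by simp
next
  case (update f a b)
  have "Poly_Mapping.update a b f = f + Poly_Mapping.single a b"
    using update(1) by (intro poly_mapping_eqI) (auto simp add: lookup_update lookup_add lookup_single when_def in_keys_iff)
  moreover have "sc c * Poly_Mapping.single a b = Poly_Mapping.single a b * sc c"
    by (simp add: sc_def mon_def mult_single zero_fperm_def[symmetric] mult.commute)
  ultimately show ?case using update(3) by (simp add: distrib_left distrib_right)
qed

lemma id_coeff_sc_mult: "id_coeff (sc c * f) = c * id_coeff f"
  unfolding id_coeff_def
proof (induct f rule: update_induct)
  case const then show ?case by simp
next
  case (update f a b)
  have "Poly_Mapping.update a b f = f + Poly_Mapping.single a b"
    using update(1) by (intro poly_mapping_eqI) (auto simp add: lookup_update lookup_add lookup_single when_def in_keys_iff)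
  moreover have "sc c * Poly_Mapping.single a b = Poly_Mapping.single a (c * b)"
    by (simp add: sc_def mon_def mult_single zero_fperm_def[symmetric])
  ultimately show ?case using update(3) by (simp add: distrib_left lookup_add lookup_single when_def)
qed

lemma sc_left_commute: "f * (sc c * g) = sc c * (f * g)"
  by (simp only: mult.assoc[symmetric] sc_commute[of c f])

text \<open>The exponent is one less than the number of cycles, so that \<open>x = 0\<close> gives the sum of all cycles of
  full length.\<close>

definition cyc_elem :: "nat set \<Rightarrow> complex \<Rightarrow> galg" where
  "cyc_elem A x = (\<Sum>p | p permutes A. mon (x ^ (cyc A p - 1)) p)"

definition sym_elem :: "nat set \<Rightarrow> galg" where
  "sym_elem A = (\<Sum>p | p permutes A. mon 1 p)"

definition alt_elem :: "nat set \<Rightarrow> galg" where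
  "alt_elem A = (\<Sum>p | p permutes A. mon (of_int (sign p)) p)"

text \<open>The Jucys-Murphy element for adjoining the point \<open>a\<close> to \<open>A\<close>,
  for any set instead of an initial segment, so that points can be adjoined in any order.\<close>

definition jm :: "nat \<Rightarrow> nat set \<Rightarrow> galg" where
  "jm a A = (\<Sum>b\<in>A. mon 1 (transpose a b))"

lemma permutation_of_permutes: "finite A \<Longrightarrow> p permutes A \<Longrightarrow> permutation p"
  by (rule permutes_imp_permutation)

section \<open>Adjoining a point: factorisations in the group algebra\<close>

lemma sum_over_permutations_insert_right:
  assumes "finite S" "a \<notin> S"
  shows "sum f {p. p permutes (insert a S)} =
    (\<Sum>b\<in>insert a S. \<Sum>q | q permutes S. f (q \<circ> transpose a b))"
proof -
  have "sum f {p. p permutes (insert a S)} = (\<Sum>b\<in>insert a S. \<Sum>q | q permutes S. f (inv (transpose a b \<circ> q)))"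
    by (subst sum_permutations_inverse, subst sum_over_permutations_insert[OF assms]) simp
  also have "\<dots> = (\<Sum>b\<in>insert a S. \<Sum>q | q permutes S. f (inv q \<circ> transpose a b))"
    by (intro sum.cong refl) (simp add: o_inv_distrib permutes_bij)
  also have "\<dots> = (\<Sum>b\<in>insert a S. \<Sum>q | q permutes S. f (q \<circ> transpose a b))"
    by (rule sum.cong[OF refl]) (rule sum_permutations_inverse[symmetric, of "\<lambda>q. f (q \<circ> transpose a b)" for b])
  finally show ?thesis .
qed

lemma insert_sum_transpose:
  assumes "finite A" "a \<notin> A"
  shows "(\<Sum>b\<in>insert a A. mon (c b) (transpose a b)) = sc (c a) + (\<Sum>b\<in>A. mon (c b) (transpose a b))"
  using assms by (simp add: sc_def)

text \<open>Each permutation of the larger set is \<open>transpose a b \<circ> q\<close> for unique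
  \<open>b\<close> and \<open>q\<close>. For \<open>b = a\<close> a new cycle appears and
  contributes \<open>x\<close>; for \<open>b \<in> A\<close> the number of cycles is that of
  \<open>q\<close>. As \<open>A\<close> is nonempty, the exponent \<open>cyc A q - 1\<close> is not
  truncated.\<close>

lemma cyc_elem_insert:
  assumes "finite A" "A \<noteq> {}" "a \<notin> A"
  shows "cyc_elem (insert a A) x = (sc x + jm a A) * cyc_elem A x"
proof -
  have "cyc_elem (insert a A) x = (\<Sum>b\<in>insert a A. \<Sum>q | q permutes A. mon (x ^ (cyc (insert a A) (transpose a b \<circ> q) - 1)) (transpose a b \<circ> q))"
    unfolding cyc_elem_def by (rule sum_over_permutations_insert[OF assms(1,3)])
  also have "\<dots> = (\<Sum>b\<in>insert a A. \<Sum>q | q permutes A. mon (if b = a then x else 1) (transpose a b) * mon (x ^ (cyc A q - 1)) q)"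
  proof (intro sum.cong refl)
    fix b q assume b: "b \<in> insert a A" and "q \<in> {q. q permutes A}"
    then have q: "q permutes A" by simp
    have "x ^ (cyc (insert a A) (transpose a b \<circ> q) - 1) = (if b = a then x else 1) * x ^ (cyc A q - 1)"
    proof (cases "b = a")
      case True
      obtain k where k: "cyc A q = Suc k" using cyc_pos[OF assms(1,2), of q] by (cases "cyc A q") auto
      show ?thesis using True cyc_insert_fixed[OF assms(1,3) q] k by simp
    next
      case False
      then have "b \<in> A" using b by simp
      then show ?thesis using False by (simp only: cyc_insert_transpose[OF assms(1,3) q] if_False mult_1)
    qed
    then show "mon (x ^ (cyc (insert a A) (transpose a b \<circ> q) - 1)) (transpose a b \<circ> q) = mon (if b = a then x else 1) (transpose a b) * mon (x ^ (cyc A q - 1)) q"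
      by (simp add: mon_mult permutation_swap_id permutation_of_permutes[OF assms(1) q])
  qed
  also have "\<dots> = (\<Sum>b\<in>insert a A. mon (if b = a then x else 1) (transpose a b)) * cyc_elem A x"
    by (simp only: cyc_elem_def sum_product)
  also have "(\<Sum>b\<in>insert a A. mon (if b = a then x else 1) (transpose a b)) = sc x + jm a A"
  proof -
    have "(\<Sum>b\<in>A. mon (if b = a then x else 1) (transpose a b)) = jm a A"
      unfolding jm_def using assms(3) by (intro sum.cong) auto
    then show ?thesis
      by (simp only: insert_sum_transpose[OF assms(1,3), of "\<lambda>b. if b = a then x else 1"] if_True refl)
  qed
  finally show ?thesis .
qed

lemma sym_elem_insert:
  assumes "finite A" "a \<notin> A"
  shows "sym_elem (insert a A) = (1 + jm a A) * sym_elem A"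
    and "sym_elem (insert a A) = sym_elem A * (1 + jm a A)"
proof -
  have s: "1 + jm a A = (\<Sum>b\<in>insert a A. mon 1 (transpose a b))"
    using insert_sum_transpose[OF assms, of "\<lambda>_. 1"] by (simp add: jm_def sc_one)
  have "sym_elem (insert a A) = (\<Sum>b\<in>insert a A. \<Sum>q | q permutes A. mon 1 (transpose a b) * mon 1 q)"
    unfolding sym_elem_def sum_over_permutations_insert[OF assms]
    by (intro sum.cong refl) (simp add: mon_mult permutation_swap_id permutation_of_permutes[OF assms(1)])
  then show "sym_elem (insert a A) = (1 + jm a A) * sym_elem A"
    unfolding s sym_elem_def sum_product .
  have "sym_elem (insert a A) = (\<Sum>b\<in>insert a A. \<Sum>q | q permutes A. mon 1 q * mon 1 (transpose a b))"
    unfolding sym_elem_def sum_over_permutations_insert_right[OF assms]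
    by (intro sum.cong refl) (simp add: mon_mult permutation_swap_id permutation_of_permutes[OF assms(1)])
  then show "sym_elem (insert a A) = sym_elem A * (1 + jm a A)"
    unfolding s sym_elem_def sum_product by (subst sum.swap)
qed

lemma alt_elem_insert:
  assumes "finite A" "a \<notin> A"
  shows "alt_elem (insert a A) = (1 - jm a A) * alt_elem A"
    and "alt_elem (insert a A) = alt_elem A * (1 - jm a A)"
proof -
  have s: "1 - jm a A = (\<Sum>b\<in>insert a A. mon (of_int (sign (transpose a b))) (transpose a b))"
  proof -
    have "(\<Sum>b\<in>A. mon (of_int (sign (transpose a b))) (transpose a b)) = (\<Sum>b\<in>A. - mon 1 (transpose a b))"
      using assms by (intro sum.cong refl) (auto simp: sign_swap_id mon_def single_uminus)
    then show ?thesis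
      using insert_sum_transpose[OF assms, of "\<lambda>b. of_int (sign (transpose a b))"]
      by (simp add: jm_def sc_one sum_negf)
  qed
  have "alt_elem (insert a A) = (\<Sum>b\<in>insert a A. \<Sum>q | q permutes A. mon (of_int (sign (transpose a b))) (transpose a b) * mon (of_int (sign q)) q)"
    unfolding alt_elem_def sum_over_permutations_insert[OF assms]
    by (intro sum.cong refl) (simp add: mon_mult permutation_swap_id permutation_of_permutes[OF assms(1)] sign_compose)
  then show "alt_elem (insert a A) = (1 - jm a A) * alt_elem A"
    unfolding s alt_elem_def sum_product .
  have "alt_elem (insert a A) = (\<Sum>b\<in>insert a A. \<Sum>q | q permutes A. mon (of_int (sign q)) q * mon (of_int (sign (transpose a b))) (transpose a b))"
    unfolding alt_elem_def sum_over_permutations_insert_right[OF assms]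
    by (intro sum.cong refl) (simp add: mon_mult permutation_swap_id permutation_of_permutes[OF assms(1)] sign_compose)
  then show "alt_elem (insert a A) = alt_elem A * (1 - jm a A)"
    unfolding s alt_elem_def sum_product by (subst sum.swap)
qed

section \<open>Absorption and commutation rules\<close>

lemma mon_sym_elem:
  assumes "finite A" "p permutes A"
  shows "mon 1 p * sym_elem A = sym_elem A" "sym_elem A * mon 1 p = sym_elem A"
proof -
  have "mon 1 p * sym_elem A = (\<Sum>q | q permutes A. mon 1 (p \<circ> q))"
    unfolding sym_elem_def sum_distrib_left
    by (intro sum.cong refl) (simp add: mon_mult permutation_of_permutes[OF assms(1)] assms(2))
  then show "mon 1 p * sym_elem A = sym_elem A"
    unfolding sym_elem_def by (simp add: setum_permutations_compose_left[OF assms(2), symmetric, of "mon 1"])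
  have "sym_elem A * mon 1 p = (\<Sum>q | q permutes A. mon 1 (q \<circ> p))"
    unfolding sym_elem_def sum_distrib_right
    by (intro sum.cong refl) (simp add: mon_mult permutation_of_permutes[OF assms(1)] assms(2))
  then show "sym_elem A * mon 1 p = sym_elem A"
    unfolding sym_elem_def by (simp add: sum_permutations_compose_right[OF assms(2), symmetric, of "mon 1"])
qed

lemma alt_elem_transpose:
  assumes "finite A" "a \<in> A" "b \<in> A" "a \<noteq> b"
  shows "alt_elem A * mon 1 (transpose a b) = - alt_elem A"
proof -
  have t: "transpose a b permutes A" by (rule permutes_swap_id[OF assms(2,3)])
  have "alt_elem A * mon 1 (transpose a b) = (\<Sum>q | q permutes A. - mon (of_int (sign (q \<circ> transpose a b))) (q \<circ> transpose a b))"
    unfolding alt_elem_def sum_distrib_right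
    by (intro sum.cong refl)
      (simp add: mon_mult permutation_of_permutes[OF assms(1)] permutation_swap_id sign_compose sign_swap_id assms(4) mon_uminus)
  also have "\<dots> = - alt_elem A"
    unfolding alt_elem_def
    by (simp add: sum_negf sum_permutations_compose_right[OF t, symmetric, of "\<lambda>q. mon (of_int (sign q)) q"])
  finally show ?thesis .
qed

text \<open>Conjugation by \<open>p\<close>, which fixes \<open>a\<close>, permutes the
  transpositions \<open>transpose a b\<close> with \<open>b \<in> A\<close> among
  themselves.\<close>

lemma jm_commute:
  assumes "finite A" "p permutes A" "a \<notin> A"
  shows "mon c p * jm a A = jm a A * mon c p"
proof -
  have pa: "p a = a" using assms by (meson permutes_not_in)
  have pp: "permutation p" by (rule permutation_of_permutes[OF assms(1,2)])
  have "mon c p * jm a A = (\<Sum>b\<in>A. mon c (p \<circ> transpose a b))"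
    unfolding jm_def sum_distrib_left by (intro sum.cong refl) (simp add: mon_mult pp permutation_swap_id)
  also have "\<dots> = (\<Sum>b\<in>A. mon c (transpose a (p b) \<circ> p))"
  proof (intro sum.cong refl)
    fix b
    have "p \<circ> transpose a b = transpose (p a) (p b) \<circ> p"
      using permutes_inj[OF assms(2)] by (auto simp: fun_eq_iff Transposition.transpose_def inj_eq)
    then show "mon c (p \<circ> transpose a b) = mon c (transpose a (p b) \<circ> p)" by (simp add: pa)
  qed
  also have "\<dots> = (\<Sum>b\<in>A. mon c (transpose a b \<circ> p))"
    by (rule sum.reindex_bij_betw[OF permutes_imp_bij[OF assms(2)], of "\<lambda>b. mon c (transpose a b \<circ> p)"])
  also have "\<dots> = jm a A * mon c p"
    unfolding jm_def sum_distrib_right by (intro sum.cong refl) (simp add: mon_mult pp permutation_swap_id)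
  finally show ?thesis .
qed

lemma jm_alt_elem_commute:
  assumes "finite A" "B \<subseteq> A" "a \<notin> A"
  shows "alt_elem B * jm a A = jm a A * alt_elem B"
  unfolding alt_elem_def sum_distrib_left sum_distrib_right
  using jm_commute[OF assms(1) _ assms(3)] permutes_subset[OF _ assms(2)] by (intro sum.cong) auto

text \<open>The coefficients are a class function, used in the form that the two products of a pair
  of permutations have equally many cycles.\<close>

lemma cyc_elem_commute:
  assumes "finite A" "w permutes A"
  shows "mon c w * cyc_elem A x = cyc_elem A x * mon c w"
proof -
  have w: "permutation w" by (rule permutation_of_permutes[OF assms])
  have "mon c w * cyc_elem A x = (\<Sum>p | p permutes A. mon (c * x ^ (cyc A p - 1)) (w \<circ> p))"
    unfolding cyc_elem_def sum_distrib_left by (intro sum.cong refl) (simp add: mon_mult w permutation_of_permutes[OF assms(1)])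
  also have "\<dots> = (\<Sum>p | p permutes A. mon (c * x ^ (cyc A (inv w \<circ> p) - 1)) p)"
    by (subst setum_permutations_compose_left[OF assms(2), of "\<lambda>p. mon (c * x ^ (cyc A (inv w \<circ> p) - 1)) p"])
      (simp add: o_assoc permutes_inv_o[OF assms(2)])
  also have "\<dots> = (\<Sum>p | p permutes A. mon (c * x ^ (cyc A (p \<circ> inv w) - 1)) p)"
    by (intro sum.cong refl) (simp add: cyc_comp_commute[OF assms(1) permutes_inv[OF assms(2)]])
  also have "\<dots> = (\<Sum>p | p permutes A. mon (c * x ^ (cyc A p - 1)) (p \<circ> w))"
    by (subst sum_permutations_compose_right[OF assms(2), of "\<lambda>p. mon (c * x ^ (cyc A (p \<circ> inv w) - 1)) p"])
      (simp add: comp_assoc permutes_inv_o[OF assms(2)])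
  also have "\<dots> = cyc_elem A x * mon c w"
    unfolding cyc_elem_def sum_distrib_right by (intro sum.cong refl) (simp add: mon_mult w permutation_of_permutes[OF assms(1)] mult.commute)
  finally show ?thesis .
qed

lemma cyc_elem_alt_elem_commute:
  assumes "finite A" "B \<subseteq> A"
  shows "alt_elem B * cyc_elem A x = cyc_elem A x * alt_elem B"
  unfolding alt_elem_def sum_distrib_left sum_distrib_right
  using cyc_elem_commute[OF assms(1)] permutes_subset[OF _ assms(2)] by (intro sum.cong) auto

lemma cyc_elem_cyc_elem_commute:
  assumes "finite A"
  shows "cyc_elem A x * cyc_elem A y = cyc_elem A y * cyc_elem A x"
  unfolding cyc_elem_def[of A x] sum_distrib_left sum_distrib_right
  using cyc_elem_commute[OF assms(1)] by (intro sum.cong) auto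

lemma cyc_elem_singleton: "cyc_elem {a} x = 1"
  by (simp add: cyc_elem_def cyc_def mon_one)

lemma sym_elem_empty: "sym_elem {} = 1" and alt_elem_empty: "alt_elem {} = 1"
  by (simp_all add: sym_elem_def alt_elem_def mon_one)

lemma sym_elem_singleton: "sym_elem {a} = 1" and alt_elem_singleton: "alt_elem {a} = 1"
  by (simp_all add: sym_elem_def alt_elem_def mon_one)

section \<open>Action of the cycle elements on row and hook symmetrizers\<close>

lemma jm_sym_elem:
  assumes "finite A" "a \<notin> A"
  shows "jm a A * sym_elem (insert a A) = sc (of_nat (card A)) * sym_elem (insert a A)"
proof -
  have "jm a A * sym_elem (insert a A) = (\<Sum>b\<in>A. sym_elem (insert a A))"
    unfolding jm_def sum_distrib_right using assms
    by (intro sum.cong refl mon_sym_elem) (auto intro: permutes_swap_id)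
  then show ?thesis by (simp add: sc_of_nat)
qed

text \<open>The symmetrizer absorbs every transposition, so each factor \<open>sc x + jm a A\<close>
  acts as x plus the number of points already present.\<close>

lemma cyc_elem_sym_elem:
  assumes "finite A" "A \<noteq> {}"
  shows "cyc_elem A x * sym_elem A = sc (\<Prod>k=1..card A - 1. x + of_nat k) * sym_elem A"
  using assms
proof (induct A rule: finite_ne_induct)
  case (singleton a)
  then show ?case by (simp add: cyc_elem_singleton sym_elem_singleton sc_one)
next
  case (insert a A)
  let ?c = "\<Prod>k=1..card A - 1. x + of_nat k"
  obtain m where m: "card A = Suc m" using insert by (metis card_gt_0_iff gr0_implies_Suc)
  \<comment> \<open>The right-hand factorisation of \<open>sym_elem\<close> leaves
    \<open>sym_elem A\<close> next to \<open>cyc_elem A x\<close>, where the induction hypothesis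
    applies.\<close>
  have "cyc_elem (insert a A) x * sym_elem (insert a A) = (sc x + jm a A) * (cyc_elem A x * sym_elem A) * (1 + jm a A)"
    by (simp only: cyc_elem_insert[OF insert(1,2,3)] sym_elem_insert(2)[OF insert(1,3)] mult.assoc)
  also have "\<dots> = (sc x + jm a A) * (sc ?c * (sym_elem A * (1 + jm a A)))"
    by (simp only: insert(4) mult.assoc)
  also have "\<dots> = sc ?c * ((sc x + jm a A) * sym_elem (insert a A))"
    by (simp only: sym_elem_insert(2)[OF insert(1,3), symmetric] sc_left_commute)
  also have "(sc x + jm a A) * sym_elem (insert a A) = sc (x + of_nat (card A)) * sym_elem (insert a A)"
    by (simp only: distrib_right jm_sym_elem[OF insert(1,3)] sc_add)
  also have "sc ?c * (sc (x + of_nat (card A)) * sym_elem (insert a A)) = sc (?c * (x + of_nat (card A))) * sym_elem (insert a A)"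
    by (simp only: mult.assoc[symmetric] sc_mult)
  also have "?c * (x + of_nat (card A)) = (\<Prod>k=1..card (insert a A) - 1. x + of_nat k)"
    using insert by (simp add: m del: of_nat_Suc)
  finally show ?case .
qed

text \<open>For \<open>q \<in> A\<close> and \<open>a, q \<in> B\<close> the transposition \<open>(a b)\<close> conjugates \<open>(a q)\<close> to \<open>(b q)\<close>, so the
  product below equals its own negative.\<close>

lemma alt_transpose_sym_zero:
  assumes "finite A" "finite B" "q \<in> A" "q \<in> B" "a \<in> B" "a \<noteq> q" "b \<in> A" "b \<noteq> q" "b \<noteq> a"
  shows "alt_elem B * mon 1 (transpose a b) * sym_elem A = 0"
proof -
  let ?t = "\<lambda>a b. mon 1 (transpose a b)"
  have eq: "transpose a q \<circ> transpose a b = transpose a b \<circ> transpose b q"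
    using assms(6,8,9) by (auto simp: fun_eq_iff Transposition.transpose_def)
  have "- (alt_elem B * ?t a b * sym_elem A) = alt_elem B * ?t a q * ?t a b * sym_elem A"
    using alt_elem_transpose[OF assms(2,5,4,6)] by simp
  also have "\<dots> = alt_elem B * (?t a q * ?t a b) * sym_elem A" by (simp only: mult.assoc)
  also have "?t a q * ?t a b = ?t a b * ?t b q"
    by (simp add: mon_mult permutation_swap_id eq)
  also have "alt_elem B * (?t a b * ?t b q) * sym_elem A = alt_elem B * ?t a b * (?t b q * sym_elem A)"
    by (simp only: mult.assoc)
  also have "\<dots> = alt_elem B * ?t a b * sym_elem A"
    by (simp only: mon_sym_elem[OF assms(1) permutes_swap_id[OF assms(7,3)]])
  finally have "alt_elem B * ?t a b * sym_elem A + alt_elem B * ?t a b * sym_elem A = 0"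
    by (metis add.left_inverse)
  then have "of_nat 2 * (alt_elem B * ?t a b * sym_elem A) = 0" by (simp only: of_nat_numeral mult_2)
  then have "sc (1/2) * (sc (of_nat 2) * (alt_elem B * ?t a b * sym_elem A)) = 0" by (simp only: sc_of_nat mult_zero_right)
  then show ?thesis by (simp add: mult.assoc[symmetric] sc_mult sc_one)
qed

text \<open>The content product of a hook with leg \<open>r\<close> and arm \<open>s\<close>,
  without the corner box of content 0: the leg has contents -1, ..., -r and the arm 1, ...,
  s.\<close>

definition hook_eigenvalue :: "nat \<Rightarrow> nat \<Rightarrow> complex \<Rightarrow> complex" where
  "hook_eigenvalue r s x = (\<Prod>k=1..r. x - of_nat k) * (\<Prod>k=1..s. x + of_nat k)"

text \<open>The leg \<open>B\<close> grows one box at a time from the row \<open>A\<close>, with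
  \<open>q\<close> as the corner. The new Jucys-Murphy factor moves past
  \<open>alt_elem (insert q B)\<close>, whose permutations fix the new point \<open>a\<close>, so
  the induction hypothesis applies; afterwards it acts by the content of the new leg box.\<close>

lemma cyc_elem_hook:
  assumes "finite A" "finite B" "q \<in> A" "q \<notin> B" "A \<inter> B = {}"
  shows "alt_elem (insert q B) * cyc_elem (A \<union> B) x * sym_elem A =
    sc (hook_eigenvalue (card B) (card A - 1) x) * alt_elem (insert q B) * sym_elem A"
  using assms(2,4,5)
proof (induct B rule: finite_induct)
  case empty
  have "A \<noteq> {}" using assms by blast
  show ?case
    using cyc_elem_sym_elem[OF assms(1) \<open>A \<noteq> {}\<close>, of x] by (simp add: alt_elem_singleton hook_eigenvalue_def)
next
  case (insert a B)
  let ?c = "hook_eigenvalue (card B) (card A - 1) x"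
  let ?B = "insert q B" and ?B' = "insert q (insert a B)" and ?U = "A \<union> B"
  have disj: "A \<inter> B = {}" "a \<notin> A" "q \<notin> B" "a \<noteq> q" using insert by auto
  have U: "finite ?U" "?U \<noteq> {}" "a \<notin> ?U" "?B \<subseteq> ?U" using insert assms disj by auto
  have B: "finite ?B" "a \<notin> ?B" "?B' = insert a ?B" using insert disj by auto
  have IH: "alt_elem ?B * cyc_elem ?U x * sym_elem A = sc ?c * alt_elem ?B * sym_elem A"
    using insert(3) disj by blast
  have "alt_elem ?B' * cyc_elem (A \<union> insert a B) x * sym_elem A
      = (1 - jm a ?B) * (alt_elem ?B * (sc x + jm a ?U)) * cyc_elem ?U x * sym_elem A"
    using alt_elem_insert(1)[OF B(1,2)] cyc_elem_insert[OF U(1,2,3), of x] B(3) by (simp add: mult.assoc)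
  also have "alt_elem ?B * (sc x + jm a ?U) = (sc x + jm a ?U) * alt_elem ?B"
    using jm_alt_elem_commute[OF U(1,4,3)] sc_commute[of x "alt_elem ?B"] by (simp add: distrib_left distrib_right)
  also have "(1 - jm a ?B) * ((sc x + jm a ?U) * alt_elem ?B) * cyc_elem ?U x * sym_elem A
      = (1 - jm a ?B) * (sc x + jm a ?U) * (alt_elem ?B * cyc_elem ?U x * sym_elem A)"
    by (simp only: mult.assoc)
  also have "\<dots> = sc ?c * ((1 - jm a ?B) * ((sc x + jm a ?U) * alt_elem ?B) * sym_elem A)"
    unfolding IH by (simp only: mult.assoc sc_left_commute)
  also have "(sc x + jm a ?U) * alt_elem ?B = alt_elem ?B * (sc x + jm a ?U)"
    using jm_alt_elem_commute[OF U(1,4,3)] sc_commute[of x "alt_elem ?B"] by (simp add: distrib_left distrib_right)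
  also have "(1 - jm a ?B) * (alt_elem ?B * (sc x + jm a ?U)) = alt_elem ?B' * (sc x + jm a ?U)"
    using alt_elem_insert(1)[OF B(1,2)] B(3) by (simp add: mult.assoc)
  also have "alt_elem ?B' * (sc x + jm a ?U) * sym_elem A = sc (x - of_nat (Suc (card B))) * alt_elem ?B' * sym_elem A"
  proof -
    have Uspl: "?U = ?B \<union> (A - {q})" "?B \<inter> (A - {q}) = {}" using assms(3) disj by auto
    \<comment> \<open>Transpositions of \<open>a\<close> with points of the column \<open>?B\<close>
      each give the sign -1; those with \<open>A - {q}\<close> are annihilated between the column
      and the row.\<close>
    have "alt_elem ?B' * jm a ?U * sym_elem A = (\<Sum>b\<in>?U. alt_elem ?B' * mon 1 (transpose a b) * sym_elem A)"
      by (simp add: jm_def sum_distrib_left sum_distrib_right)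
    also have "\<dots> = (\<Sum>b\<in>?B. alt_elem ?B' * mon 1 (transpose a b) * sym_elem A) + (\<Sum>b\<in>A - {q}. alt_elem ?B' * mon 1 (transpose a b) * sym_elem A)"
      using Uspl B(1) assms(1) by (simp only: sum.union_disjoint finite_Diff)
    also have "(\<Sum>b\<in>A - {q}. alt_elem ?B' * mon 1 (transpose a b) * sym_elem A) = 0"
    proof (intro sum.neutral ballI)
      fix b assume "b \<in> A - {q}"
      then show "alt_elem ?B' * mon 1 (transpose a b) * sym_elem A = 0"
        using assms(1,3) B disj by (intro alt_transpose_sym_zero[where q = q]) auto
    qed
    also have "(\<Sum>b\<in>?B. alt_elem ?B' * mon 1 (transpose a b) * sym_elem A) = (\<Sum>b\<in>?B. - (alt_elem ?B' * sym_elem A))"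
    proof (intro sum.cong refl)
      fix b assume b: "b \<in> ?B"
      have "alt_elem ?B' * mon 1 (transpose a b) = - alt_elem ?B'"
        using b B by (intro alt_elem_transpose) auto
      then show "alt_elem ?B' * mon 1 (transpose a b) * sym_elem A = - (alt_elem ?B' * sym_elem A)" by simp
    qed
    also have "\<dots> = - (sc (of_nat (Suc (card B))) * alt_elem ?B' * sym_elem A)"
      using insert(1) disj by (simp add: sc_of_nat sc_add sc_one mult.assoc algebra_simps)
    finally have "alt_elem ?B' * jm a ?U * sym_elem A = - (sc (of_nat (Suc (card B))) * alt_elem ?B' * sym_elem A)" by simp
    then show ?thesis
      by (simp only: distrib_left distrib_right diff_conv_add_uminus sc_add sc_minus sc_commute[of x "alt_elem ?B'"] minus_mult_left)
  qed
  also have "sc ?c * (sc (x - of_nat (Suc (card B))) * alt_elem ?B' * sym_elem A) = sc (?c * (x - of_nat (Suc (card B)))) * alt_elem ?B' * sym_elem A"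
    by (simp only: mult.assoc[symmetric] sc_mult)
  also have "?c * (x - of_nat (Suc (card B))) = hook_eigenvalue (card (insert a B)) (card A - 1) x"
    using insert by (simp add: hook_eigenvalue_def)
  finally show ?case .
qed

text \<open>When a point \<open>a\<close> is adjoined, the term of \<open>S\<close> is replaced by
  those of \<open>S\<close> and \<open>insert a S\<close>, with factors
  \<open>1 + jm a (V - S)\<close> and \<open>- (1 - jm a (insert q S))\<close>. The constants cancel
  and the rest is \<open>jm a (insert q V)\<close>, the factor that \<open>cyc_elem_insert\<close>
  gives at x = 0.\<close>

lemma cyc_elem_0_expand:
  assumes "finite V" "q \<notin> V"
  shows "cyc_elem (insert q V) 0 = (\<Sum>S\<in>Pow V. sc ((-1) ^ card S) * (alt_elem (insert q S) * sym_elem (V - S)))"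
  using assms
proof (induct V rule: finite_induct)
  case empty
  then show ?case by (simp add: cyc_elem_singleton alt_elem_singleton sym_elem_empty sc_one)
next
  case (insert a V)
  let ?U = "insert q V"
  have U: "finite ?U" "?U \<noteq> {}" "a \<notin> ?U" "q \<notin> V" using insert by auto
  let ?f = "\<lambda>S. sc ((-1) ^ card S) * (alt_elem (insert q S) * sym_elem (V - S))"
  let ?g = "\<lambda>S. sc ((-1) ^ card S) * (alt_elem (insert q S) * sym_elem (insert a V - S))"
  have step: "?g S + ?g (insert a S) = jm a ?U * ?f S" if S: "S \<in> Pow V" for S
  proof -
    have fin: "finite S" "finite (V - S)" "a \<notin> S" "a \<notin> V - S" "a \<notin> insert q S" "finite (insert q S)"
      using S insert finite_subset U by auto
    have e1: "sym_elem (insert a V - S) = (1 + jm a (V - S)) * sym_elem (V - S)"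
      using sym_elem_insert(1)[OF fin(2,4)] fin(3) by (simp add: insert_Diff_if)
    have e2: "alt_elem (insert q (insert a S)) = (1 - jm a (insert q S)) * alt_elem (insert q S)"
      using alt_elem_insert(1)[OF fin(6,5)] by (simp add: insert_commute)
    have e3: "insert a V - insert a S = V - S" using fin by auto
    have e4: "jm a ?U = jm a (insert q S) + jm a (V - S)"
    proof -
      have "?U = insert q S \<union> (V - S)" "insert q S \<inter> (V - S) = {}" using S U by auto
      then show ?thesis unfolding jm_def using fin by (metis sum.union_disjoint)
    qed
    \<comment> \<open>A permutation of \<open>insert q S\<close> and a transposition of two points
      outside this set have disjoint supports.\<close>
    have e5: "alt_elem (insert q S) * jm a (V - S) = jm a (V - S) * alt_elem (insert q S)"
      unfolding alt_elem_def jm_def sum_product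
    proof (subst sum.swap, intro sum.cong refl)
      fix p b assume b: "b \<in> V - S" and "p \<in> {p. p permutes insert q S}"
      then have p: "p permutes insert q S" by simp
      have "p a = a" "p b = b" using b fin U by (auto intro!: permutes_not_in[OF p])
      moreover have "p x = p y \<longleftrightarrow> x = y" for x y
        by (rule inj_eq[OF permutes_inj[OF p]])
      ultimately have "p x = a \<longleftrightarrow> x = a" "p x = b \<longleftrightarrow> x = b" for x by metis+
      then have "p \<circ> transpose a b = transpose a b \<circ> p"
        using \<open>p a = a\<close> \<open>p b = b\<close> by (simp add: fun_eq_iff Transposition.transpose_def)
      then show "mon (of_int (sign p)) p * mon 1 (transpose a b) = mon 1 (transpose a b) * mon (of_int (sign p)) p"
        by (simp add: mon_mult permutation_swap_id permutation_of_permutes[OF fin(6) p])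
    qed
    have g1: "?g S = sc ((-1) ^ card S) * ((1 + jm a (V - S)) * (alt_elem (insert q S) * sym_elem (V - S)))"
      unfolding e1 using e5 by (simp add: mult.assoc[symmetric] distrib_left distrib_right)
    have g2: "?g (insert a S) = - (sc ((-1) ^ card S) * ((1 - jm a (insert q S)) * (alt_elem (insert q S) * sym_elem (V - S))))"
      unfolding e2 e3 using fin by (simp add: sc_minus mult.assoc)
    have "?g S + ?g (insert a S) = sc ((-1) ^ card S) * (jm a ?U * (alt_elem (insert q S) * sym_elem (V - S)))"
      unfolding g1 g2 e4 by (simp add: algebra_simps)
    also have "\<dots> = jm a ?U * ?f S"
      by (simp only: sc_left_commute)
    finally show ?thesis .
  qed
  have "(\<Sum>S\<in>Pow (insert a V). ?g S) = (\<Sum>S\<in>Pow V. ?g S) + (\<Sum>S\<in>insert a ` Pow V. ?g S)"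
    unfolding Pow_insert using insert by (intro sum.union_disjoint) auto
  also have "(\<Sum>S\<in>insert a ` Pow V. ?g S) = (\<Sum>S\<in>Pow V. ?g (insert a S))"
  proof (subst sum.reindex)
    show "inj_on (insert a) (Pow V)" using insert(2) by (auto simp: inj_on_def)
  qed simp
  also have "(\<Sum>S\<in>Pow V. ?g S) + (\<Sum>S\<in>Pow V. ?g (insert a S)) = jm a ?U * (\<Sum>S\<in>Pow V. ?f S)"
    unfolding sum.distrib[symmetric] sum_distrib_left by (rule sum.cong[OF refl step])
  also have "\<dots> = cyc_elem (insert q (insert a V)) 0"
    using insert(3)[OF U(4)] cyc_elem_insert[OF U(1-3), of 0] by (simp add: sc_zero insert_commute)
  finally show ?case ..
qed

text \<open>A group algebra form of the Pieri rule: a column times a disjoint row is an average of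
  hook symmetrizers. Enlarging the column subtracts, and enlarging the row adds, the terms with
  \<open>transpose p q\<close> for \<open>p \<in> T\<close> and \<open>q \<in> S\<close>, so these
  cancel in the total.\<close>

lemma alt_sym_hook_sum:
  assumes "finite S" "finite T" "S \<inter> T = {}"
  shows "(\<Sum>p\<in>T. alt_elem (insert p S) * sym_elem T) + (\<Sum>q\<in>S. alt_elem S * sym_elem (insert q T))
    = of_nat (card S + card T) * (alt_elem S * sym_elem T)"
proof -
  let ?m = "\<Sum>p\<in>T. \<Sum>q\<in>S. alt_elem S * mon 1 (transpose p q) * sym_elem T"
  have "(\<Sum>p\<in>T. alt_elem (insert p S) * sym_elem T) = (\<Sum>p\<in>T. alt_elem S * sym_elem T - (\<Sum>q\<in>S. alt_elem S * mon 1 (transpose p q) * sym_elem T))"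
  proof (intro sum.cong refl)
    fix p assume "p \<in> T"
    then have "p \<notin> S" using assms by blast
    then show "alt_elem (insert p S) * sym_elem T = alt_elem S * sym_elem T - (\<Sum>q\<in>S. alt_elem S * mon 1 (transpose p q) * sym_elem T)"
      by (simp add: alt_elem_insert(2)[OF assms(1)] right_diff_distrib left_diff_distrib jm_def sum_distrib_left sum_distrib_right)
  qed
  also have "\<dots> = of_nat (card T) * (alt_elem S * sym_elem T) - ?m" by (simp add: sum_subtractf)
  finally have 1: "(\<Sum>p\<in>T. alt_elem (insert p S) * sym_elem T) = of_nat (card T) * (alt_elem S * sym_elem T) - ?m" .
  have "(\<Sum>q\<in>S. alt_elem S * sym_elem (insert q T)) = (\<Sum>q\<in>S. alt_elem S * sym_elem T + (\<Sum>p\<in>T. alt_elem S * mon 1 (transpose p q) * sym_elem T))"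
  proof (intro sum.cong refl)
    fix q assume "q \<in> S"
    then have "q \<notin> T" using assms by blast
    then show "alt_elem S * sym_elem (insert q T) = alt_elem S * sym_elem T + (\<Sum>p\<in>T. alt_elem S * mon 1 (transpose p q) * sym_elem T)"
      by (simp add: sym_elem_insert(1)[OF assms(2)] distrib_left distrib_right jm_def sum_distrib_left sum_distrib_right
          mult.assoc transpose_commute[of q])
  qed
  also have "\<dots> = of_nat (card S) * (alt_elem S * sym_elem T) + ?m" by (simp add: sum.distrib) (rule sum.swap)
  finally show ?thesis using 1 by (simp add: distrib_right)
qed

text \<open>If \<open>c \<circ> r = id\<close> and \<open>r\<close> moves \<open>x\<close>, then
  \<open>x\<close> and \<open>r x\<close> are two distinct points of \<open>A \<inter> B\<close>;
  hence only the pair of identities contributes.\<close>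

lemma id_coeff_alt_sym:
  assumes "finite A" "finite B" "A \<inter> B \<subseteq> {q}"
  shows "id_coeff (alt_elem B * sym_elem A) = 1"
proof -
  have "id_coeff (alt_elem B * sym_elem A) = (\<Sum>c | c permutes B. \<Sum>r | r permutes A. id_coeff (mon (of_int (sign c)) (c \<circ> r)))"
    by (simp add: alt_elem_def sym_elem_def sum_product id_coeff_def lookup_sum mon_mult permutation_of_permutes[OF assms(1)] permutation_of_permutes[OF assms(2)])
  also have "\<dots> = (\<Sum>c | c permutes B. \<Sum>r | r permutes A. if c = id \<and> r = id then 1 else 0)"
  proof (intro sum.cong refl)
    fix c r assume "c \<in> {c. c permutes B}" "r \<in> {r. r permutes A}"
    then have c: "c permutes B" and r: "r permutes A" by auto
    have "c = id \<and> r = id" if cr: "c \<circ> r = id"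
    proof -
      have "r x = x" for x
      proof (rule ccontr)
        assume rx: "r x \<noteq> x"
        then have xA: "x \<in> A" using r by (meson permutes_not_in)
        then have rA: "r x \<in> A" using permutes_in_image[OF r] by simp
        have crx: "c (r x) = x" using cr by (metis comp_apply id_apply)
        then have rB: "r x \<in> B" using c rx by (metis permutes_not_in)
        then have "x \<in> B" using crx permutes_in_image[OF c] by metis
        then show False using xA rA rB rx assms(3) by auto
      qed
      then have "r = id" by auto
      then show ?thesis using cr by simp
    qed
    moreover have "permutation (c \<circ> r)"
      using permutation_of_permutes[OF assms(2) c] permutation_of_permutes[OF assms(1) r] by (rule permutation_compose)
    ultimately show "id_coeff (mon (of_int (sign c)) (c \<circ> r)) = (if c = id \<and> r = id then 1 else 0)"
      by (auto simp: id_coeff_mon)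
  qed
  also have "\<dots> = (\<Sum>c | c permutes B. if c = id then 1 else 0)"
  proof (intro sum.cong refl)
    fix c
    have "(\<Sum>r | r permutes A. if c = id \<and> r = id then 1 else 0) = (\<Sum>r | r permutes A. if r = id then (if c = id then 1 else 0) else 0 :: complex)"
      by (intro sum.cong) auto
    then show "(\<Sum>r | r permutes A. if c = id \<and> r = id then 1 else 0) = (if c = id then 1 else 0 :: complex)"
      using finite_permutations[OF assms(1)] permutes_id[of A] by (simp add: sum.delta)
  qed
  also have "\<dots> = 1" using finite_permutations[OF assms(2)] permutes_id[of B] by (simp add: sum.delta)
  finally show ?thesis .
qed

lemma id_coeff_sum: "id_coeff (\<Sum>i\<in>I. f i) = (\<Sum>i\<in>I. id_coeff (f i))"
  by (simp add: id_coeff_def lookup_sum)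

lemma id_coeff_add: "id_coeff (f + g) = id_coeff f + id_coeff g"
  by (simp add: id_coeff_def lookup_add)

lemma cyc_elem_mult_hook:
  assumes "finite A" "finite B" "q \<in> A" "q \<notin> B" "A \<inter> B = {}"
  shows "cyc_elem (A \<union> B) x * (alt_elem (insert q B) * sym_elem A) =
    sc (hook_eigenvalue (card B) (card A - 1) x) * (alt_elem (insert q B) * sym_elem A)"
proof -
  have "alt_elem (insert q B) * cyc_elem (A \<union> B) x = cyc_elem (A \<union> B) x * alt_elem (insert q B)"
    using assms by (intro cyc_elem_alt_elem_commute) auto
  then show ?thesis using cyc_elem_hook[OF assms, of x] by (simp add: mult.assoc)
qed

text \<open>Three of the four factors whose identity coefficient is sought; the fourth, again
  \<open>cyc_elem U 0\<close>, is the one to be expanded.\<close>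

definition cyc_triple :: "nat set \<Rightarrow> complex \<Rightarrow> complex \<Rightarrow> galg" where
  "cyc_triple U x y = cyc_elem U 0 * cyc_elem U x * cyc_elem U y"

definition hook_triple :: "nat \<Rightarrow> nat \<Rightarrow> complex \<Rightarrow> complex \<Rightarrow> complex" where
  "hook_triple r s x y = hook_eigenvalue r s 0 * hook_eigenvalue r s x * hook_eigenvalue r s y"

lemma id_coeff_cyc_triple_hook:
  assumes "finite A" "finite B" "q \<in> A" "q \<notin> B" "A \<inter> B = {}"
  shows "id_coeff (cyc_triple (A \<union> B) x y * (alt_elem (insert q B) * sym_elem A)) =
    hook_triple (card B) (card A - 1) x y"
proof -
  define F where "F = alt_elem (insert q B) * sym_elem A"
  let ?e = "hook_eigenvalue (card B) (card A - 1)"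
  have X: "cyc_elem (A \<union> B) z * (sc c * F) = sc (c * ?e z) * F" for z c
    using cyc_elem_mult_hook[OF assms, of z]
    by (simp add: F_def[symmetric] sc_left_commute[of "cyc_elem (A \<union> B) z"]) (simp add: mult.assoc[symmetric] sc_mult)
  have "cyc_triple (A \<union> B) x y * F = cyc_elem (A \<union> B) 0 * (cyc_elem (A \<union> B) x * (cyc_elem (A \<union> B) y * (sc 1 * F)))"
    by (simp add: cyc_triple_def mult.assoc sc_one)
  also have "\<dots> = sc (hook_triple (card B) (card A - 1) x y) * F"
    unfolding X hook_triple_def by (simp add: mult_ac)
  finally have "cyc_triple (A \<union> B) x y * (alt_elem (insert q B) * sym_elem A) =
    sc (hook_triple (card B) (card A - 1) x y) * (alt_elem (insert q B) * sym_elem A)"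
    unfolding F_def .
  moreover have "id_coeff (alt_elem (insert q B) * sym_elem A) = 1"
    using assms by (intro id_coeff_alt_sym[where q = q]) auto
  ultimately show ?thesis by (simp add: id_coeff_sc_mult)
qed

text \<open>Averaging reduces to the two neighbouring hooks, with legs \<open>card S\<close> and
  \<open>card S - 1\<close>. For empty \<open>T\<close> the truncated \<open>card T - 1\<close> is
  multiplied by 0.\<close>

lemma id_coeff_cyc_triple_alt_sym:
  assumes "finite S" "finite T" "S \<inter> T = {}" "S \<noteq> {}"
  shows "of_nat (card S + card T) * id_coeff (cyc_triple (S \<union> T) x y * (alt_elem S * sym_elem T)) =
    of_nat (card T) * hook_triple (card S) (card T - 1) x y + of_nat (card S) * hook_triple (card S - 1) (card T) x y"
proof -
  let ?Z = "cyc_triple (S \<union> T) x y"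
  have 1: "id_coeff (?Z * (alt_elem (insert p S) * sym_elem T)) = hook_triple (card S) (card T - 1) x y" if "p \<in> T" for p
  proof -
    have "p \<notin> S" "T \<inter> S = {}" using that assms by auto
    then show ?thesis using id_coeff_cyc_triple_hook[OF assms(2,1) that, of x y] by (simp add: Un_commute)
  qed
  have 2: "id_coeff (?Z * (alt_elem S * sym_elem (insert q T))) = hook_triple (card S - 1) (card T) x y" if "q \<in> S" for q
  proof -
    have e: "insert q T \<union> (S - {q}) = S \<union> T" "insert q (S - {q}) = S" "insert q T \<inter> (S - {q}) = {}"
      using that assms by auto
    have e': "card (S - {q}) = card S - 1" "card (insert q T) - 1 = card T"
    proof -
      have "q \<notin> T" using that assms by auto
      then show "card (S - {q}) = card S - 1" "card (insert q T) - 1 = card T"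
        using that assms by (simp_all add: card_Diff_singleton)
    qed
    have "finite (insert q T)" "finite (S - {q})" "q \<in> insert q T" "q \<notin> S - {q}" using assms by auto
    from id_coeff_cyc_triple_hook[OF this e(3), of x y] show ?thesis by (simp only: e e')
  qed
  have "of_nat (card S + card T) * id_coeff (?Z * (alt_elem S * sym_elem T)) = id_coeff (sc (of_nat (card S + card T)) * (?Z * (alt_elem S * sym_elem T)))"
    by (simp only: id_coeff_sc_mult)
  also have "sc (of_nat (card S + card T)) * (?Z * (alt_elem S * sym_elem T)) = ?Z * (of_nat (card S + card T) * (alt_elem S * sym_elem T))"
    by (simp only: sc_left_commute[symmetric] sc_of_nat[symmetric])
  also have "\<dots> = (\<Sum>p\<in>T. ?Z * (alt_elem (insert p S) * sym_elem T)) + (\<Sum>q\<in>S. ?Z * (alt_elem S * sym_elem (insert q T)))"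
    unfolding alt_sym_hook_sum[OF assms(1-3), symmetric] by (simp add: distrib_left sum_distrib_left)
  finally show ?thesis by (simp add: id_coeff_add id_coeff_sum 1 2)
qed

section \<open>Summation over the hooks\<close>

lemma hook_eigenvalue_0: "hook_eigenvalue r s 0 = (-1) ^ r * fact r * fact s"
proof -
  have "(\<Prod>k=1..r. - complex_of_nat k) = (-1) ^ r * fact r"
    by (simp add: prod_uminus fact_prod)
  then show ?thesis by (simp add: hook_eigenvalue_def fact_prod)
qed

lemma sum_card_Pow:
  fixes f :: "nat \<Rightarrow> complex"
  assumes "finite V"
  shows "(\<Sum>S\<in>Pow V. f (card S)) = (\<Sum>m=0..card V. of_nat (card V choose m) * f m)"
proof -
  have "(\<Sum>S\<in>Pow V. f (card S)) = (\<Sum>m\<in>{0..card V}. \<Sum>S\<in>{S \<in> Pow V. card S = m}. f (card S))"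
    using assms by (intro sum.group[symmetric]) (auto intro: card_mono)
  also have "\<dots> = (\<Sum>m=0..card V. of_nat (card V choose m) * f m)"
  proof (intro sum.cong refl)
    fix m
    have "(\<Sum>S\<in>{S \<in> Pow V. card S = m}. f (card S)) = of_nat (card {S \<in> Pow V. card S = m}) * f m" by simp
    also have "{S \<in> Pow V. card S = m} = {S. S \<subseteq> V \<and> card S = m}" by auto
    finally show "(\<Sum>S\<in>{S \<in> Pow V. card S = m}. f (card S)) = of_nat (card V choose m) * f m"
      using n_subsets[OF assms] by simp
  qed
  finally show ?thesis .
qed

text \<open>By \<open>(N choose m) * (N - m) = (N choose Suc m) * Suc m\<close>, shifting the first
  part gives \<open>t m\<close> the factor -m next to its signed binomial, while the second part has
  m + 1 there; a single binomial remains. The value \<open>t (Suc N)\<close> has coefficient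
  0.\<close>

lemma hook_sum_telescope:
  fixes t :: "nat \<Rightarrow> complex"
  shows "(\<Sum>m=0..N. of_nat (N choose m) * ((-1) ^ m * (of_nat (N - m) * t (Suc m) + of_nat (Suc m) * t m))) =
    (\<Sum>m=0..N. (-1) ^ m * of_nat (N choose m) * t m)"
proof -
  have "(\<Sum>m=0..N. of_nat (N choose m) * ((-1) ^ m * (of_nat (N - m) * t (Suc m) + of_nat (Suc m) * t m))) =
     (\<Sum>m=0..N. (-1) ^ m * of_nat ((N choose m) * (N - m)) * t (Suc m)) + (\<Sum>m=0..N. (-1) ^ m * of_nat ((N choose m) * Suc m) * t m)"
    by (simp add: sum.distrib[symmetric] algebra_simps)
  also have "(\<Sum>m=0..N. (-1) ^ m * of_nat ((N choose m) * (N - m)) * t (Suc m)) = (\<Sum>m=0..N. (-1) ^ m * of_nat ((N choose Suc m) * Suc m) * t (Suc m))"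
    by (intro sum.cong refl) (metis binomial_absorb_comp binomial_absorption mult.commute)
  also have "\<dots> = (\<Sum>m=0..Suc N. - ((-1) ^ m) * of_nat ((N choose m) * m) * t m)"
    by (subst sum.atLeast0_atMost_Suc_shift) (simp add: algebra_simps)
  also have "\<dots> = (\<Sum>m=0..N. - ((-1) ^ m) * of_nat ((N choose m) * m) * t m)"
    by (simp add: binomial_eq_0)
  finally show ?thesis
    by (simp add: sum.distrib[symmetric] algebra_simps)
qed

text \<open>For a subset \<open>S\<close>, the column \<open>insert n S\<close> and the row of the
  remaining points involve the hooks with legs \<open>card S\<close> and \<open>card S + 1\<close>.
  The contributions depend on \<open>card S\<close> only, and neighbouring sizes telescope.\<close>

lemma id_coeff_cyc_elems:
  assumes "n \<ge> 1"
  shows "id_coeff (cyc_elem {1..n} 0 * cyc_elem {1..n} x * cyc_elem {1..n} y * cyc_elem {1..n} 0) =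
    fact (n - 1) / of_nat n * (\<Sum>r=0..n - 1. hook_eigenvalue r (n - 1 - r) x * hook_eigenvalue r (n - 1 - r) y)"
proof -
  let ?U = "{1..n}" and ?V = "{1..n} - {n}"
  let ?t = "\<lambda>r. hook_triple r (n - 1 - r) x y"
  have V: "finite ?V" "n \<notin> ?V" "insert n ?V = ?U" "card ?V = n - 1" using assms by auto
  have L: "of_nat n * id_coeff (cyc_triple ?U x y * (alt_elem (insert n S) * sym_elem (?V - S))) =
      of_nat (n - 1 - card S) * ?t (Suc (card S)) + of_nat (Suc (card S)) * ?t (card S)" if S: "S \<in> Pow ?V" for S
  proof -
    have fin: "finite S" "n \<notin> S" "card S \<le> n - 1"
      using S V card_mono[OF V(1), of S] by (auto intro: finite_subset)
    have c: "card (?V - S) = n - 1 - card S" using S V fin by (simp add: card_Diff_subset)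
    have U: "insert n S \<union> (?V - S) = ?U" and disj: "insert n S \<inter> (?V - S) = {}" using S assms by auto
    have c': "card (insert n S) = Suc (card S)" using fin by simp
    have c'': "Suc (card S) + (n - 1 - card S) = n" "n - 1 - card S - 1 = n - 1 - Suc (card S)" "Suc (card S) - 1 = card S"
      using fin assms by auto
    have "finite (insert n S)" "finite (?V - S)" "insert n S \<noteq> {}" using fin by auto
    from id_coeff_cyc_triple_alt_sym[OF this(1,2) disj this(3), of x y]
    have "of_nat (Suc (card S) + (n - 1 - card S)) * id_coeff (cyc_triple ?U x y * (alt_elem (insert n S) * sym_elem (?V - S))) =
      of_nat (n - 1 - card S) * hook_triple (Suc (card S)) (n - 1 - card S - 1) x y + of_nat (Suc (card S)) * hook_triple (Suc (card S) - 1) (n - 1 - card S) x y"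
      by (simp only: U c c')
    then show ?thesis by (simp only: c'')
  qed
  have "of_nat n * id_coeff (cyc_triple ?U x y * cyc_elem ?U 0) =
     of_nat n * (\<Sum>S\<in>Pow ?V. (-1) ^ card S * id_coeff (cyc_triple ?U x y * (alt_elem (insert n S) * sym_elem (?V - S))))"
  proof -
    have "cyc_elem ?U 0 = (\<Sum>S\<in>Pow ?V. sc ((-1) ^ card S) * (alt_elem (insert n S) * sym_elem (?V - S)))"
      using cyc_elem_0_expand[OF V(1,2)] V(3) by simp
    then show ?thesis
      by (simp only: sum_distrib_left[of "cyc_triple ?U x y"] sc_left_commute id_coeff_sum id_coeff_sc_mult)
  qed
  also have "\<dots> = (\<Sum>S\<in>Pow ?V. (-1) ^ card S * (of_nat n * id_coeff (cyc_triple ?U x y * (alt_elem (insert n S) * sym_elem (?V - S)))))"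
    by (simp add: sum_distrib_left mult.left_commute)
  also have "\<dots> = (\<Sum>S\<in>Pow ?V. (-1) ^ card S * (of_nat (n - 1 - card S) * ?t (Suc (card S)) + of_nat (Suc (card S)) * ?t (card S)))"
    by (intro sum.cong refl) (simp only: L)
  also have "\<dots> = (\<Sum>m=0..n - 1. of_nat (n - 1 choose m) * ((-1) ^ m * (of_nat (n - 1 - m) * ?t (Suc m) + of_nat (Suc m) * ?t m)))"
    using sum_card_Pow[OF V(1), of "\<lambda>c. (-1) ^ c * (of_nat (n - 1 - c) * ?t (Suc c) + of_nat (Suc c) * ?t c)"]
    unfolding V(4) .
  also have "\<dots> = (\<Sum>m=0..n - 1. (-1) ^ m * of_nat (n - 1 choose m) * ?t m)"
    by (rule hook_sum_telescope)
  \<comment> \<open>The eigenvalue at 0 is (-1)^r r! (n-1-r)!, which cancels both the sign and the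
    denominator of the binomial coefficient.\<close>
  also have "\<dots> = (\<Sum>r=0..n - 1. fact (n - 1) * (hook_eigenvalue r (n - 1 - r) x * hook_eigenvalue r (n - 1 - r) y))"
  proof (intro sum.cong refl)
    fix r assume "r \<in> {0..n - 1}"
    have b: "of_nat (n - 1 choose r) * fact r * fact (n - 1 - r) = (fact (n - 1) :: complex)"
    proof -
      have "fact r * fact (n - 1 - r) * (n - 1 choose r) = (fact (n - 1) :: nat)"
        using binomial_fact_lemma[of r "n - 1"] \<open>r \<in> {0..n - 1}\<close> by simp
      then have "of_nat (fact r * fact (n - 1 - r) * (n - 1 choose r)) = (of_nat (fact (n - 1)) :: complex)"
        by (simp only:)
      then show ?thesis by (simp add: mult_ac)
    qed
    have s: "(-1) ^ r * (-1) ^ r = (1 :: complex)" by (simp add: power_mult_distrib[symmetric])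
    have "(-1) ^ r * of_nat (n - 1 choose r) * ?t r = ((-1) ^ r * (-1) ^ r) * (of_nat (n - 1 choose r) * fact r * fact (n - 1 - r)) * (hook_eigenvalue r (n - 1 - r) x * hook_eigenvalue r (n - 1 - r) y)"
      by (simp only: hook_triple_def hook_eigenvalue_0 mult_ac)
    then show "(-1) ^ r * of_nat (n - 1 choose r) * ?t r = fact (n - 1) * (hook_eigenvalue r (n - 1 - r) x * hook_eigenvalue r (n - 1 - r) y)"
      by (simp only: b s mult_1)
  qed
  finally have "of_nat n * id_coeff (cyc_triple ?U x y * cyc_elem ?U 0) = fact (n - 1) * (\<Sum>r=0..n - 1. hook_eigenvalue r (n - 1 - r) x * hook_eigenvalue r (n - 1 - r) y)"
    by (simp add: sum_distrib_left)
  moreover have "of_nat n \<noteq> (0 :: complex)" using assms by simp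
  ultimately show ?thesis by (simp add: cyc_triple_def field_simps)
qed

text \<open>The contents of the hook are the consecutive integers -r, ..., n-1-r. With the corner
  factor \<open>x\<close> restored, the content product is a falling factorial of length n starting
  at x + (n-1-r). It is formed in \<open>complex\<close>, so a small \<open>x\<close> gives a zero
  factor instead of a truncation.\<close>

lemma hook_eigenvalue_binomial:
  assumes "n \<ge> 1" "r \<le> n - 1"
  shows "of_nat x * hook_eigenvalue r (n - 1 - r) (of_nat x) = fact n * of_nat ((x + (n - 1 - r)) choose n)"
proof -
  let ?m = "x + (n - 1 - r)"
  have "of_nat (?m choose n) * fact n = (\<Prod>i=0..<n. of_nat ?m - of_nat i :: complex)"
    by (metis binomial_gbinomial gbinomial_mult_fact' mult.commute)
  also have "\<dots> = (\<Prod>i\<in>{0..<n - 1 - r} \<union> {n - 1 - r} \<union> {n - r..<n}. of_nat ?m - of_nat i)"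
  proof -
    have "{0..<n} = {0..<n - 1 - r} \<union> {n - 1 - r} \<union> {n - r..<n}" using assms by auto
    then show ?thesis by simp
  qed
  also have "\<dots> = (\<Prod>i=0..<n - 1 - r. of_nat ?m - of_nat i) * of_nat x * (\<Prod>i=n - r..<n. of_nat ?m - of_nat i :: complex)"
    using assms by (subst prod.union_disjoint; (subst prod.union_disjoint)?) auto
  also have "(\<Prod>i=0..<n - 1 - r. of_nat ?m - of_nat i) = (\<Prod>k=1..n - 1 - r. of_nat x + of_nat k :: complex)"
    by (rule prod.reindex_bij_witness[of _ "\<lambda>k. n - 1 - r - k" "\<lambda>i. n - 1 - r - i"]) (auto simp: of_nat_diff)
  also have "(\<Prod>i=n - r..<n. of_nat ?m - of_nat i) = (\<Prod>k=1..r. of_nat x - of_nat k :: complex)"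
    using assms by (intro prod.reindex_bij_witness[of _ "\<lambda>k. n - 1 - r + k" "\<lambda>i. i - (n - 1 - r)"]) (auto simp: of_nat_diff)
  finally show ?thesis by (simp add: hook_eigenvalue_def mult_ac)
qed

section \<open>Identity coefficients as sums over permutations\<close>

lemma cyc_elem_mult:
  assumes "finite U" "U \<noteq> {}"
  shows "cyc_elem U 0 * cyc_elem U x =
    (\<Sum>g | g permutes U. mon (\<Sum>s | s permutes U \<and> cyc U s = 1. x ^ (cyc U (inv s \<circ> g) - 1)) g)"
proof -
  let ?P = "{p. p permutes U}"
  \<comment> \<open>With \<open>0 ^ 0 = 1\<close>, the coefficients of \<open>cyc_elem U 0\<close>
    are the indicator of the cycles of full length.\<close>
  have z: "0 ^ (cyc U s - 1) = (if cyc U s = 1 then 1 else 0 :: complex)" for s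
    using cyc_pos[OF assms, of s] by (auto simp: power_0_left)
  have "cyc_elem U 0 * cyc_elem U x = (\<Sum>s\<in>?P. \<Sum>g\<in>?P. mon (0 ^ (cyc U s - 1) * x ^ (cyc U g - 1)) (s \<circ> g))"
    unfolding cyc_elem_def sum_product by (intro sum.cong refl) (simp add: mon_mult permutation_of_permutes[OF assms(1)])
  also have "\<dots> = (\<Sum>s\<in>?P. \<Sum>g\<in>?P. mon (0 ^ (cyc U s - 1) * x ^ (cyc U (inv s \<circ> g) - 1)) g)"
  proof (rule sum.cong[OF refl])
    fix s assume "s \<in> ?P"
    then have s: "s permutes U" by simp
    show "(\<Sum>g\<in>?P. mon (0 ^ (cyc U s - 1) * x ^ (cyc U g - 1)) (s \<circ> g)) = (\<Sum>g\<in>?P. mon (0 ^ (cyc U s - 1) * x ^ (cyc U (inv s \<circ> g) - 1)) g)"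
      by (subst setum_permutations_compose_left[OF s, of "\<lambda>g. mon (0 ^ (cyc U s - 1) * x ^ (cyc U (inv s \<circ> g) - 1)) g"])
        (simp add: o_assoc permutes_inv_o[OF s])
  qed
  also have "\<dots> = (\<Sum>g\<in>?P. \<Sum>s\<in>?P. mon (0 ^ (cyc U s - 1) * x ^ (cyc U (inv s \<circ> g) - 1)) g)"
    by (rule sum.swap)
  also have "\<dots> = (\<Sum>g\<in>?P. mon (\<Sum>s\<in>?P. 0 ^ (cyc U s - 1) * x ^ (cyc U (inv s \<circ> g) - 1)) g)"
  proof -
    have "(\<Sum>s\<in>T. mon (f s) g) = mon (\<Sum>s\<in>T. f s) g" if "finite T" for T :: "(nat \<Rightarrow> nat) set" and f g
      using that by induct (simp_all add: mon_add, simp add: mon_def)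
    then show ?thesis using finite_permutations[OF assms(1)] by simp
  qed
  also have "\<dots> = (\<Sum>g\<in>?P. mon (\<Sum>s | s permutes U \<and> cyc U s = 1. x ^ (cyc U (inv s \<circ> g) - 1)) g)"
  proof (rule sum.cong[OF refl])
    fix g
    have "(\<Sum>s\<in>?P. 0 ^ (cyc U s - 1) * x ^ (cyc U (inv s \<circ> g) - 1)) = (\<Sum>s\<in>?P. if cyc U s = 1 then x ^ (cyc U (inv s \<circ> g) - 1) else 0)"
      unfolding z by (intro sum.cong) auto
    also have "\<dots> = (\<Sum>s | s permutes U \<and> cyc U s = 1. x ^ (cyc U (inv s \<circ> g) - 1))"
      using finite_permutations[OF assms(1)] by (subst sum.inter_filter[symmetric]) auto
    finally show "mon (\<Sum>s\<in>?P. 0 ^ (cyc U s - 1) * x ^ (cyc U (inv s \<circ> g) - 1)) g = mon (\<Sum>s | s permutes U \<and> cyc U s = 1. x ^ (cyc U (inv s \<circ> g) - 1)) g"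
      by simp
  qed
  finally show ?thesis .
qed

lemma id_coeff_mult_sums:
  assumes "finite U"
  shows "id_coeff ((\<Sum>g | g permutes U. mon (a g) g) * (\<Sum>g | g permutes U. mon (b g) g)) =
    (\<Sum>g | g permutes U. a g * b (inv g))"
proof -
  let ?P = "{p. p permutes U}"
  have "id_coeff ((\<Sum>g\<in>?P. mon (a g) g) * (\<Sum>g\<in>?P. mon (b g) g)) = (\<Sum>g\<in>?P. \<Sum>h\<in>?P. if h = inv g then a g * b h else 0)"
    unfolding sum_product id_coeff_sum
  proof (intro sum.cong refl)
    fix g h assume "g \<in> ?P" "h \<in> ?P"
    then have g: "g permutes U" and h: "h permutes U" by auto
    have "g \<circ> h = id \<longleftrightarrow> h = inv g"
      using permutes_inv_o[OF g] by (metis comp_assoc comp_id id_comp)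
    moreover have "permutation (g \<circ> h)" by (intro permutation_compose permutation_of_permutes[OF assms] g h)
    ultimately show "id_coeff (mon (a g) g * mon (b h) h) = (if h = inv g then a g * b h else 0)"
      by (simp add: mon_mult permutation_of_permutes[OF assms] g h id_coeff_mon)
  qed
  also have "\<dots> = (\<Sum>g\<in>?P. a g * b (inv g))"
  proof (intro sum.cong refl)
    fix g assume "g \<in> ?P"
    then have "inv g \<in> ?P" using permutes_inv by auto
    then show "(\<Sum>h\<in>?P. if h = inv g then a g * b h else 0) = a g * b (inv g)"
      using finite_permutations[OF assms] by (simp add: sum.delta)
  qed
  finally show ?thesis .
qed

text \<open>The cycle elements commute, so the last factor can join the third, and two products of
  the same form arise. The identity coefficient pairs their coefficients at \<open>g\<close> and
  \<open>inv g\<close>; the latter equals that at \<open>g\<close>, because inversion preserves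
  cycle numbers and permutes the full cycles.\<close>

lemma id_coeff_cyc_elems_expand:
  assumes "finite U" "U \<noteq> {}"
  shows "id_coeff (cyc_elem U 0 * cyc_elem U x * cyc_elem U y * cyc_elem U 0) =
    (\<Sum>g | g permutes U. (\<Sum>s | s permutes U \<and> cyc U s = 1. x ^ (cyc U (inv s \<circ> g) - 1)) *
       (\<Sum>s | s permutes U \<and> cyc U s = 1. y ^ (cyc U (inv s \<circ> g) - 1)))"
proof -
  let ?N = "{s. s permutes U \<and> cyc U s = 1}"
  have "cyc_elem U 0 * cyc_elem U x * cyc_elem U y * cyc_elem U 0 = (cyc_elem U 0 * cyc_elem U x) * (cyc_elem U 0 * cyc_elem U y)"
    using cyc_elem_cyc_elem_commute[OF assms(1), of y 0] by (simp add: mult.assoc)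
  moreover have "(\<Sum>s\<in>?N. y ^ (cyc U (inv s \<circ> inv g) - 1)) = (\<Sum>s\<in>?N. y ^ (cyc U (inv s \<circ> g) - 1))"
    if g: "g permutes U" for g
  proof -
    have "(\<Sum>s\<in>?N. y ^ (cyc U (inv s \<circ> inv g) - 1)) = (\<Sum>s\<in>?N. y ^ (cyc U (s \<circ> g) - 1))"
    proof (intro sum.cong refl)
      fix s assume "s \<in> ?N"
      then have s: "s permutes U" by simp
      have "inv s \<circ> inv g = inv (g \<circ> s)"
        using o_inv_distrib[OF permutes_bij[OF g] permutes_bij[OF s]] by simp
      then have "cyc U (inv s \<circ> inv g) = cyc U (s \<circ> g)"
        using cyc_inv[OF assms(1) permutes_compose[OF s g]] cyc_comp_commute[OF assms(1) g s] by simp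
      then show "y ^ (cyc U (inv s \<circ> inv g) - 1) = y ^ (cyc U (s \<circ> g) - 1)" by simp
    qed
    also have "\<dots> = (\<Sum>s\<in>?N. y ^ (cyc U (inv s \<circ> g) - 1))"
      by (rule sum.reindex_bij_witness[of _ inv inv])
        (auto simp: permutes_inv permutes_inv_inv cyc_inv[OF assms(1)])
    finally show ?thesis .
  qed
  ultimately show ?thesis
    by (simp add: cyc_elem_mult[OF assms] id_coeff_mult_sums[OF assms(1)])
qed

section \<open>The bracket of powers of the number of cycles\<close>

text \<open>Induction on the set: the new point cannot be a cycle by itself, and it can be spliced
  into a full cycle before any of the \<open>card A\<close> old points.\<close>

lemma card_single_cycles:
  assumes "finite A" "A \<noteq> {}"
  shows "card {p. p permutes A \<and> cyc A p = 1} = fact (card A - 1)"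
  using assms
proof (induct A rule: finite_ne_induct)
  case (singleton a)
  have "{p. p permutes {a} \<and> cyc {a} p = 1} = {id}" by (auto simp: cyc_def)
  then show ?case by simp
next
  case (insert a A)
  have c: "card {p. p permutes U \<and> cyc U p = 1} = (\<Sum>p | p permutes U. if cyc U p = 1 then 1 else 0)"
    if "finite U" for U :: "'a set"
    using sum.inter_filter[OF finite_permutations[OF that], of "\<lambda>_. 1::nat" "\<lambda>p. cyc U p = 1"] by simp
  have "card {p. p permutes insert a A \<and> cyc (insert a A) p = 1} =
      (\<Sum>b\<in>insert a A. \<Sum>q | q permutes A. if cyc (insert a A) (transpose a b \<circ> q) = 1 then 1 else 0)"
    using insert(1) by (subst c) (simp_all only: finite_insert sum_over_permutations_insert[OF insert(1,3)])
  also have "\<dots> = (\<Sum>b\<in>insert a A. if b = a then 0 else card {p. p permutes A \<and> cyc A p = 1})"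
  proof (rule sum.cong[OF refl])
    fix b assume b: "b \<in> insert a A"
    show "(\<Sum>q | q permutes A. if cyc (insert a A) (transpose a b \<circ> q) = 1 then 1 else 0) = (if b = a then 0 else card {p. p permutes A \<and> cyc A p = 1})"
    proof (cases "b = a")
      case True
      have "cyc (insert a A) (transpose a b \<circ> q) \<noteq> 1" if "q permutes A" for q
        using True cyc_insert_fixed[OF insert(1,3) that] cyc_pos[OF insert(1,2), of q] by simp
      then show ?thesis using True by simp
    next
      case False
      then have "b \<in> A" using b by simp
      have "(\<Sum>q | q permutes A. if cyc (insert a A) (transpose a b \<circ> q) = 1 then 1 else 0) = (\<Sum>q | q permutes A. if cyc A q = 1 then 1 else (0::nat))"
        by (rule sum.cong[OF refl]) (simp only: mem_Collect_eq cyc_insert_transpose[OF insert(1,3) _ \<open>b \<in> A\<close>])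
      then show ?thesis using False c[OF insert(1)] by simp
    qed
  qed
  also have "\<dots> = (\<Sum>b\<in>A. card {p. p permutes A \<and> cyc A p = 1})"
  proof -
    have "(\<Sum>b\<in>A. if b = a then 0 else card {p. p permutes A \<and> cyc A p = 1}) = (\<Sum>b\<in>A. card {p. p permutes A \<and> cyc A p = 1})"
      using insert(3) by (intro sum.cong) auto
    then show ?thesis using insert by simp
  qed
  also have "\<dots> = card A * fact (card A - 1)" using insert(4) by simp
  also have "\<dots> = fact (card (insert a A) - 1)"
    using insert by (simp add: fact_reduce card_gt_0_iff)
  finally show ?case .
qed

lemma finite_symgrp: "finite (symgrp n)"
  by (simp add: symgrp_def finite_permutations)

lemma card_symgrp: "card (symgrp n) = fact n"
  unfolding symgrp_def by (rule card_permutations) simp_all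

lemma cycle_class_1: "cycle_class n 1 = {p. p permutes {1..n} \<and> cyc {1..n} p = 1}"
  by (auto simp: cycle_class_def symgrp_def num_cycles_eq_cyc)

text \<open>A translated class is a level set: \<open>g\<close> lies in the translate by \<sigma>
  when \<open>inv \<sigma> \<circ> g\<close> has \<open>i\<close> cycles. Each random cycle is
  uniform among (n-1)! choices, hence the square in the denominator.\<close>

lemma expected_overlap_eq:
  assumes "n \<ge> 1"
  shows "expected_overlap n i j = (\<Sum>\<sigma>\<in>cycle_class n 1. \<Sum>\<tau>\<in>cycle_class n 1.
     \<Sum>g\<in>symgrp n. of_bool (num_cycles n (inv \<sigma> \<circ> g) = i) * of_bool (num_cycles n (inv \<tau> \<circ> g) = j)) / (fact (n - 1))\<^sup>2"
proof -
  let ?C = "cycle_class n 1"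
  have C: "finite ?C" "card ?C = fact (n - 1)"
  proof -
    show "finite ?C" by (rule finite_subset[OF _ finite_symgrp[of n]]) (auto simp: cycle_class_def)
    show "card ?C = fact (n - 1)"
      unfolding cycle_class_1 using card_single_cycles[of "{1..n}"] assms by simp
  qed
  have ne: "?C \<noteq> {}" using C(2) by (metis card.empty fact_nonzero)
  let ?f = "\<lambda>\<sigma> \<tau>. real (card ((\<lambda>x. \<sigma> \<circ> x) ` cycle_class n i \<inter> (\<lambda>x. \<tau> \<circ> x) ` cycle_class n j))"
  have img: "(\<lambda>x. \<sigma> \<circ> x) ` cycle_class n i = {g \<in> symgrp n. num_cycles n (inv \<sigma> \<circ> g) = i}"
    if "\<sigma> \<in> ?C" for \<sigma> i
  proof -
    have s: "\<sigma> permutes {1..n}" using that by (simp add: cycle_class_def symgrp_def)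
    have inv: "inv \<sigma> \<circ> (\<sigma> \<circ> x) = x" "\<sigma> \<circ> (inv \<sigma> \<circ> x) = x" for x :: "nat \<Rightarrow> nat"
      by (simp_all add: o_assoc permutes_inv_o[OF s])
    show ?thesis
    proof (intro equalityI subsetI)
      fix g assume "g \<in> (\<lambda>x. \<sigma> \<circ> x) ` cycle_class n i"
      then show "g \<in> {g \<in> symgrp n. num_cycles n (inv \<sigma> \<circ> g) = i}"
        using permutes_compose[OF _ s] by (auto simp: cycle_class_def symgrp_def inv)
    next
      fix g assume g: "g \<in> {g \<in> symgrp n. num_cycles n (inv \<sigma> \<circ> g) = i}"
      then have "inv \<sigma> \<circ> g \<in> cycle_class n i"
        using permutes_compose[OF _ permutes_inv[OF s]] by (auto simp: cycle_class_def symgrp_def)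
      then show "g \<in> (\<lambda>x. \<sigma> \<circ> x) ` cycle_class n i"
        using inv(2)[of g] by (metis image_eqI)
    qed
  qed
  have f: "?f \<sigma> \<tau> = (\<Sum>g\<in>symgrp n. of_bool (num_cycles n (inv \<sigma> \<circ> g) = i) * of_bool (num_cycles n (inv \<tau> \<circ> g) = j))"
    if "\<sigma> \<in> ?C" "\<tau> \<in> ?C" for \<sigma> \<tau>
  proof -
    have "?f \<sigma> \<tau> = real (card {g \<in> symgrp n. num_cycles n (inv \<sigma> \<circ> g) = i \<and> num_cycles n (inv \<tau> \<circ> g) = j})"
      unfolding img[OF that(1)] img[OF that(2)] by (intro arg_cong[where f = "\<lambda>A. real (card A)"]) auto
    also have "\<dots> = (\<Sum>g\<in>symgrp n. if num_cycles n (inv \<sigma> \<circ> g) = i \<and> num_cycles n (inv \<tau> \<circ> g) = j then 1 else 0)"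
      using sum.inter_filter[OF finite_symgrp[of n], of "\<lambda>_. 1::real"] by simp
    finally show ?thesis by (simp add: of_bool_def if_distrib cong: if_cong sum.cong) (intro sum.cong, auto)
  qed
  have "expected_overlap n i j = (\<Sum>(\<sigma>,\<tau>)\<in>?C \<times> ?C. pmf (pair_pmf (pmf_of_set ?C) (pmf_of_set ?C)) (\<sigma>, \<tau>) * ?f \<sigma> \<tau>)"
    unfolding expected_overlap_def
    by (subst integral_measure_pmf[of "?C \<times> ?C"]) (use C ne in \<open>auto intro!: sum.cong\<close>)
  also have "\<dots> = (\<Sum>\<sigma>\<in>?C. \<Sum>\<tau>\<in>?C. pmf (pair_pmf (pmf_of_set ?C) (pmf_of_set ?C)) (\<sigma>, \<tau>) * ?f \<sigma> \<tau>)"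
    by (rule sum.cartesian_product[symmetric])
  also have "\<dots> = (\<Sum>\<sigma>\<in>?C. \<Sum>\<tau>\<in>?C. (\<Sum>g\<in>symgrp n. of_bool (num_cycles n (inv \<sigma> \<circ> g) = i) * of_bool (num_cycles n (inv \<tau> \<circ> g) = j)) / (fact (n - 1))\<^sup>2)"
  proof (intro sum.cong[OF refl])
    fix \<sigma> \<tau> assume st: "\<sigma> \<in> ?C" "\<tau> \<in> ?C"
    have "pmf (pair_pmf (pmf_of_set ?C) (pmf_of_set ?C)) (\<sigma>, \<tau>) = 1 / (fact (n - 1))\<^sup>2"
      using st C ne by (simp add: pmf_pair power2_eq_square)
    then show "pmf (pair_pmf (pmf_of_set ?C) (pmf_of_set ?C)) (\<sigma>, \<tau>) * ?f \<sigma> \<tau> =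
       (\<Sum>g\<in>symgrp n. of_bool (num_cycles n (inv \<sigma> \<circ> g) = i) * of_bool (num_cycles n (inv \<tau> \<circ> g) = j)) / (fact (n - 1))\<^sup>2"
      using f[OF st] by simp
  qed
  finally show ?thesis by (simp add: sum_divide_distrib)
qed

lemma class_value_eq:
  assumes "\<And>\<pi>. \<pi> \<in> cycle_class n i \<Longrightarrow> \<theta> \<pi> = c" "cycle_class n i \<noteq> {}"
  shows "class_value n \<theta> i = c"
  unfolding class_value_def
proof (rule the_equality)
  show "\<forall>\<pi>\<in>cycle_class n i. \<theta> \<pi> = c" using assms(1) by blast
next
  fix d assume "\<forall>\<pi>\<in>cycle_class n i. \<theta> \<pi> = d"
  then show "d = c" using assms by (metis all_not_in_conv)
qed

text \<open>For fixed \<sigma>, \<tau> and \<open>g\<close> exactly one pair of indices contributes.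
  Its classes contain the permutations in question, so \<open>class_value\<close>, a definite
  description, is determined there.\<close>

lemma bracket_eq:
  assumes "n \<ge> 1"
    and \<theta>: "\<And>\<pi>. \<pi> \<in> symgrp n \<Longrightarrow> \<theta> \<pi> = \<Theta> (num_cycles n \<pi>)"
    and \<psi>: "\<And>\<pi>. \<pi> \<in> symgrp n \<Longrightarrow> \<psi> \<pi> = \<Psi> (num_cycles n \<pi>)"
  shows "bracket n \<theta> \<psi> = 1 / (fact n * (fact (n - 1))\<^sup>2) *
    (\<Sum>\<sigma>\<in>cycle_class n 1. \<Sum>\<tau>\<in>cycle_class n 1. \<Sum>g\<in>symgrp n.
       \<Theta> (num_cycles n (inv \<sigma> \<circ> g)) * cnj (\<Psi> (num_cycles n (inv \<tau> \<circ> g))))"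
proof -
  let ?C = "cycle_class n 1" and ?c = "class_value n \<theta>" and ?d = "class_value n \<psi>"
  let ?a = "\<lambda>\<sigma> g i. of_bool (num_cycles n (inv \<sigma> \<circ> g) = i) :: complex"
  have dist: "(\<Sum>i=1..n. \<Sum>j=1..n. ?c i * cnj (?d j) * (?a \<sigma> g i * ?a \<tau> g j)) =
     \<Theta> (num_cycles n (inv \<sigma> \<circ> g)) * cnj (\<Psi> (num_cycles n (inv \<tau> \<circ> g)))"
    if "\<sigma> \<in> ?C" "\<tau> \<in> ?C" "g \<in> symgrp n" for \<sigma> \<tau> g
  proof -
    have mem: "inv \<rho> \<circ> g \<in> symgrp n" if "\<rho> \<in> ?C" for \<rho>
      using that \<open>g \<in> symgrp n\<close> by (auto simp: cycle_class_def symgrp_def intro: permutes_compose permutes_inv)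
    have rng: "num_cycles n \<rho> \<in> {1..n}" for \<rho>
      using assms(1) cyc_pos[of "{1..n}" \<rho>] card_image_le[of "{1..n}" "orbit \<rho>"] by (auto simp: num_cycles_def cyc_def)
    have pick: "(\<Sum>i=1..n. c i * of_bool (m = i)) = c m" if "m \<in> {1..n}" for c :: "nat \<Rightarrow> complex" and m
    proof -
      have "(\<Sum>i=1..n. c i * of_bool (m = i)) = (\<Sum>i=1..n. if m = i then c i else 0)"
        by (intro sum.cong) auto
      then show ?thesis using that by simp
    qed
    have "(\<Sum>i=1..n. \<Sum>j=1..n. ?c i * cnj (?d j) * (?a \<sigma> g i * ?a \<tau> g j)) =
      (\<Sum>i=1..n. ?c i * ?a \<sigma> g i) * (\<Sum>j=1..n. cnj (?d j) * ?a \<tau> g j)"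
      unfolding sum_product by (intro sum.cong refl) (simp add: mult_ac)
    also have "\<dots> = ?c (num_cycles n (inv \<sigma> \<circ> g)) * cnj (?d (num_cycles n (inv \<tau> \<circ> g)))"
      by (simp only: pick[OF rng])
    also have "?c (num_cycles n (inv \<sigma> \<circ> g)) = \<Theta> (num_cycles n (inv \<sigma> \<circ> g))"
      by (rule class_value_eq) (use mem[OF that(1)] in \<open>auto simp: cycle_class_def \<theta>\<close>)
    also have "?d (num_cycles n (inv \<tau> \<circ> g)) = \<Psi> (num_cycles n (inv \<tau> \<circ> g))"
      by (rule class_value_eq) (use mem[OF that(2)] in \<open>auto simp: cycle_class_def \<psi>\<close>)
    finally show ?thesis .
  qed
  have "(\<Sum>i=1..n. \<Sum>j=1..n. ?c i * cnj (?d j) * complex_of_real (expected_overlap n i j)) =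
    (\<Sum>i=1..n. \<Sum>j=1..n. \<Sum>\<sigma>\<in>?C. \<Sum>\<tau>\<in>?C. \<Sum>g\<in>symgrp n. ?c i * cnj (?d j) * (?a \<sigma> g i * ?a \<tau> g j)) / (fact (n - 1))\<^sup>2"
  proof -
    have "complex_of_real (of_bool b) = of_bool b" for b by (cases b) auto
    then show ?thesis
      by (simp add: expected_overlap_eq[OF assms(1)] sum_distrib_left sum_divide_distrib)
  qed
  also have "(\<Sum>i=1..n. \<Sum>j=1..n. \<Sum>\<sigma>\<in>?C. \<Sum>\<tau>\<in>?C. \<Sum>g\<in>symgrp n. ?c i * cnj (?d j) * (?a \<sigma> g i * ?a \<tau> g j)) =
    (\<Sum>\<sigma>\<in>?C. \<Sum>\<tau>\<in>?C. \<Sum>g\<in>symgrp n. \<Sum>i=1..n. \<Sum>j=1..n. ?c i * cnj (?d j) * (?a \<sigma> g i * ?a \<tau> g j))"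
    unfolding sum.swap[of _ ?C "{1..n}"] sum.swap[of _ "symgrp n" "{1..n}"] ..
  also have "\<dots> = (\<Sum>\<sigma>\<in>?C. \<Sum>\<tau>\<in>?C. \<Sum>g\<in>symgrp n. \<Theta> (num_cycles n (inv \<sigma> \<circ> g)) * cnj (\<Psi> (num_cycles n (inv \<tau> \<circ> g))))"
    by (intro sum.cong refl dist)
  finally show ?thesis by (simp add: bracket_def card_symgrp)
qed

lemma sum_num_cycles_powers:
  assumes "n \<ge> 1"
  shows "(\<Sum>\<sigma>\<in>cycle_class n 1. \<Sum>\<tau>\<in>cycle_class n 1. \<Sum>g\<in>symgrp n.
       of_nat x ^ num_cycles n (inv \<sigma> \<circ> g) * of_nat y ^ num_cycles n (inv \<tau> \<circ> g)) =
    fact n * (fact (n - 1))\<^sup>2 * (\<Sum>r=0..n - 1. of_nat ((x + (n - 1 - r)) choose n) * of_nat ((y + (n - 1 - r)) choose n) :: complex)"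
proof -
  let ?U = "{1..n}" and ?C = "cycle_class n 1"
  let ?e = "\<lambda>r z. hook_eigenvalue r (n - 1 - r) (of_nat z)"
  have U: "finite ?U" "?U \<noteq> {}" using assms by auto
  \<comment> \<open>Every permutation has a cycle, so one factor \<open>z\<close> can be split off;
    it supplies the corner content that \<open>hook_eigenvalue\<close> omits.\<close>
  have p: "z ^ cyc ?U s = z * z ^ (cyc ?U s - 1)" for z :: complex and s
    using cyc_pos[OF U, of s] by (cases "cyc ?U s") auto
  have "(\<Sum>\<sigma>\<in>?C. \<Sum>\<tau>\<in>?C. \<Sum>g\<in>symgrp n. of_nat x ^ num_cycles n (inv \<sigma> \<circ> g) * of_nat y ^ num_cycles n (inv \<tau> \<circ> g)) =
    (\<Sum>g\<in>symgrp n. \<Sum>\<sigma>\<in>?C. \<Sum>\<tau>\<in>?C. of_nat x ^ num_cycles n (inv \<sigma> \<circ> g) * of_nat y ^ num_cycles n (inv \<tau> \<circ> g) :: complex)"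
    unfolding sum.swap[of _ "symgrp n" ?C] ..
  also have "\<dots> = (\<Sum>g\<in>symgrp n. (\<Sum>\<sigma>\<in>?C. of_nat x ^ num_cycles n (inv \<sigma> \<circ> g)) * (\<Sum>\<tau>\<in>?C. of_nat y ^ num_cycles n (inv \<tau> \<circ> g)))"
    unfolding sum_product ..
  also have "\<dots> = (\<Sum>g\<in>symgrp n. of_nat x * of_nat y * ((\<Sum>\<sigma>\<in>?C. of_nat x ^ (cyc ?U (inv \<sigma> \<circ> g) - 1)) * (\<Sum>\<tau>\<in>?C. of_nat y ^ (cyc ?U (inv \<tau> \<circ> g) - 1))))"
  proof (rule sum.cong[OF refl])
    fix g
    have "(\<Sum>\<sigma>\<in>?C. z ^ num_cycles n (inv \<sigma> \<circ> g)) = z * (\<Sum>\<sigma>\<in>?C. z ^ (cyc ?U (inv \<sigma> \<circ> g) - 1))" for z :: complex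
      unfolding num_cycles_eq_cyc sum_distrib_left by (intro sum.cong refl p)
    then show "(\<Sum>\<sigma>\<in>?C. of_nat x ^ num_cycles n (inv \<sigma> \<circ> g)) * (\<Sum>\<tau>\<in>?C. of_nat y ^ num_cycles n (inv \<tau> \<circ> g)) =
      of_nat x * of_nat y * ((\<Sum>\<sigma>\<in>?C. of_nat x ^ (cyc ?U (inv \<sigma> \<circ> g) - 1)) * (\<Sum>\<tau>\<in>?C. of_nat y ^ (cyc ?U (inv \<tau> \<circ> g) - 1)) :: complex)"
      by (simp only: mult_ac)
  qed
  also have "\<dots> = of_nat x * of_nat y * id_coeff (cyc_elem ?U 0 * cyc_elem ?U (of_nat x) * cyc_elem ?U (of_nat y) * cyc_elem ?U 0)"
    by (simp only: id_coeff_cyc_elems_expand[OF U] sum_distrib_left symgrp_def cycle_class_1)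
  also have "\<dots> = fact (n - 1) / of_nat n * (\<Sum>r=0..n - 1. (of_nat x * ?e r x) * (of_nat y * ?e r y))"
    unfolding id_coeff_cyc_elems[OF assms] by (simp add: sum_distrib_left mult_ac)
  also have "(\<Sum>r=0..n - 1. (of_nat x * ?e r x) * (of_nat y * ?e r y)) =
    (\<Sum>r=0..n - 1. (fact n * fact n) * (of_nat ((x + (n - 1 - r)) choose n) * of_nat ((y + (n - 1 - r)) choose n)))"
  proof (rule sum.cong[OF refl])
    fix r assume "r \<in> {0..n - 1}"
    then have "r \<le> n - 1" by simp
    then show "(of_nat x * ?e r x) * (of_nat y * ?e r y) =
      (fact n * fact n) * (of_nat ((x + (n - 1 - r)) choose n) * of_nat ((y + (n - 1 - r)) choose n))"
      by (simp only: hook_eigenvalue_binomial[OF assms] mult_ac)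
  qed
  also have "fact (n - 1) / of_nat n * \<dots> = (fact (n - 1) / of_nat n * fact n * fact n) * (\<Sum>r=0..n - 1. of_nat ((x + (n - 1 - r)) choose n) * of_nat ((y + (n - 1 - r)) choose n))"
    by (simp add: sum_distrib_left mult_ac)
  \<comment> \<open>Since n! = n (n-1)!, the constant becomes the normalisation of
    \<open>bracket_eq\<close>.\<close>
  also have "fact (n - 1) / of_nat n * fact n * fact n = (fact n * (fact (n - 1))\<^sup>2 :: complex)"
    using assms by (simp add: fact_reduce[of n] power2_eq_square)
  finally show ?thesis .
qed

text \<open>The signed numbers \<open>(n + 1) choose s\<close> are the coefficients of (1-z)^(n+1)
  and the numbers \<open>(n + s) choose n\<close> those of its inverse, so their convolution is
  trivial. The proof is Vandermonde's identity with upper arguments -(n+1) and n+1; the terms with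
  \<open>j < r\<close> vanish.\<close>

lemma binomial_inversion_delta:
  assumes "r \<le> n"
  shows "(\<Sum>j=0..i. (-1) ^ (i - j) * of_nat ((n + 1) choose (i - j)) * of_nat ((j + n - r) choose n)) =
    (if i = r then 1 else 0 :: complex)"
proof (cases "i < r")
  case True
  have z: "(j + n - r) choose n = 0" if "j \<le> i" for j
  proof -
    have "j + n - r < n" using that True assms by auto
    then show ?thesis by (rule binomial_eq_0)
  qed
  have "(\<Sum>j=0..i. (-1) ^ (i - j) * of_nat ((n + 1) choose (i - j)) * of_nat ((j + n - r) choose n)) = (0 :: complex)"
    by (intro sum.neutral ballI) (simp add: z)
  then show ?thesis using True by simp
next
  case False
  define d where "d = i - r"
  have i: "i = r + d" using False by (simp add: d_def)
  let ?f = "\<lambda>j. (-1) ^ (i - j) * of_nat ((n + 1) choose (i - j)) * of_nat ((j + n - r) choose n) :: complex"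
  have "(\<Sum>j=0..i. ?f j) = (\<Sum>j\<in>{r..i}. ?f j)"
    using assms False by (intro sum.mono_neutral_right) (auto intro!: binomial_eq_0)
  also have "\<dots> = (\<Sum>s=0..d. ?f (s + r))"
    using sum.shift_bounds_cl_nat_ivl[of ?f 0 r d] by (simp add: i add.commute)
  also have "\<dots> = (\<Sum>s=0..d. (-1) ^ d * (((- of_nat (n + 1)) gchoose s) * (of_nat (n + 1) gchoose (d - s))))"
  proof (rule sum.cong[OF refl])
    fix s assume "s \<in> {0..d}"
    then have s: "s \<le> d" by simp
    have "(- of_nat (n + 1) :: complex) gchoose s = (-1) ^ s * ((of_nat (n + s)) gchoose s)"
      by (subst gbinomial_minus) simp
    also have "\<dots> = (-1) ^ s * of_nat ((n + s) choose n)"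
      by (simp only: binomial_gbinomial[symmetric]) (simp add: binomial_symmetric[of s "n + s"])
    finally have 1: "(- of_nat (n + 1) :: complex) gchoose s = (-1) ^ s * of_nat ((n + s) choose n)" .
    have 2: "(-1) ^ d * (-1) ^ s = ((-1) ^ (d - s) :: complex)"
    proof -
      have "(-1) ^ d = (-1) ^ (d - s) * ((-1) ^ s :: complex)" using s by (simp add: power_add[symmetric])
      then show ?thesis by (simp add: mult.assoc power_mult_distrib[symmetric])
    qed
    have "?f (s + r) = (-1) ^ (d - s) * of_nat ((n + 1) choose (d - s)) * of_nat ((n + s) choose n)"
      using assms by (simp add: i add.commute)
    also have "\<dots> = (-1) ^ d * (((- of_nat (n + 1)) gchoose s) * (of_nat (n + 1) gchoose (d - s)))"
      unfolding 1 binomial_gbinomial[symmetric] 2[symmetric] by (simp only: mult_ac)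
    finally show "?f (s + r) = (-1) ^ d * (((- of_nat (n + 1)) gchoose s) * (of_nat (n + 1) gchoose (d - s)))" .
  qed
  also have "\<dots> = (-1) ^ d * ((- of_nat (n + 1) + of_nat (n + 1)) gchoose d)"
    by (simp only: gbinomial_Vandermonde sum_distrib_left[symmetric])
  also have "\<dots> = (if i = r then 1 else 0)"
    by (cases d) (simp_all add: i)
  finally show ?thesis .
qed

text \<open>Evaluation at x = 1, ..., i+1 suffices, as the matrix of the expansion is unitriangular
  at these points.\<close>

lemma binomial_inversion:
  fixes c :: "nat \<Rightarrow> complex"
  assumes "\<And>x. of_nat x ^ m = (\<Sum>i=0..n - 1. c i * of_nat ((x + (n - 1 - i)) choose n))" "n \<ge> 1" "i \<le> n - 1"
  shows "c i = (\<Sum>j=0..i. (-1) ^ (i - j) * of_nat ((n + 1) choose (i - j)) * of_nat (j + 1) ^ m)"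
proof -
  have "(\<Sum>j=0..i. (-1) ^ (i - j) * of_nat ((n + 1) choose (i - j)) * of_nat (j + 1) ^ m) =
    (\<Sum>j=0..i. \<Sum>r=0..n - 1. c r * ((-1) ^ (i - j) * of_nat ((n + 1) choose (i - j)) * of_nat ((j + n - r) choose n)))"
    unfolding assms(1) sum_distrib_left
  proof (intro sum.cong refl)
    fix j r assume "r \<in> {0..n - 1}"
    then have "j + 1 + (n - 1 - r) = j + n - r" using assms(2) by auto
    then show "(-1) ^ (i - j) * of_nat ((n + 1) choose (i - j)) * (c r * of_nat ((j + 1 + (n - 1 - r)) choose n)) =
      c r * ((-1) ^ (i - j) * of_nat ((n + 1) choose (i - j)) * of_nat ((j + n - r) choose n))"
      by (simp only: mult_ac)
  qed
  also have "\<dots> = (\<Sum>r=0..n - 1. c r * (\<Sum>j=0..i. (-1) ^ (i - j) * of_nat ((n + 1) choose (i - j)) * of_nat ((j + n - r) choose n)))"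
    by (subst sum.swap) (simp only: sum_distrib_left)
  also have "\<dots> = (\<Sum>r=0..n - 1. c r * (if i = r then 1 else 0))"
  proof (rule sum.cong[OF refl])
    fix r assume "r \<in> {0..n - 1}"
    then have "r \<le> n" by auto
    from binomial_inversion_delta[OF this, of i]
    show "c r * (\<Sum>j=0..i. (-1) ^ (i - j) * of_nat ((n + 1) choose (i - j)) * of_nat ((j + n - r) choose n)) = c r * (if i = r then 1 else 0)"
      by (simp only:)
  qed
  also have "\<dots> = (\<Sum>r=0..n - 1. if i = r then c r else 0)" by (intro sum.cong) auto
  also have "\<dots> = c i" using assms(3) by simp
  finally show ?thesis by simp
qed

text \<open>Expanding all three characters leaves brackets of powers only. The sum over
  \<open>w\<close>, which comes from the third character, meets its inverse matrix and selects the
  single term \<open>r = k\<close>, so two sums remain.\<close>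

lemma bracket_foulkes:
  fixes i j k n :: nat
  assumes "n \<ge> 1" and "i \<le> n - 1" and "j \<le> n - 1" and "k \<le> n - 1"
    and F: "\<And>i \<pi>. i \<le> n - 1 \<Longrightarrow> \<pi> \<in> symgrp n \<Longrightarrow>
      foulkes n i \<pi> = (\<Sum>u=0..i. (-1) ^ (i - u) * of_nat ((n + 1) choose (i - u)) * of_nat (u + 1) ^ num_cycles n \<pi>)"
  shows "bracket n (\<lambda>\<pi>. foulkes n i \<pi> * foulkes n j \<pi>) (foulkes n k) =
    (\<Sum>u=0..i. \<Sum>v=0..j. (-1) ^ (i - u) * (-1) ^ (j - v) *
       of_nat ((n + 1) choose (i - u)) * of_nat ((n + 1) choose (j - v)) *
       of_nat ((u * v + u + v + n - k) choose n))"
proof -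
  let ?C = "cycle_class n 1" and ?G = "symgrp n"
  define a where "a i u = ((-1) ^ (i - u) * of_nat ((n + 1) choose (i - u)) :: complex)" for i u
  define \<phi> where "\<phi> i m = (\<Sum>u=0..i. a i u * of_nat (u + 1) ^ m)" for i m
  define S where "S x y = (\<Sum>\<sigma>\<in>?C. \<Sum>\<tau>\<in>?C. \<Sum>g\<in>?G. of_nat x ^ num_cycles n (inv \<sigma> \<circ> g) * of_nat y ^ num_cycles n (inv \<tau> \<circ> g) :: complex)" for x y
  have Fa: "foulkes n i \<pi> = \<phi> i (num_cycles n \<pi>)" if "i \<le> n - 1" "\<pi> \<in> ?G" for i \<pi>
    using F[OF that] by (simp add: \<phi>_def a_def)
  have cnja: "cnj (a i u) = a i u" for i u by (simp add: a_def)
  have "bracket n (\<lambda>\<pi>. foulkes n i \<pi> * foulkes n j \<pi>) (foulkes n k) = 1 / (fact n * (fact (n - 1))\<^sup>2) *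
    (\<Sum>\<sigma>\<in>?C. \<Sum>\<tau>\<in>?C. \<Sum>g\<in>?G. (\<phi> i (num_cycles n (inv \<sigma> \<circ> g)) * \<phi> j (num_cycles n (inv \<sigma> \<circ> g))) * cnj (\<phi> k (num_cycles n (inv \<tau> \<circ> g))))"
  proof -
    have "foulkes n i \<pi> * foulkes n j \<pi> = \<phi> i (num_cycles n \<pi>) * \<phi> j (num_cycles n \<pi>)" if "\<pi> \<in> ?G" for \<pi>
      by (simp only: Fa[OF assms(2) that] Fa[OF assms(3) that])
    from bracket_eq[OF assms(1), where \<Theta> = "\<lambda>m. \<phi> i m * \<phi> j m" and \<Psi> = "\<phi> k", OF this Fa[OF assms(4)]]
    show ?thesis by simp
  qed
  also have "(\<Sum>\<sigma>\<in>?C. \<Sum>\<tau>\<in>?C. \<Sum>g\<in>?G. (\<phi> i (num_cycles n (inv \<sigma> \<circ> g)) * \<phi> j (num_cycles n (inv \<sigma> \<circ> g))) * cnj (\<phi> k (num_cycles n (inv \<tau> \<circ> g)))) =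
    (\<Sum>\<sigma>\<in>?C. \<Sum>\<tau>\<in>?C. \<Sum>g\<in>?G. \<Sum>u=0..i. \<Sum>v=0..j. \<Sum>w=0..k. a i u * a j v * a k w *
       (of_nat ((u + 1) * (v + 1)) ^ num_cycles n (inv \<sigma> \<circ> g) * of_nat (w + 1) ^ num_cycles n (inv \<tau> \<circ> g)))"
  proof (intro sum.cong refl)
    fix \<sigma> \<tau> g
    show "(\<phi> i (num_cycles n (inv \<sigma> \<circ> g)) * \<phi> j (num_cycles n (inv \<sigma> \<circ> g))) * cnj (\<phi> k (num_cycles n (inv \<tau> \<circ> g))) =
      (\<Sum>u=0..i. \<Sum>v=0..j. \<Sum>w=0..k. a i u * a j v * a k w *
       (of_nat ((u + 1) * (v + 1)) ^ num_cycles n (inv \<sigma> \<circ> g) * of_nat (w + 1) ^ num_cycles n (inv \<tau> \<circ> g)))"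
    proof -
      have ck: "cnj (\<phi> k m) = \<phi> k m" for m by (simp add: \<phi>_def cnja del: of_nat_add of_nat_Suc)
      have "(\<phi> i m * \<phi> j m) * \<phi> k m' = (\<Sum>u=0..i. \<Sum>v=0..j. \<Sum>w=0..k. a i u * a j v * a k w *
         (of_nat ((u + 1) * (v + 1)) ^ m * of_nat (w + 1) ^ m'))" for m m'
      proof -
        have "\<phi> i m * \<phi> j m = (\<Sum>u=0..i. \<Sum>v=0..j. a i u * of_nat (u + 1) ^ m * (a j v * of_nat (v + 1) ^ m))"
          unfolding \<phi>_def by (rule sum_product)
        then have "(\<phi> i m * \<phi> j m) * \<phi> k m' = (\<Sum>u=0..i. \<Sum>v=0..j. a i u * of_nat (u + 1) ^ m * (a j v * of_nat (v + 1) ^ m) * \<phi> k m')"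
          by (simp only: sum_distrib_right)
        also have "\<dots> = (\<Sum>u=0..i. \<Sum>v=0..j. \<Sum>w=0..k. a i u * a j v * a k w *
           (of_nat ((u + 1) * (v + 1)) ^ m * of_nat (w + 1) ^ m'))"
          unfolding \<phi>_def sum_distrib_left
          by (intro sum.cong refl) (simp only: of_nat_mult power_mult_distrib mult_ac)
        finally show ?thesis .
      qed
      then show ?thesis by (simp only: ck)
    qed
  qed
  also have "\<dots> = (\<Sum>u=0..i. \<Sum>v=0..j. \<Sum>w=0..k. a i u * a j v * a k w * S ((u + 1) * (v + 1)) (w + 1))"
    unfolding S_def sum_distrib_left sum.swap[of _ "{0..i}" ?G] sum.swap[of _ "{0..j}" ?G] sum.swap[of _ "{0..k}" ?G]
      sum.swap[of _ "{0..i}" ?C] sum.swap[of _ "{0..j}" ?C] sum.swap[of _ "{0..k}" ?C] ..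
  also have "1 / (fact n * (fact (n - 1))\<^sup>2) * \<dots> = (\<Sum>u=0..i. \<Sum>v=0..j. a i u * a j v * of_nat ((u * v + u + v + n - k) choose n))"
    unfolding sum_distrib_left
  proof (intro sum.cong refl)
    fix u v :: nat
    let ?x = "(u + 1) * (v + 1)"
    have nz: "fact n * (fact (n - 1))\<^sup>2 \<noteq> (0 :: complex)" by simp
    have "(\<Sum>w=0..k. 1 / (fact n * (fact (n - 1))\<^sup>2) * (a i u * a j v * a k w * S ?x (w + 1))) =
      (\<Sum>w=0..k. \<Sum>r=0..n - 1. a i u * a j v * of_nat ((?x + (n - 1 - r)) choose n) * (a k w * of_nat ((w + n - r) choose n)))"
    proof (rule sum.cong[OF refl])
      fix w
      have "1 / (fact n * (fact (n - 1))\<^sup>2) * S ?x (w + 1) = (\<Sum>r=0..n - 1. of_nat ((?x + (n - 1 - r)) choose n) * of_nat ((w + 1 + (n - 1 - r)) choose n))"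
        unfolding S_def sum_num_cycles_powers[OF assms(1)] using nz by simp
      also have "\<dots> = (\<Sum>r=0..n - 1. of_nat ((?x + (n - 1 - r)) choose n) * of_nat ((w + n - r) choose n))"
        using assms(1) by (intro sum.cong refl arg_cong2[where f = "(*)"] arg_cong[where f = "\<lambda>m. of_nat (m choose n)"]) auto
      finally have e: "1 / (fact n * (fact (n - 1))\<^sup>2) * S ?x (w + 1) = (\<Sum>r=0..n - 1. of_nat ((?x + (n - 1 - r)) choose n) * of_nat ((w + n - r) choose n))" .
      have "1 / (fact n * (fact (n - 1))\<^sup>2) * (a i u * a j v * a k w * S ?x (w + 1)) = a i u * a j v * a k w * (1 / (fact n * (fact (n - 1))\<^sup>2) * S ?x (w + 1))"
        by (simp only: mult_ac)
      also have "\<dots> = (\<Sum>r=0..n - 1. a i u * a j v * of_nat ((?x + (n - 1 - r)) choose n) * (a k w * of_nat ((w + n - r) choose n)))"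
        unfolding e sum_distrib_left by (intro sum.cong refl) (simp only: mult_ac)
      finally show "1 / (fact n * (fact (n - 1))\<^sup>2) * (a i u * a j v * a k w * S ?x (w + 1)) =
        (\<Sum>r=0..n - 1. a i u * a j v * of_nat ((?x + (n - 1 - r)) choose n) * (a k w * of_nat ((w + n - r) choose n)))" .
    qed
    also have "\<dots> = (\<Sum>r=0..n - 1. a i u * a j v * of_nat ((?x + (n - 1 - r)) choose n) * (\<Sum>w=0..k. a k w * of_nat ((w + n - r) choose n)))"
      by (subst sum.swap) (simp only: sum_distrib_left)
    also have "\<dots> = (\<Sum>r=0..n - 1. if k = r then a i u * a j v * of_nat ((?x + (n - 1 - r)) choose n) else 0)"
    proof (rule sum.cong[OF refl])
      fix r assume "r \<in> {0..n - 1}"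
      then have "r \<le> n" by auto
      from binomial_inversion_delta[OF this, of k]
      show "a i u * a j v * of_nat ((?x + (n - 1 - r)) choose n) * (\<Sum>w=0..k. a k w * of_nat ((w + n - r) choose n)) =
        (if k = r then a i u * a j v * of_nat ((?x + (n - 1 - r)) choose n) else 0)"
        unfolding a_def[of k] by simp
    qed
    also have "\<dots> = a i u * a j v * of_nat ((?x + (n - 1 - k)) choose n)" using assms(4) by simp
    also have "?x + (n - 1 - k) = u * v + u + v + n - k" using assms(1,4) by simp
    finally show "(\<Sum>w=0..k. 1 / (fact n * (fact (n - 1))\<^sup>2) * (a i u * a j v * a k w * S ?x (w + 1))) =
      a i u * a j v * of_nat ((u * v + u + v + n - k) choose n)" .
  qed
  finally show ?thesis by (simp only: a_def mult_ac)
qed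

section \<open>Young subgroups and ascents\<close>

text \<open>The Young subgroup generated by the adjacent transpositions \<open>(i, i + 1)\<close> with \<open>i \<in> J\<close>.\<close>

definition young :: "nat \<Rightarrow> nat set \<Rightarrow> (nat \<Rightarrow> nat) set" where
  "young n J = {u \<in> symgrp n. \<forall>i\<in>{1..<n} - J. u ` {1..i} = {1..i}}"

definition ascents :: "nat \<Rightarrow> (nat \<Rightarrow> nat) \<Rightarrow> nat set" where
  "ascents n w = {i \<in> {1..<n}. w i < w (Suc i)}"

text \<open>By the rearrangement inequality this is largest, among the rearrangements of
  \<open>f\<close>, for the increasing one. It serves as the height function for straightening and
  for triangularity.\<close>

definition weight :: "nat \<Rightarrow> (nat \<Rightarrow> int) \<Rightarrow> int" where
  "weight n f = (\<Sum>p=1..n. int p * f p)"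

section \<open>Group laws for the symmetric group and its Young subgroups\<close>

lemma symgrp_iff: "w \<in> symgrp n \<longleftrightarrow> w permutes {1..n}"
  by (simp add: symgrp_def)

lemma symgrp_id: "id \<in> symgrp n"
  unfolding symgrp_iff by (rule permutes_id)

lemma symgrp_comp: "w \<in> symgrp n \<Longrightarrow> u \<in> symgrp n \<Longrightarrow> w \<circ> u \<in> symgrp n"
  unfolding symgrp_iff by (rule permutes_compose)

lemma symgrp_inv: "w \<in> symgrp n \<Longrightarrow> inv w \<in> symgrp n"
  unfolding symgrp_iff by (rule permutes_inv)

lemma symgrp_inv_o:
  assumes "w \<in> symgrp n"
  shows "w \<circ> inv w = id" "inv w \<circ> w = id" "inv w \<circ> (w \<circ> x) = x" "w \<circ> (inv w \<circ> x) = x"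
  using permutes_inv_o[of w "{1..n}"] assms by (simp_all add: symgrp_iff o_assoc)

lemma symgrp_inv_comp: "w \<in> symgrp n \<Longrightarrow> u \<in> symgrp n \<Longrightarrow> inv (w \<circ> u) = inv u \<circ> inv w"
  unfolding symgrp_iff by (rule o_inv_distrib) (auto intro: permutes_bij)

lemma symgrp_inv_inv: "w \<in> symgrp n \<Longrightarrow> inv (inv w) = w"
  unfolding symgrp_iff by (rule permutes_inv_inv)

lemma symgrp_perm: "w \<in> symgrp n \<Longrightarrow> permutation w"
  unfolding symgrp_iff by (rule permutes_imp_permutation[of "{1..n}"]) simp

lemma symgrp_eq_iff: "w \<in> symgrp n \<Longrightarrow> w x = w y \<longleftrightarrow> x = y"
  unfolding symgrp_iff by (rule inj_eq[OF permutes_inj])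

lemma young_symgrp: "u \<in> young n J \<Longrightarrow> u \<in> symgrp n"
  by (simp add: young_def)

lemma finite_young: "finite (young n J)"
  by (rule finite_subset[OF _ finite_symgrp[of n]]) (auto simp: young_def)

lemma young_id: "id \<in> young n J"
  by (simp add: young_def symgrp_id)

lemma young_comp:
  assumes "u \<in> young n J" "v \<in> young n J"
  shows "u \<circ> v \<in> young n J"
proof -
  have "(u \<circ> v) ` {1..i} = {1..i}" if "i \<in> {1..<n} - J" for i
  proof -
    have "(u \<circ> v) ` {1..i} = u ` v ` {1..i}" by (simp add: image_comp)
    then show ?thesis using assms that by (auto simp: young_def)
  qed
  then show ?thesis using assms by (auto simp: young_def intro: symgrp_comp)
qed

lemma young_inv:
  assumes "u \<in> young n J"
  shows "inv u \<in> young n J"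
proof -
  have u: "u \<in> symgrp n" using assms by (rule young_symgrp)
  have "inv u ` {1..i} = {1..i}" if "i \<in> {1..<n} - J" for i
  proof -
    have e: "u ` {1..i} = {1..i}" using assms that by (auto simp: young_def)
    have "inv u ` u ` {1..i} = (inv u \<circ> u) ` {1..i}" by (rule image_comp)
    also have "\<dots> = {1..i}" by (simp only: symgrp_inv_o(2)[OF u] image_id id_apply)
    finally show ?thesis by (simp only: e)
  qed
  then show ?thesis using u by (auto simp: young_def intro: symgrp_inv)
qed

lemma young_mono: "J \<subseteq> J' \<Longrightarrow> young n J \<subseteq> young n J'"
  by (auto simp: young_def)

lemma young_full: "young n {1..<n} = symgrp n"
  by (auto simp: young_def)

lemma adjacent_transpose_young:
  assumes "i \<in> J" "i \<in> {1..<n}"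
  shows "transpose i (Suc i) \<in> young n J"
proof -
  have "transpose i (Suc i) ` {1..k} = {1..k}" if "k \<noteq> i" for k
    using that assms by (intro transpose_image_eq) auto
  note img = this
  have "transpose i (Suc i) permutes {1..n}" using assms by (intro permutes_swap_id) auto
  moreover have "transpose i (Suc i) ` {1..k} = {1..k}" if "k \<in> {1..<n} - J" for k
    by (rule img) (use that assms in blast)
  ultimately show ?thesis by (simp only: young_def symgrp_iff mem_Collect_eq ball_simps) simp
qed

text \<open>Every initial segment \<open>{1..i}\<close> is preserved by one of the two hypotheses,
  so each point, being the difference of two segments, is fixed.\<close>

lemma young_disjoint:
  assumes "u \<in> young n J" "u \<in> young n ({1..<n} - J)"
  shows "u = id"
proof
  fix p
  have u: "u permutes {1..n}" using assms(1) by (auto simp: young_def symgrp_iff)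
  have pres: "u ` {1..i} = {1..i}" if "i \<le> n" for i
  proof (cases "i = 0 \<or> i = n")
    case True
    then show ?thesis using permutes_image[OF u] by auto
  next
    case False
    then show ?thesis using that assms by (cases "i \<in> J") (auto simp: young_def)
  qed
  show "u p = id p"
  proof (cases "p \<in> {1..n}")
    case True
    then have "u p \<in> {1..p}" using pres[of p] by auto
    moreover have "u p \<notin> {1..p - 1}"
    proof
      assume "u p \<in> {1..p - 1}"
      moreover have "u ` {1..p - 1} = {1..p - 1}" by (rule pres) (use True in auto)
      ultimately obtain q where q: "q \<in> {1..p - 1}" "u q = u p" by (metis imageE)
      have "q = p" by (rule injD[OF permutes_inj[OF u] q(2)])
      then show False using q(1) by auto
    qed
    ultimately show ?thesis using True by auto
  next
    case False
    then show ?thesis using permutes_not_in[OF u] by simp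
  qed
qed

section \<open>Ascending representatives of cosets\<close>

lemma interval_chain:
  assumes "\<And>q. a \<le> q \<Longrightarrow> q < b \<Longrightarrow> R (f q) (f (Suc q))" "a < b" "transp R"
  shows "R (f a) (f b)"
  using assms(2,1)
proof (induct b)
  case (Suc b)
  show ?case
  proof (cases "a = b")
    case True then show ?thesis using Suc(3)[of b] by simp
  next
    case False
    then have "a < b" using Suc(2) by simp
    moreover have "R (f q) (f (Suc q))" if "a \<le> q" "q < b" for q using Suc(3)[of q] that by simp
    ultimately have "R (f a) (f b)" by (rule Suc(1))
    moreover have "R (f b) (f (Suc b))" using Suc(3)[of b] \<open>a < b\<close> by simp
    ultimately show ?thesis by (rule transpD[OF assms(3)])
  qed
qed simp

text \<open>Let \<open>p\<close> be the least moved point. Both \<open>u p\<close> and the preimage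
  \<open>p'\<close> of \<open>p\<close> exceed \<open>p\<close>, and \<open>J\<close> contains all
  positions passed on the way to them. Following \<open>f\<close> up to \<open>u p\<close> and
  \<open>f \<circ> u\<close> up to \<open>p'\<close> gives \<open>f p < f (u p)\<close> and
  \<open>f (u p) < f (u p')\<close>, but \<open>u p' = p\<close>.\<close>

lemma young_ascending_unique:
  fixes f :: "nat \<Rightarrow> int"
  assumes u: "u \<in> young n J"
    and f: "\<And>j. j \<in> J \<Longrightarrow> j \<in> {1..<n} \<Longrightarrow> f j < f (Suc j)"
    and fu: "\<And>j. j \<in> J \<Longrightarrow> j \<in> {1..<n} \<Longrightarrow> f (u j) < f (u (Suc j))"
  shows "u = id"
proof (rule ccontr)
  assume "u \<noteq> id"
  then have "\<exists>p. u p \<noteq> p" by (auto simp: fun_eq_iff)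
  define p where "p = (LEAST p. u p \<noteq> p)"
  have p: "u p \<noteq> p" "\<And>q. q < p \<Longrightarrow> u q = q"
    unfolding p_def using LeastI_ex[OF \<open>\<exists>p. u p \<noteq> p\<close>] not_less_Least by blast+
  have up: "u permutes {1..n}" using u by (auto simp: young_def symgrp_iff)
  have inj: "u x = u y \<Longrightarrow> x = y" for x y by (rule injD[OF permutes_inj[OF up]])
  have pin: "p \<in> {1..n}" using p(1) up by (meson permutes_not_in)
  have upin: "u p \<in> {1..n}" using pin permutes_in_image[OF up] by blast
  have gt: "u p > p" using p inj by (metis linorder_neqE_nat)
  define p' where "p' = inv u p"
  have p': "u p' = p" unfolding p'_def using permutes_inverses(1)[OF up] .
  have p'in: "p' \<in> {1..n}" using p' pin permutes_in_image[OF up] by metis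
  have gt': "p' > p" using p p' by (metis linorder_neqE_nat)
  have 1: "q \<in> J" if "p \<le> q" "q < u p" for q
  proof (rule ccontr)
    assume "q \<notin> J"
    then have "u ` {1..q} = {1..q}" using u that pin upin by (auto simp: young_def)
    moreover have "p \<in> {1..q}" using that pin by auto
    ultimately have "u p \<in> {1..q}" by blast
    then show False using that by auto
  qed
  have 2: "q \<in> J" if "p \<le> q" "q < p'" for q
  proof (rule ccontr)
    assume "q \<notin> J"
    then have "u ` {1..q} = {1..q}" using u that pin p'in by (auto simp: young_def)
    moreover have "p \<in> {1..q}" using that pin by auto
    ultimately obtain x where "x \<in> {1..q}" "u x = p" by (metis imageE)
    then have "x = p'" using p' inj by metis
    then show False using \<open>x \<in> {1..q}\<close> that by auto
  qed
  have "f p < f (u p)"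
  proof (rule interval_chain[where R = "(<)"])
    fix q assume "p \<le> q" "q < u p"
    moreover from this have "q \<in> {1..<n}" using pin upin by auto
    ultimately show "f q < f (Suc q)" using f[OF 1] by simp
  qed (use gt in \<open>auto intro: transpI\<close>)
  moreover have "f (u p) < f (u p')"
  proof (rule interval_chain[where R = "(<)" and f = "\<lambda>x. f (u x)"])
    fix q assume "p \<le> q" "q < p'"
    moreover from this have "q \<in> {1..<n}" using pin p'in by auto
    ultimately show "f (u q) < f (u (Suc q))" using fu[OF 2] by simp
  qed (use gt' in \<open>auto intro: transpI\<close>)
  ultimately show False using p' by simp
qed

lemma weight_adjacent_transpose:
  assumes "i \<in> {1..<n}"
  shows "weight n (f \<circ> transpose i (Suc i)) = weight n f + f i - f (Suc i)"
proof -
  let ?s = "transpose i (Suc i)"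
  have s: "?s permutes {1..n}" using assms by (auto intro: permutes_swap_id)
  have "weight n (f \<circ> ?s) = (\<Sum>p=1..n. int (?s (?s p)) * f (?s p))" by (simp add: weight_def)
  also have "\<dots> = (\<Sum>p=1..n. int (?s p) * f p)"
    by (rule sum.reindex_bij_betw[OF permutes_imp_bij[OF s], of "\<lambda>p. int (?s p) * f p"])
  also have "\<dots> = weight n f + (\<Sum>p=1..n. (int (?s p) - int p) * f p)"
    by (simp add: weight_def sum.distrib[symmetric] algebra_simps)
  also have "(\<Sum>p=1..n. (int (?s p) - int p) * f p) = (\<Sum>p\<in>{i, Suc i}. (int (?s p) - int p) * f p)"
    using assms by (intro sum.mono_neutral_right) (auto simp: Transposition.transpose_def)
  also have "\<dots> = f i - f (Suc i)" by (simp add: algebra_simps)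
  finally show ?thesis by (simp only: add_diff_eq)
qed

text \<open>At a maximiser no adjacent swap in \<open>J\<close> raises the weight, so it is
  ascending along \<open>J\<close>, and by uniqueness it is the identity.\<close>

lemma weight_maximal:
  fixes f :: "nat \<Rightarrow> int"
  assumes u: "u \<in> young n J" "u \<noteq> id"
    and f: "\<And>j. j \<in> J \<Longrightarrow> j \<in> {1..<n} \<Longrightarrow> f j < f (Suc j)" and inj: "inj f"
  shows "weight n (f \<circ> u) < weight n f"
proof -
  have max_id: "v = id" if v: "v \<in> young n J" "\<And>x. x \<in> young n J \<Longrightarrow> weight n (f \<circ> x) \<le> weight n (f \<circ> v)" for v
  proof (rule young_ascending_unique[where f = f, OF v(1) f])
    fix j assume j: "j \<in> J" "j \<in> {1..<n}"
    have "v \<circ> transpose j (Suc j) \<in> young n J" using young_comp[OF v(1) adjacent_transpose_young[OF j]] .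
    from v(2)[OF this] have "f (v j) \<le> f (v (Suc j))"
      using weight_adjacent_transpose[OF j(2), of "f \<circ> v"] by (simp add: comp_assoc)
    moreover have "f (v j) \<noteq> f (v (Suc j))"
      by (simp add: inj_eq[OF inj] symgrp_eq_iff[OF young_symgrp[OF v(1)]])
    ultimately show "f (v j) < f (v (Suc j))" by simp
  qed
  define M where "M = Max ((\<lambda>x. weight n (f \<circ> x)) ` young n J)"
  have fin: "finite ((\<lambda>x. weight n (f \<circ> x)) ` young n J)" using finite_young by simp
  have "M \<in> (\<lambda>x. weight n (f \<circ> x)) ` young n J"
    unfolding M_def using young_id fin by (intro Max_in) auto
  then obtain v where v: "v \<in> young n J" "weight n (f \<circ> v) = M" by auto
  have le: "weight n (f \<circ> x) \<le> M" if "x \<in> young n J" for x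
    unfolding M_def using fin that by (intro Max_ge) auto
  have "v = id" using v le by (intro max_id) auto
  then have "M = weight n f" using v by simp
  moreover have "weight n (f \<circ> u) \<noteq> M"
  proof
    assume "weight n (f \<circ> u) = M"
    then have "u = id" using u(1) le by (intro max_id) auto
    then show False using u(2) by simp
  qed
  ultimately show ?thesis using le[OF u(1)] by simp
qed

definition perm_weight :: "nat \<Rightarrow> (nat \<Rightarrow> nat) \<Rightarrow> int" where
  "perm_weight n w = weight n (\<lambda>p. int (w p))"

lemma perm_weight_ascending:
  assumes "w \<in> symgrp n" "J \<subseteq> ascents n w" "u \<in> young n J" "u \<noteq> id"
  shows "perm_weight n (w \<circ> u) < perm_weight n w"
proof -
  have "inj (\<lambda>p. int (w p))" by (simp add: inj_def symgrp_eq_iff[OF assms(1)])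
  then have "weight n ((\<lambda>p. int (w p)) \<circ> u) < weight n (\<lambda>p. int (w p))"
    using assms by (intro weight_maximal) (auto simp: ascents_def)
  then show ?thesis by (simp add: perm_weight_def o_def)
qed

text \<open>This is \<open>weight_maximal\<close> for the negated values, under which descents
  become ascents.\<close>

lemma perm_weight_descending:
  assumes "w \<in> symgrp n" "ascents n w \<inter> J = {}" "u \<in> young n J" "u \<noteq> id"
  shows "perm_weight n w < perm_weight n (w \<circ> u)"
proof -
  have "inj (\<lambda>p. - int (w p))" by (simp add: inj_def symgrp_eq_iff[OF assms(1)])
  moreover have "- int (w j) < - int (w (Suc j))" if "j \<in> J" "j \<in> {1..<n}" for j
  proof -
    have "\<not> w j < w (Suc j)" using assms(2) that by (auto simp: ascents_def)
    moreover have "w j \<noteq> w (Suc j)" by (simp add: symgrp_eq_iff[OF assms(1)])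
    ultimately show ?thesis by simp
  qed
  ultimately have "weight n ((\<lambda>p. - int (w p)) \<circ> u) < weight n (\<lambda>p. - int (w p))"
    using assms by (intro weight_maximal) auto
  then show ?thesis by (simp add: perm_weight_def weight_def o_def sum_negf)
qed

text \<open>An element of largest weight in the coset has no descent in \<open>J\<close>, since an
  adjacent swap there would raise the weight.\<close>

lemma ex_ascending_representative:
  assumes "w \<in> symgrp n" "J \<subseteq> {1..<n}"
  shows "\<exists>u\<in>young n J. J \<subseteq> ascents n (w \<circ> u)"
proof -
  have fin: "finite ((\<lambda>x. perm_weight n (w \<circ> x)) ` young n J)" using finite_young by simp
  have "Max ((\<lambda>x. perm_weight n (w \<circ> x)) ` young n J) \<in> (\<lambda>x. perm_weight n (w \<circ> x)) ` young n J"
    using young_id fin by (intro Max_in) auto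
  then obtain v where v: "v \<in> young n J" "perm_weight n (w \<circ> v) = Max ((\<lambda>x. perm_weight n (w \<circ> x)) ` young n J)" by auto
  have "j \<in> ascents n (w \<circ> v)" if j: "j \<in> J" for j
  proof -
    have jn: "j \<in> {1..<n}" using j assms(2) by blast
    have "v \<circ> transpose j (Suc j) \<in> young n J" using young_comp[OF v(1) adjacent_transpose_young[OF j jn]] .
    then have "perm_weight n (w \<circ> (v \<circ> transpose j (Suc j))) \<le> perm_weight n (w \<circ> v)"
      unfolding v(2) using fin by (intro Max_ge) auto
    then have "w (v j) \<le> w (v (Suc j))"
      using weight_adjacent_transpose[OF jn, of "\<lambda>p. int (w (v p))"] by (simp add: perm_weight_def o_def)
    moreover have "w (v j) \<noteq> w (v (Suc j))"
      by (simp add: symgrp_eq_iff[OF assms(1)] symgrp_eq_iff[OF young_symgrp[OF v(1)]])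
    ultimately show ?thesis using jn by (simp add: ascents_def)
  qed
  then show ?thesis using v(1) by blast
qed

section \<open>Ribbon submodules of the regular representation\<close>

type_synonym permfun = "(nat \<Rightarrow> nat) \<Rightarrow> complex"

text \<open>The permutation module on the cosets of \<open>young n J\<close>, realised inside the
  functions on permutations so that the modules for different \<open>J\<close> are nested. Vanishing
  off \<open>symgrp n\<close> keeps the space finite-dimensional.\<close>

definition inv_space :: "nat \<Rightarrow> nat set \<Rightarrow> permfun set" where
  "inv_space n J = {f. (\<forall>w. w \<notin> symgrp n \<longrightarrow> f w = 0) \<and>
     (\<forall>w\<in>symgrp n. \<forall>u\<in>young n J. f (w \<circ> u) = f w)}"

definition coset_ind :: "nat \<Rightarrow> nat set \<Rightarrow> (nat \<Rightarrow> nat) \<Rightarrow> permfun" where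
  "coset_ind n J w = (\<lambda>x. of_bool (x \<in> symgrp n \<and> inv w \<circ> x \<in> young n J))"

text \<open>The polytabloids of the ribbon with horizontal steps \<open>J\<close>, as functions on permutations rather than tabloids.\<close>

definition ribbon_vec :: "nat \<Rightarrow> nat set \<Rightarrow> (nat \<Rightarrow> nat) \<Rightarrow> permfun" where
  "ribbon_vec n J v = (\<lambda>x. \<Sum>c\<in>young n ({1..<n} - J). of_int (sign c) * coset_ind n J (v \<circ> c) x)"

definition ltrans :: "(nat \<Rightarrow> nat) \<Rightarrow> permfun \<Rightarrow> permfun" where
  "ltrans \<pi> f = (\<lambda>w. f (inv \<pi> \<circ> w))"

section \<open>Functions invariant under a Young subgroup\<close>

lemma sum_fun_apply: "(\<Sum>i\<in>I. f i) x = (\<Sum>i\<in>I. f i x)" for f :: "'i \<Rightarrow> 'a \<Rightarrow> complex"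
  by (induct I rule: infinite_finite_induct) simp_all

lemma subspace_inv_space: "cfun.subspace (inv_space n J)"
  by (rule cfun.subspaceI) (auto simp: inv_space_def)

lemma inv_space_mono:
  assumes "J \<subseteq> J'"
  shows "inv_space n J' \<subseteq> inv_space n J"
proof
  fix f assume f: "f \<in> inv_space n J'"
  then show "f \<in> inv_space n J"
    using young_mono[OF assms, of n] by (auto simp: inv_space_def)
qed

lemma young_left_cancel:
  assumes "u \<in> young n J" "v \<in> symgrp n"
  shows "v \<circ> u \<in> young n J \<longleftrightarrow> v \<in> young n J"
proof
  assume "v \<circ> u \<in> young n J"
  then have "(v \<circ> u) \<circ> inv u \<in> young n J" using young_inv[OF assms(1)] by (rule young_comp)
  then show "v \<in> young n J" by (simp only: comp_assoc symgrp_inv_o(1)[OF young_symgrp[OF assms(1)]] comp_id)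
qed (rule young_comp[OF _ assms(1)])

lemma coset_ind_inv_space:
  assumes "w \<in> symgrp n"
  shows "coset_ind n J w \<in> inv_space n J"
proof -
  have "(x \<circ> u \<in> symgrp n \<and> inv w \<circ> (x \<circ> u) \<in> young n J) \<longleftrightarrow> (x \<in> symgrp n \<and> inv w \<circ> x \<in> young n J)"
    if "x \<in> symgrp n" "u \<in> young n J" for x u
    using young_left_cancel[OF that(2) symgrp_comp[OF symgrp_inv[OF assms] that(1)]] that
      symgrp_comp[OF that(1) young_symgrp[OF that(2)]] by (simp only: comp_assoc simp_thms)
  then show ?thesis unfolding inv_space_def coset_ind_def by auto
qed

lemma coset_ind_self: "w \<in> symgrp n \<Longrightarrow> coset_ind n J w w = 1"
  by (simp only: coset_ind_def symgrp_inv_o young_id simp_thms of_bool_eq)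

lemma coset_ind_translate:
  assumes "w \<in> symgrp n" "u \<in> young n J"
  shows "coset_ind n J (w \<circ> u) = coset_ind n J w"
proof
  fix x
  have u: "u \<in> symgrp n" using assms(2) by (rule young_symgrp)
  have "inv u \<circ> (inv w \<circ> x) \<in> young n J \<longleftrightarrow> inv w \<circ> x \<in> young n J"
  proof
    assume "inv u \<circ> (inv w \<circ> x) \<in> young n J"
    with assms(2) have "u \<circ> (inv u \<circ> (inv w \<circ> x)) \<in> young n J" by (rule young_comp)
    then show "inv w \<circ> x \<in> young n J" by (simp only: symgrp_inv_o(4)[OF u])
  qed (rule young_comp[OF young_inv[OF assms(2)]])
  then show "coset_ind n J (w \<circ> u) x = coset_ind n J w x"
    by (simp only: coset_ind_def symgrp_inv_comp[OF assms(1) u] comp_assoc)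
qed

lemma coset_ind_eq_iff:
  assumes "w \<in> symgrp n" "w' \<in> symgrp n"
  shows "coset_ind n J w = coset_ind n J w' \<longleftrightarrow> inv w \<circ> w' \<in> young n J"
proof
  assume "coset_ind n J w = coset_ind n J w'"
  then have "coset_ind n J w w' = 1" by (simp only: coset_ind_self[OF assms(2)])
  then show "inv w \<circ> w' \<in> young n J" by (auto simp: coset_ind_def of_bool_def split: if_splits)
next
  assume "inv w \<circ> w' \<in> young n J"
  from coset_ind_translate[OF assms(1) this]
  show "coset_ind n J w = coset_ind n J w'" by (simp only: symgrp_inv_o(4)[OF assms(1)])
qed

lemma inv_space_eq_value:
  assumes "f \<in> inv_space n J" "w \<in> symgrp n" "x \<in> symgrp n" "inv w \<circ> x \<in> young n J"
  shows "f x = f w"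
proof -
  have "f (w \<circ> (inv w \<circ> x)) = f w" using assms(1,2,4) unfolding inv_space_def by blast
  then show ?thesis by (simp only: symgrp_inv_o(4)[OF assms(2)])
qed

lemma sum_coset_ind:
  assumes "w \<in> symgrp n" "f \<in> inv_space n J"
  shows "(\<Sum>x\<in>symgrp n. f x * coset_ind n J w x) = of_nat (card (young n J)) * f w"
proof -
  have "(\<Sum>x\<in>symgrp n. f x * coset_ind n J w x) = (\<Sum>x\<in>{x \<in> symgrp n. inv w \<circ> x \<in> young n J}. f x)"
    using finite_symgrp by (intro sum.mono_neutral_cong_right) (auto simp: coset_ind_def)
  also have "\<dots> = (\<Sum>x\<in>{x \<in> symgrp n. inv w \<circ> x \<in> young n J}. f w)"
    by (intro sum.cong refl inv_space_eq_value[OF assms(2,1)]) auto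
  also have "card {x \<in> symgrp n. inv w \<circ> x \<in> young n J} = card (young n J)"
    by (rule bij_betw_same_card[of "\<lambda>x. inv w \<circ> x"], rule bij_betwI[where g = "\<lambda>u. w \<circ> u"])
      (auto simp: symgrp_inv_o[OF assms(1)] intro: symgrp_comp[OF assms(1) young_symgrp])
  then have "(\<Sum>x\<in>{x \<in> symgrp n. inv w \<circ> x \<in> young n J}. f w) = of_nat (card (young n J)) * f w" by simp
  finally show ?thesis .
qed

lemma card_young_pos: "card (young n J) \<noteq> 0"
  using finite_young young_id by (metis card_0_eq empty_iff)

text \<open>The combination over all of \<open>symgrp n\<close> meets each coset
  \<open>card (young n J)\<close> times; dividing by this number spares a choice of
  representatives.\<close>

lemma inv_space_eq_span: "inv_space n J = cfun.span (coset_ind n J ` symgrp n)"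
proof
  show "cfun.span (coset_ind n J ` symgrp n) \<subseteq> inv_space n J"
    by (rule cfun.span_minimal[OF _ subspace_inv_space]) (auto intro: coset_ind_inv_space)
  show "inv_space n J \<subseteq> cfun.span (coset_ind n J ` symgrp n)"
  proof
    fix f assume f: "f \<in> inv_space n J"
    let ?N = "of_nat (card (young n J)) :: complex"
    have "f = (\<Sum>w\<in>symgrp n. (\<lambda>x. (f w / ?N) * coset_ind n J w x))"
    proof
      fix x
      have sym: "coset_ind n J w x = coset_ind n J x w" if "w \<in> symgrp n" "x \<in> symgrp n" for w
        using coset_ind_eq_iff[OF that, of J] coset_ind_eq_iff[OF that(2,1), of J] that by (auto simp: coset_ind_def)
      show "f x = (\<Sum>w\<in>symgrp n. (\<lambda>x. (f w / ?N) * coset_ind n J w x)) x"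
      proof (cases "x \<in> symgrp n")
        case True
        have "(\<Sum>w\<in>symgrp n. (f w / ?N) * coset_ind n J w x) = (\<Sum>w\<in>symgrp n. f w * coset_ind n J x w) / ?N"
          by (simp add: sum_divide_distrib sym[OF _ True])
        also have "\<dots> = f x" using sum_coset_ind[OF True f] card_young_pos[of n J] by simp
        finally show ?thesis by (simp add: sum_fun_apply)
      next
        case False
        then show ?thesis using f by (simp add: sum_fun_apply coset_ind_def inv_space_def)
      qed
    qed
    also have "\<dots> \<in> cfun.span (coset_ind n J ` symgrp n)"
      by (intro cfun.span_sum cfun.span_scale cfun.span_base imageI)
    finally show "f \<in> cfun.span (coset_ind n J ` symgrp n)" .
  qed
qed

section \<open>Ribbon polytabloids: orthogonality, straightening, independence\<close>

lemma ribbon_vec_alt: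
  "ribbon_vec n J v = (\<Sum>c\<in>young n ({1..<n} - J). (\<lambda>x. of_int (sign c) * coset_ind n J (v \<circ> c) x))"
  by (rule ext) (simp add: ribbon_vec_def sum_fun_apply)

lemma ribbon_vec_inv_space:
  assumes "v \<in> symgrp n"
  shows "ribbon_vec n J v \<in> inv_space n J"
  unfolding ribbon_vec_alt
proof (rule cfun.subspace_sum[OF subspace_inv_space])
  fix c assume "c \<in> young n ({1..<n} - J)"
  then have "v \<circ> c \<in> symgrp n" by (rule symgrp_comp[OF assms young_symgrp])
  then show "(\<lambda>x. of_int (sign c) * coset_ind n J (v \<circ> c) x) \<in> inv_space n J"
    by (intro cfun.subspace_scale[OF subspace_inv_space] coset_ind_inv_space)
qed

lemma inv_space_cnj: "f \<in> inv_space n J \<Longrightarrow> (\<lambda>x. cnj (f x)) \<in> inv_space n J"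
  by (auto simp: inv_space_def)

text \<open>The transposition at \<open>i\<close> lies in the column group, where it reverses the
  sign, and also in the Young subgroup that leaves \<open>h\<close> invariant. Reindexing the sum
  over \<open>c\<close> by this transposition makes it its own negative.\<close>

lemma ribbon_vec_orthogonal:
  assumes "v \<in> symgrp n" "i \<in> {1..<n} - J" "h \<in> inv_space n (insert i J)"
  shows "(\<Sum>x\<in>symgrp n. cnj (h x) * ribbon_vec n J v x) = 0"
proof -
  let ?C = "young n ({1..<n} - J)" and ?s = "transpose i (Suc i)"
  have h: "(\<lambda>x. cnj (h x)) \<in> inv_space n J" using inv_space_mono[of J "insert i J" n] inv_space_cnj[of h] assms(3) by blast
  have s: "?s \<in> ?C" "?s \<in> young n (insert i J)" using assms(2) by (auto intro: adjacent_transpose_young)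
  have "(\<Sum>x\<in>symgrp n. cnj (h x) * ribbon_vec n J v x) =
    (\<Sum>x\<in>symgrp n. \<Sum>c\<in>?C. of_int (sign c) * (cnj (h x) * coset_ind n J (v \<circ> c) x))"
    by (simp add: ribbon_vec_def sum_distrib_left mult.left_commute)
  also have "\<dots> = (\<Sum>c\<in>?C. of_int (sign c) * (\<Sum>x\<in>symgrp n. cnj (h x) * coset_ind n J (v \<circ> c) x))"
    by (subst sum.swap) (simp only: sum_distrib_left)
  also have "\<dots> = (\<Sum>c\<in>?C. of_int (sign c) * (of_nat (card (young n J)) * cnj (h (v \<circ> c))))"
    by (intro sum.cong refl arg_cong2[where f = "(*)"] sum_coset_ind[OF _ h] symgrp_comp[OF assms(1)] young_symgrp)
  finally have e: "(\<Sum>x\<in>symgrp n. cnj (h x) * ribbon_vec n J v x) = (\<Sum>c\<in>?C. of_int (sign c) * (of_nat (card (young n J)) * cnj (h (v \<circ> c))))" .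
  let ?g = "\<lambda>c. of_int (sign c) * (of_nat (card (young n J)) * cnj (h (v \<circ> c)))"
  have "(\<Sum>c\<in>?C. ?g c) = (\<Sum>c\<in>?C. ?g (c \<circ> ?s))"
  proof (rule sum.reindex_bij_betw[symmetric], rule bij_betwI)
    show "(\<lambda>c. c \<circ> ?s) \<in> ?C \<rightarrow> ?C" by (rule funcsetI) (rule young_comp[OF _ s(1)])
    then show "(\<lambda>c. c \<circ> ?s) \<in> ?C \<rightarrow> ?C" .
  qed (simp_all add: comp_assoc)
  also have "\<dots> = (\<Sum>c\<in>?C. - ?g c)"
  proof (rule sum.cong[OF refl])
    fix c assume c: "c \<in> ?C"
    have cG: "c \<in> symgrp n" using c by (rule young_symgrp)
    have "sign (c \<circ> ?s) = - sign c"
      by (simp add: sign_compose[OF symgrp_perm[OF cG] permutation_swap_id] sign_swap_id)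
    moreover have "h (v \<circ> c \<circ> ?s) = h (v \<circ> c)"
      using assms(3) s(2) symgrp_comp[OF assms(1) cG] unfolding inv_space_def by blast
    ultimately show "?g (c \<circ> ?s) = - ?g c" by (simp add: comp_assoc)
  qed
  finally show ?thesis unfolding e by (simp add: sum_negf)
qed

text \<open>A function in both spans is orthogonal to itself for the Hermitian form on functions on
  \<open>symgrp n\<close>.\<close>

lemma ribbon_span_disjoint:
  "cfun.span (ribbon_vec n J ` symgrp n) \<inter> cfun.span (\<Union>i\<in>{1..<n} - J. inv_space n (insert i J)) \<subseteq> {0}"
proof
  fix f assume f: "f \<in> cfun.span (ribbon_vec n J ` symgrp n) \<inter> cfun.span (\<Union>i\<in>{1..<n} - J. inv_space n (insert i J))"
  have orth: "(\<Sum>x\<in>symgrp n. cnj (h x) * f x) = 0" if "h \<in> inv_space n (insert i J)" "i \<in> {1..<n} - J" for h i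
  proof -
    have sub: "cfun.subspace {f. (\<Sum>x\<in>symgrp n. cnj (h x) * f x) = 0}"
    proof (rule cfun.subspaceI)
      fix c and g :: permfun assume "g \<in> {f. (\<Sum>x\<in>symgrp n. cnj (h x) * f x) = 0}"
      then have "c * (\<Sum>x\<in>symgrp n. cnj (h x) * g x) = 0" by simp
      then show "(\<lambda>x. c * g x) \<in> {f. (\<Sum>x\<in>symgrp n. cnj (h x) * f x) = 0}"
        by (simp add: sum_distrib_left mult.left_commute)
    qed (auto simp: distrib_left sum.distrib)
    have "cfun.span (ribbon_vec n J ` symgrp n) \<subseteq> {f. (\<Sum>x\<in>symgrp n. cnj (h x) * f x) = 0}"
      by (rule cfun.span_minimal[OF _ sub]) (auto intro: ribbon_vec_orthogonal[OF _ that(2,1)])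
    then show ?thesis using f by blast
  qed
  have orth': "(\<Sum>x\<in>symgrp n. cnj (h x) * f x) = 0" if "h \<in> cfun.span (\<Union>i\<in>{1..<n} - J. inv_space n (insert i J))" for h
  proof -
    have sub: "cfun.subspace {h. (\<Sum>x\<in>symgrp n. cnj (h x) * f x) = 0}"
    proof (rule cfun.subspaceI)
      fix c and g :: permfun assume "g \<in> {h. (\<Sum>x\<in>symgrp n. cnj (h x) * f x) = 0}"
      then have "cnj c * (\<Sum>x\<in>symgrp n. cnj (g x) * f x) = 0" by simp
      then show "(\<lambda>x. c * g x) \<in> {h. (\<Sum>x\<in>symgrp n. cnj (h x) * f x) = 0}"
        by (simp add: sum_distrib_left mult.assoc)
    qed (auto simp: distrib_right sum.distrib)
    have "cfun.span (\<Union>i\<in>{1..<n} - J. inv_space n (insert i J)) \<subseteq> {h. (\<Sum>x\<in>symgrp n. cnj (h x) * f x) = 0}"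
      by (rule cfun.span_minimal[OF _ sub]) (auto intro: orth)
    then show ?thesis using that by blast
  qed
  have "(\<Sum>x\<in>symgrp n. cnj (f x) * f x) = 0" using orth' f by blast
  then have "(\<Sum>x\<in>symgrp n. complex_of_real ((cmod (f x))\<^sup>2)) = 0"
    by (simp only: complex_norm_square mult.commute)
  then have "complex_of_real (\<Sum>x\<in>symgrp n. (cmod (f x))\<^sup>2) = 0" by (simp only: of_real_sum)
  then have "(\<Sum>x\<in>symgrp n. (cmod (f x))\<^sup>2) = 0" by (simp only: of_real_eq_0_iff)
  then have z: "f x = 0" if "x \<in> symgrp n" for x
    using that finite_symgrp[of n] by (subst (asm) sum_nonneg_eq_0_iff) auto
  have "cfun.span (ribbon_vec n J ` symgrp n) \<subseteq> inv_space n J"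
    by (rule cfun.span_minimal[OF _ subspace_inv_space]) (auto intro: ribbon_vec_inv_space)
  then have "f \<in> inv_space n J" using f by blast
  then have "f x = 0" for x using z by (cases "x \<in> symgrp n") (auto simp: inv_space_def)
  then show "f \<in> {0}" by (simp add: fun_eq_iff)
qed

text \<open>The large coset is a disjoint union of small ones. Summing over the image, a set of
  functions, counts each small coset once although several \<open>u\<close> may yield it.\<close>

lemma coset_ind_insert_decompose:
  assumes w: "w \<in> symgrp n"
  shows "coset_ind n (insert i J) w = (\<Sum>q\<in>(\<lambda>u. coset_ind n J (w \<circ> u)) ` young n (insert i J). q)"
proof
  let ?Y = "young n (insert i J)"
  let ?Q = "(\<lambda>u. coset_ind n J (w \<circ> u)) ` ?Y"
  fix x
  have finQ: "finite ?Q" using finite_young by simp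
  have val: "coset_ind n J (w \<circ> u) x = (if x \<in> symgrp n \<and> coset_ind n J (w \<circ> u) = coset_ind n J x then 1 else 0)"
    if "u \<in> ?Y" for u
  proof (cases "x \<in> symgrp n")
    case True
    then show ?thesis
      using coset_ind_eq_iff[OF symgrp_comp[OF w young_symgrp[OF that]] True, of J] by (simp add: coset_ind_def)
  qed (simp add: coset_ind_def)
  have "(\<Sum>q\<in>?Q. q) x = (\<Sum>q\<in>?Q. q x)" by (rule sum_fun_apply)
  also have "\<dots> = (\<Sum>q\<in>?Q. if coset_ind n J x = q then of_bool (x \<in> symgrp n) else 0)"
    by (rule sum.cong[OF refl]) (auto simp: val)
  also have "\<dots> = of_bool (x \<in> symgrp n \<and> coset_ind n J x \<in> ?Q)"
    using finQ by (simp add: sum.delta' of_bool_def)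
  also have "(x \<in> symgrp n \<and> coset_ind n J x \<in> ?Q) \<longleftrightarrow> (x \<in> symgrp n \<and> inv w \<circ> x \<in> ?Y)"
  proof (intro conj_cong refl iffI)
    assume x: "x \<in> symgrp n" and "coset_ind n J x \<in> ?Q"
    then obtain u where u: "u \<in> ?Y" "coset_ind n J (w \<circ> u) = coset_ind n J x" by (metis (no_types, lifting) imageE)
    have uG: "u \<in> symgrp n" using u(1) by (rule young_symgrp)
    have "inv (w \<circ> u) \<circ> x \<in> young n J" using u(2) coset_ind_eq_iff[OF symgrp_comp[OF w uG] x] by blast
    then have "inv u \<circ> (inv w \<circ> x) \<in> ?Y" using young_mono[of J "insert i J" n] by (auto simp: symgrp_inv_comp[OF w uG] comp_assoc)
    with u(1) have "u \<circ> (inv u \<circ> (inv w \<circ> x)) \<in> ?Y" by (rule young_comp)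
    then show "inv w \<circ> x \<in> ?Y" by (simp only: symgrp_inv_o(4)[OF uG])
  next
    assume "inv w \<circ> x \<in> ?Y"
    then have "coset_ind n J (w \<circ> (inv w \<circ> x)) \<in> ?Q" by (rule imageI)
    then show "coset_ind n J x \<in> ?Q" by (simp only: symgrp_inv_o(4)[OF w])
  qed
  finally show "coset_ind n (insert i J) w x = (\<Sum>q\<in>?Q. q) x" by (simp only: coset_ind_def[of n "insert i J"])
qed

text \<open>Straightening: an ascent \<open>i \<notin> J\<close> of \<open>w\<close> is traded, modulo functions invariant under the larger
  Young subgroup, for cosets whose ascending representatives have smaller weight.\<close>

lemma coset_ind_straighten:
  assumes J: "J \<subseteq> {1..<n}" and "w \<in> symgrp n" "J \<subseteq> ascents n w"
  shows "coset_ind n J w \<in> cfun.span (coset_ind n J ` {v \<in> symgrp n. ascents n v = J} \<union>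
    (\<Union>i\<in>{1..<n} - J. inv_space n (insert i J)))" (is "_ \<in> cfun.span (?E \<union> ?P)")
  using assms(2,3)
proof (induct "nat (perm_weight n w)" arbitrary: w rule: less_induct)
  case less
  show ?case
  proof (cases "ascents n w = J")
    case True
    then show ?thesis using less(2) by (intro cfun.span_base UnI1 imageI) auto
  next
    case False
    then obtain i where i: "i \<in> ascents n w" "i \<notin> J" using less(3) by blast
    have iI: "i \<in> {1..<n} - J" using i by (auto simp: ascents_def)
    let ?Y = "young n (insert i J)"
    let ?Q = "(\<lambda>u. coset_ind n J (w \<circ> u)) ` ?Y"
    have self: "coset_ind n J w \<in> ?Q" using imageI[OF young_id[of n "insert i J"], of "\<lambda>u. coset_ind n J (w \<circ> u)"] by simp
    have "coset_ind n (insert i J) w = coset_ind n J w + (\<Sum>q\<in>?Q - {coset_ind n J w}. q)"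
      unfolding coset_ind_insert_decompose[OF less(2)]
      by (rule sum.remove[OF finite_imageI[OF finite_young] self])
    then have e: "coset_ind n J w = coset_ind n (insert i J) w - (\<Sum>q\<in>?Q - {coset_ind n J w}. q)" by simp
    have "coset_ind n (insert i J) w \<in> cfun.span (?E \<union> ?P)"
      using iI coset_ind_inv_space[OF less(2), of "insert i J"] by (intro cfun.span_base) auto
    moreover have "(\<Sum>q\<in>?Q - {coset_ind n J w}. q) \<in> cfun.span (?E \<union> ?P)"
    proof (rule cfun.span_sum)
      fix q assume q: "q \<in> ?Q - {coset_ind n J w}"
      then obtain u where u: "u \<in> ?Y" "q = coset_ind n J (w \<circ> u)" by (metis (no_types, lifting) DiffD1 imageE)
      have wu: "w \<circ> u \<in> symgrp n" using symgrp_comp[OF less(2) young_symgrp[OF u(1)]] .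
      \<comment> \<open>The other small cosets are given ascending representatives, so that the
        induction hypothesis fits them.\<close>
      obtain y where y: "y \<in> young n J" "J \<subseteq> ascents n (w \<circ> u \<circ> y)"
        using ex_ascending_representative[OF wu J] by (metis comp_assoc)
      have q': "q = coset_ind n J (w \<circ> (u \<circ> y))"
        using coset_ind_translate[OF wu y(1)] u(2) by (simp only: comp_assoc)
      have uy: "u \<circ> y \<in> ?Y" using young_comp[OF u(1), of y] young_mono[of J "insert i J" n] y(1) by blast
      have ne: "u \<circ> y \<noteq> id"
      proof
        assume "u \<circ> y = id"
        then have "q = coset_ind n J w" using q' by simp
        then show False using q by simp
      qed
      \<comment> \<open>Within its coset for \<open>insert i J\<close>, \<open>w\<close> is itself
        ascending and hence the unique element of largest weight.\<close>
      have "insert i J \<subseteq> ascents n w" using i less(3) by simp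
      then have lt: "perm_weight n (w \<circ> (u \<circ> y)) < perm_weight n w"
        using less(2) uy ne by (intro perm_weight_ascending)
      have "perm_weight n (w \<circ> (u \<circ> y)) \<ge> 0" by (simp add: perm_weight_def weight_def sum_nonneg)
      then have "nat (perm_weight n (w \<circ> (u \<circ> y))) < nat (perm_weight n w)" using lt by simp
      moreover have "w \<circ> (u \<circ> y) \<in> symgrp n" using symgrp_comp[OF less(2) young_symgrp[OF uy]] .
      ultimately show "q \<in> cfun.span (?E \<union> ?P)"
        unfolding q' using y(2) by (intro less(1)) (simp_all only: comp_assoc)
    qed
    ultimately show ?thesis by (subst e) (rule cfun.span_diff)
  qed
qed

text \<open>In a vanishing combination, take an index \<open>v\<close> of least height among those
  with nonzero coefficient and evaluate at \<open>v\<close>: only the diagonal term can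
  survive.\<close>

lemma triangular_independent:
  fixes e :: "'a \<Rightarrow> 'a \<Rightarrow> complex" and h :: "'a \<Rightarrow> int"
  assumes "finite I" and diag: "\<And>v. v \<in> I \<Longrightarrow> e v v \<noteq> 0"
    and tri: "\<And>v w. v \<in> I \<Longrightarrow> w \<in> I \<Longrightarrow> v \<noteq> w \<Longrightarrow> e v w \<noteq> 0 \<Longrightarrow> h v < h w"
  shows "inj_on e I" "cfun.independent (e ` I)"
proof -
  show inj: "inj_on e I"
  proof (rule inj_onI, rule ccontr)
    fix v w assume vw: "v \<in> I" "w \<in> I" "e v = e w" "v \<noteq> w"
    then have "h v < h w" using diag[of w] by (intro tri) auto
    moreover have "h w < h v" using diag[of v] vw by (intro tri) auto
    ultimately show False by simp
  qed
  show "cfun.independent (e ` I)"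
  proof (rule cfun.independent_if_scalars_zero)
    show "finite (e ` I)" using assms(1) by simp
    fix a x assume z: "(\<Sum>x\<in>e ` I. (\<lambda>y. a x * x y)) = 0" and x: "x \<in> e ` I"
    have z': "(\<Sum>v\<in>I. a (e v) * e v y) = 0" for y
    proof -
      have "(\<Sum>v\<in>I. a (e v) * e v y) = (\<Sum>x\<in>e ` I. a x * x y)" by (simp add: sum.reindex[OF inj])
      also have "\<dots> = (\<Sum>x\<in>e ` I. (\<lambda>y. a x * x y)) y" by (simp add: sum_fun_apply)
      finally show ?thesis using z by simp
    qed
    show "a x = 0"
    proof (rule ccontr)
      assume "a x \<noteq> 0"
      define B where "B = {v \<in> I. a (e v) \<noteq> 0}"
      have B: "finite B" "B \<noteq> {}" using assms(1) x \<open>a x \<noteq> 0\<close> by (auto simp: B_def)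
      then obtain v where v: "v \<in> B" "\<And>w. w \<in> B \<Longrightarrow> h v \<le> h w"
        using ex_min_if_finite[of "h ` B"] by (metis (mono_tags, lifting) arg_min_if_finite(1) arg_min_least)
      have vI: "v \<in> I" using v(1) by (simp add: B_def)
      have "(\<Sum>w\<in>I. a (e w) * e w v) = (\<Sum>w\<in>I. if w = v then a (e v) * e v v else 0)"
      proof (rule sum.cong[OF refl])
        fix w assume w: "w \<in> I"
        show "a (e w) * e w v = (if w = v then a (e v) * e v v else 0)"
        proof (cases "w = v \<or> w \<notin> B")
          case True
          then show ?thesis using w by (auto simp: B_def)
        next
          case False
          then have "\<not> h w < h v" using v(2)[of w] by simp
          then have "e w v = 0" using tri[OF w vI] False by blast
          then show ?thesis using False by simp
        qed
      qed
      also have "\<dots> = a (e v) * e v v" using assms(1) vI by simp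
      finally have "a (e v) * e v v = 0" using z'[of v] by simp
      then show False using diag[OF vI] v(1) by (simp add: B_def)
    qed
  qed
qed

text \<open>A nonzero value means \<open>w = v \<circ> c \<circ> r\<close> with \<open>c\<close> in
  the column and \<open>r\<close> in the row subgroup. As \<open>c\<close> acts along descents of
  \<open>v\<close> it raises the weight, and as \<open>inv r\<close> acts along ascents of
  \<open>w\<close> it lowers it; \<open>v \<circ> c = w \<circ> inv r\<close> links the two
  inequalities.\<close>

lemma ribbon_vec_triangular:
  assumes v: "v \<in> symgrp n" "ascents n v = J" and w: "w \<in> symgrp n" "ascents n w = J"
    and nz: "ribbon_vec n J v w \<noteq> 0" and ne: "v \<noteq> w"
  shows "perm_weight n v < perm_weight n w"
proof -
  let ?C = "young n ({1..<n} - J)"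
  obtain c where c: "c \<in> ?C" "coset_ind n J (v \<circ> c) w \<noteq> 0"
    using nz unfolding ribbon_vec_def by (metis (mono_tags, lifting) mult_zero_right sum.neutral)
  have cG: "c \<in> symgrp n" using c(1) by (rule young_symgrp)
  have vc: "v \<circ> c \<in> symgrp n" using v(1) cG by (rule symgrp_comp)
  define r where "r = inv (v \<circ> c) \<circ> w"
  have r: "r \<in> young n J" using c(2) by (auto simp: coset_ind_def r_def split: if_splits)
  have rG: "r \<in> symgrp n" using r by (rule young_symgrp)
  have wr: "w = v \<circ> c \<circ> r" unfolding r_def by (simp only: symgrp_inv_o(4)[OF vc])
  then have wr': "w \<circ> inv r = v \<circ> c" by (simp only: comp_assoc symgrp_inv_o(1)[OF rG] comp_id)
  have 1: "perm_weight n v < perm_weight n (v \<circ> c)" if "c \<noteq> id"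
    using v that c(1) by (intro perm_weight_descending) auto
  have 2: "perm_weight n (w \<circ> inv r) < perm_weight n w" if "inv r \<noteq> id"
    using w that r by (intro perm_weight_ascending[where J = J] young_inv) auto
  show ?thesis
  proof (cases "c = id")
    case True
    then have "inv r \<noteq> id" using ne wr' by auto
    then show ?thesis using 2 wr' True by simp
  next
    case False
    then show ?thesis using 1 2 wr' by (cases "inv r = id") auto
  qed
qed

text \<open>Only \<open>c = id\<close> contributes, as the row and column subgroups meet
  trivially.\<close>

lemma ribbon_vec_diag:
  assumes "v \<in> symgrp n" "J \<subseteq> {1..<n}"
  shows "ribbon_vec n J v v = 1"
proof -
  let ?C = "young n ({1..<n} - J)"
  have "ribbon_vec n J v v = (\<Sum>c\<in>?C. if c = id then 1 else 0)"
    unfolding ribbon_vec_def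
  proof (rule sum.cong[OF refl])
    fix c assume c: "c \<in> ?C"
    have cG: "c \<in> symgrp n" using c by (rule young_symgrp)
    have e: "inv (v \<circ> c) \<circ> v = inv c"
      by (simp only: symgrp_inv_comp[OF assms(1) cG] comp_assoc symgrp_inv_o(2)[OF assms(1)] comp_id)
    have "inv c \<in> young n J \<longleftrightarrow> c = id"
    proof
      assume "inv c \<in> young n J"
      then have "inv (inv c) \<in> young n J" by (rule young_inv)
      then have "c \<in> young n J" by (simp only: symgrp_inv_inv[OF cG])
      then show "c = id" using c by (rule young_disjoint)
    qed (simp add: young_id)
    then show "of_int (sign c) * coset_ind n J (v \<circ> c) v = (if c = id then 1 else 0)"
      using assms(1) by (simp add: coset_ind_def e)
  qed
  also have "\<dots> = 1" using finite_young young_id by (simp add: sum.delta)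
  finally show ?thesis .
qed

text \<open>Each permutation takes the ribbon of its own ascent set. Over all permutations these
  vectors will form one basis adapted to every module in play.\<close>

abbreviation desc_vec :: "nat \<Rightarrow> (nat \<Rightarrow> nat) \<Rightarrow> permfun" where
  "desc_vec n v \<equiv> ribbon_vec n (ascents n v) v"

lemma ascents_subset: "ascents n v \<subseteq> {1..<n}"
  by (auto simp: ascents_def)

text \<open>Downward induction on \<open>J\<close>. By straightening, \<open>?F\<close> together
  with the functions of larger invariance spans the space; by triangularity and orthogonality,
  \<open>?E\<close> together with them is independent. Both are indexed by the permutations with
  ascent set \<open>J\<close>, so a count of vectors makes the two spans equal.\<close>

lemma inv_space_eq_desc_span:
  assumes "J \<subseteq> {1..<n}"
  shows "inv_space n J = cfun.span (desc_vec n ` {v \<in> symgrp n. J \<subseteq> ascents n v})"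
  using assms
proof (induct "card ({1..<n} - J)" arbitrary: J rule: less_induct)
  case less
  let ?I = "{1..<n}" and ?G = "symgrp n"
  let ?A = "{v \<in> ?G. ascents n v = J}"
  let ?D = "desc_vec n ` {v \<in> ?G. J \<subset> ascents n v}"
  let ?P = "\<Union>i\<in>?I - J. inv_space n (insert i J)"
  let ?E = "ribbon_vec n J ` ?A" and ?F = "coset_ind n J ` ?A"
  have finA: "finite ?A" "finite {v \<in> ?G. J \<subset> ascents n v}" using finite_symgrp by auto
  have memD: "desc_vec n v \<in> inv_space n J" if "v \<in> ?G" "J \<subseteq> ascents n v" for v
    using ribbon_vec_inv_space[OF that(1), of "ascents n v"] inv_space_mono[OF that(2), of n] by (rule rev_subsetD)
  have PD: "?P \<subseteq> cfun.span ?D"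
  proof (rule UN_least)
    fix i assume i: "i \<in> ?I - J"
    have "card (?I - insert i J) < card (?I - J)" 
    proof (rule psubset_card_mono)
      show "?I - insert i J \<subset> ?I - J" using i by blast
    qed simp
    then have "inv_space n (insert i J) = cfun.span (desc_vec n ` {v \<in> ?G. insert i J \<subseteq> ascents n v})"
      by (rule less(1)) (use i less(2) in blast)
    also have "\<dots> \<subseteq> cfun.span ?D"
    proof (intro cfun.span_mono image_mono)
      show "{v \<in> ?G. insert i J \<subseteq> ascents n v} \<subseteq> {v \<in> ?G. J \<subset> ascents n v}" using i by blast
    qed
    finally show "inv_space n (insert i J) \<subseteq> cfun.span ?D" .
  qed
  have DP: "?D \<subseteq> ?P"
  proof
    fix d assume "d \<in> ?D"
    then obtain v where v: "v \<in> ?G" "J \<subset> ascents n v" "d = desc_vec n v" by blast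
    then obtain i where i: "i \<in> ascents n v" "i \<notin> J" by blast
    have "desc_vec n v \<in> inv_space n (insert i J)"
      using ribbon_vec_inv_space[OF v(1), of "ascents n v"] inv_space_mono[of "insert i J" "ascents n v" n] i v(2) by blast
    then show "d \<in> ?P" using i v(3) ascents_subset[of n v] by blast
  qed
  \<comment> \<open>Independence of \<open>?D\<close> is not yet known, so the count uses an
    independent subset with the same span.\<close>
  obtain Q where Q: "Q \<subseteq> ?D" "cfun.independent Q" "?D \<subseteq> cfun.span Q"
    by (rule cfun.maximal_independent_subset)
  have finQ: "finite Q" using Q(1) finA(2) finite_subset by blast
  have spQ: "cfun.span Q = cfun.span ?D"
    using cfun.span_mono[OF Q(1)] cfun.span_minimal[OF Q(3) cfun.subspace_span] by (rule equalityI)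
  have PQ: "?P \<subseteq> cfun.span Q" using PD spQ by simp
  have spP: "cfun.span Q \<subseteq> cfun.span ?P" using Q(1) DP by (intro cfun.span_mono) blast
  have inE: "inj_on (ribbon_vec n J) ?A" "cfun.independent ?E"
  proof -
    have diag: "\<And>v. v \<in> ?A \<Longrightarrow> ribbon_vec n J v v \<noteq> 0" using ribbon_vec_diag[OF _ less(2)] by simp
    have tri: "\<And>v w. v \<in> ?A \<Longrightarrow> w \<in> ?A \<Longrightarrow> v \<noteq> w \<Longrightarrow> ribbon_vec n J v w \<noteq> 0 \<Longrightarrow> perm_weight n v < perm_weight n w"
      by (rule ribbon_vec_triangular) auto
    show "inj_on (ribbon_vec n J) ?A" by (rule triangular_independent(1)[OF finA(1) diag tri])
    show "cfun.independent ?E" by (rule triangular_independent(2)[OF finA(1) diag tri])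
  qed
  have disj: "cfun.span ?E \<inter> cfun.span Q \<subseteq> {0}"
  proof -
    have "cfun.span ?E \<subseteq> cfun.span (ribbon_vec n J ` ?G)" by (intro cfun.span_mono image_mono) auto
    then show ?thesis using ribbon_span_disjoint[of n J] spP by blast
  qed
  have EQ: "cfun.independent (?E \<union> Q)" "?E \<inter> Q = {}"
    using independent_Un[OF _ finQ inE(2) Q(2) disj] finA(1) by auto
  have span1: "inv_space n J = cfun.span (?F \<union> Q)"
  proof
    have FP: "?F \<union> ?P \<subseteq> cfun.span (?F \<union> Q)"
    proof (rule Un_least)
      show "?F \<subseteq> cfun.span (?F \<union> Q)" using cfun.span_superset[of "?F \<union> Q"] by (rule subset_trans[rotated]) simp
      show "?P \<subseteq> cfun.span (?F \<union> Q)" using PQ cfun.span_mono[of Q "?F \<union> Q"] by (rule subset_trans) simp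
    qed
    have "coset_ind n J ` ?G \<subseteq> cfun.span (?F \<union> Q)"
    proof
      fix q assume "q \<in> coset_ind n J ` ?G"
      then obtain w where w: "w \<in> ?G" "q = coset_ind n J w" by (rule imageE)
      obtain u where u: "u \<in> young n J" "J \<subseteq> ascents n (w \<circ> u)"
        using ex_ascending_representative[OF w(1) less(2)] by (rule bexE)
      have "coset_ind n J (w \<circ> u) \<in> cfun.span (?F \<union> ?P)"
        by (rule coset_ind_straighten[OF less(2) symgrp_comp[OF w(1) young_symgrp[OF u(1)]] u(2)])
      then have "q \<in> cfun.span (?F \<union> ?P)" by (simp only: w(2) coset_ind_translate[OF w(1) u(1)])
      then show "q \<in> cfun.span (?F \<union> Q)"
        using cfun.span_minimal[OF FP cfun.subspace_span] by (rule rev_subsetD)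
    qed
    then show "inv_space n J \<subseteq> cfun.span (?F \<union> Q)"
      unfolding inv_space_eq_span[of n J] by (rule cfun.span_minimal[OF _ cfun.subspace_span])
    have "?F \<subseteq> inv_space n J" by (auto intro: coset_ind_inv_space)
    moreover have "Q \<subseteq> inv_space n J" using Q(1) memD by blast
    ultimately show "cfun.span (?F \<union> Q) \<subseteq> inv_space n J"
      by (intro cfun.span_minimal[OF _ subspace_inv_space] Un_least)
  qed
  have subE: "?E \<union> Q \<subseteq> cfun.span (?F \<union> Q)"
  proof -
    have "?E \<subseteq> inv_space n J" by (auto intro: ribbon_vec_inv_space)
    moreover have "Q \<subseteq> inv_space n J" using Q(1) memD by blast
    ultimately show ?thesis using span1 by blast
  qed
  have "card (?F \<union> Q) \<le> card (?E \<union> Q)"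
  proof -
    have "card (?F \<union> Q) \<le> card ?F + card Q" by (rule card_Un_le)
    also have "card ?F \<le> card ?A" by (rule card_image_le[OF finA(1)])
    also have "card ?A = card ?E" by (rule card_image[OF inE(1), symmetric])
    also have "card ?E + card Q = card (?E \<union> Q)" using EQ(2) finA(1) finQ by (simp add: card_Un_disjoint)
    finally show ?thesis by simp
  qed
  then have "cfun.span (?E \<union> Q) = inv_space n J"
    unfolding span1 using finA(1) finQ subE EQ(1) by (intro independent_card_ge_spanning) auto
  moreover have "cfun.span (?E \<union> Q) = cfun.span (?E \<union> ?D)"
  proof
    show "cfun.span (?E \<union> Q) \<subseteq> cfun.span (?E \<union> ?D)" using Q(1) by (intro cfun.span_mono) blast
    have "?E \<union> ?D \<subseteq> cfun.span (?E \<union> Q)"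
    proof (rule Un_least)
      show "?E \<subseteq> cfun.span (?E \<union> Q)" using cfun.span_superset[of "?E \<union> Q"] by (rule subset_trans[rotated]) simp
      show "?D \<subseteq> cfun.span (?E \<union> Q)" using Q(3) cfun.span_mono[of Q "?E \<union> Q"] by (rule subset_trans) simp
    qed
    then show "cfun.span (?E \<union> ?D) \<subseteq> cfun.span (?E \<union> Q)" by (rule cfun.span_minimal[OF _ cfun.subspace_span])
  qed
  moreover have "?E \<union> ?D = desc_vec n ` {v \<in> ?G. J \<subseteq> ascents n v}"
  proof -
    have "?E = desc_vec n ` ?A" by (rule image_cong) auto
    then have "?E \<union> ?D = desc_vec n ` (?A \<union> {v \<in> ?G. J \<subset> ascents n v})" by (simp only: image_Un)
    also have "?A \<union> {v \<in> ?G. J \<subset> ascents n v} = {v \<in> ?G. J \<subseteq> ascents n v}" by auto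
    finally show ?thesis .
  qed
  ultimately show ?case by simp
qed

text \<open>For \<open>J = {}\<close> the Young subgroup is trivial, so these vectors span a space
  of dimension n!. Being at most n! in number, they are distinct and independent.\<close>

lemma desc_vec_basis:
  "inj_on (desc_vec n) (symgrp n)" "cfun.independent (desc_vec n ` symgrp n)"
proof -
  let ?T = "coset_ind n {} ` symgrp n" and ?B = "desc_vec n ` symgrp n"
  have triv: "young n {} = {id}"
  proof -
    have "u = id" if "u \<in> young n {}" for u
    proof (rule young_disjoint[OF that])
      show "u \<in> young n ({1..<n} - {})" using young_symgrp[OF that] young_full[of n] by simp
    qed
    then show ?thesis using young_id[of n "{}"] by blast
  qed
  have "coset_ind n {} v w \<noteq> 0 \<Longrightarrow> w = v" if "v \<in> symgrp n" for v w
    using symgrp_inv_o(4)[OF that, of w] by (auto simp: coset_ind_def triv split: if_splits)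
  then have tri: "\<And>v w. v \<in> symgrp n \<Longrightarrow> w \<in> symgrp n \<Longrightarrow> v \<noteq> w \<Longrightarrow> coset_ind n {} v w \<noteq> 0 \<Longrightarrow> perm_weight n v < perm_weight n w"
    by blast
  have diag: "\<And>v. v \<in> symgrp n \<Longrightarrow> coset_ind n {} v v \<noteq> 0" by (simp add: coset_ind_self)
  have T: "inj_on (coset_ind n {}) (symgrp n)" "cfun.independent ?T"
    by (rule triangular_independent(1)[OF finite_symgrp diag tri], assumption+)
      (rule triangular_independent(2)[OF finite_symgrp diag tri], assumption+)
  have cT: "card ?T = card (symgrp n)" by (rule card_image[OF T(1)])
  have "cfun.span ?B = inv_space n {}"
    using inv_space_eq_desc_span[of "{}" n] by simp
  then have TB: "?T \<subseteq> cfun.span ?B" using coset_ind_inv_space[of _ n "{}"] by blast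
  have finB: "finite ?B" using finite_symgrp by simp
  have cB: "card ?B \<le> card (symgrp n)" by (rule card_image_le[OF finite_symgrp])
  then show "cfun.independent ?B"
    using cT by (intro spanning_card_le_independent[OF finB TB T(2)]) simp
  have "card ?T \<le> card ?B" using cfun.independent_span_bound[OF finB T(2) TB] by simp
  then have "card ?B = card (symgrp n)" using cT cB by simp
  then show "inj_on (desc_vec n) (symgrp n)" by (rule eq_card_imp_inj_on[OF finite_symgrp])
qed

text \<open>An element of the ribbon span splits into a part with ascent set \<open>J\<close> and a
  part with larger ascent sets. The second part lies in the ribbon span and in the span of the
  functions of larger invariance, hence is 0.\<close>

lemma ribbon_span_eq:
  assumes J: "J \<subseteq> {1..<n}"
  shows "cfun.span (ribbon_vec n J ` symgrp n) = cfun.span (desc_vec n ` {v \<in> symgrp n. ascents n v = J})"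
proof
  let ?A = "{v \<in> symgrp n. ascents n v = J}"
  let ?D = "desc_vec n ` {v \<in> symgrp n. J \<subset> ascents n v}"
  let ?P = "\<Union>i\<in>{1..<n} - J. inv_space n (insert i J)"
  have AE: "desc_vec n ` ?A = ribbon_vec n J ` ?A" by (rule image_cong) auto
  show sub: "cfun.span (desc_vec n ` ?A) \<subseteq> cfun.span (ribbon_vec n J ` symgrp n)"
    unfolding AE by (intro cfun.span_mono image_mono) auto
  show "cfun.span (ribbon_vec n J ` symgrp n) \<subseteq> cfun.span (desc_vec n ` ?A)"
  proof
    fix f assume f: "f \<in> cfun.span (ribbon_vec n J ` symgrp n)"
    have "cfun.span (ribbon_vec n J ` symgrp n) \<subseteq> inv_space n J"
      by (rule cfun.span_minimal[OF _ subspace_inv_space]) (auto intro: ribbon_vec_inv_space)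
    then have "f \<in> inv_space n J" using f by blast
    also have "inv_space n J = cfun.span (desc_vec n ` ?A \<union> ?D)"
    proof -
      have "{v \<in> symgrp n. J \<subseteq> ascents n v} = ?A \<union> {v \<in> symgrp n. J \<subset> ascents n v}" by auto
      then show ?thesis unfolding inv_space_eq_desc_span[OF J] by (simp only: image_Un)
    qed
    finally obtain s p where sp: "f = s + p" "s \<in> cfun.span (desc_vec n ` ?A)" "p \<in> cfun.span ?D"
      unfolding cfun.span_Un by blast
    have "?D \<subseteq> ?P"
    proof
      fix d assume "d \<in> ?D"
      then obtain v where v: "v \<in> symgrp n" "J \<subset> ascents n v" "d = desc_vec n v" by blast
      then obtain i where i: "i \<in> ascents n v" "i \<notin> J" by blast
      have "desc_vec n v \<in> inv_space n (insert i J)"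
        using ribbon_vec_inv_space[OF v(1), of "ascents n v"] inv_space_mono[of "insert i J" "ascents n v" n] i v(2) by blast
      then show "d \<in> ?P" using i v(3) ascents_subset[of n v] by blast
    qed
    then have "p \<in> cfun.span ?P" using sp(3) cfun.span_mono[of ?D ?P] by blast
    moreover have "p \<in> cfun.span (ribbon_vec n J ` symgrp n)"
    proof -
      have "s \<in> cfun.span (ribbon_vec n J ` symgrp n)" using sp(2) sub by blast
      with f have "f - s \<in> cfun.span (ribbon_vec n J ` symgrp n)" by (rule cfun.span_diff)
      then show ?thesis using sp(1) by simp
    qed
    ultimately have "p = 0" using ribbon_span_disjoint[of n J] by blast
    then show "f \<in> cfun.span (desc_vec n ` ?A)" using sp by simp
  qed
qed

section \<open>Left translation and its traces\<close>

lemma linear_ltrans: "Vector_Spaces.linear (\<lambda>c v x. c * v x) (\<lambda>c v x. c * v x) (ltrans \<pi>)"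
  by unfold_locales (simp_all add: ltrans_def fun_eq_iff algebra_simps)

lemma ltrans_coset_ind:
  assumes "\<pi> \<in> symgrp n" "w \<in> symgrp n"
  shows "ltrans \<pi> (coset_ind n J w) = coset_ind n J (\<pi> \<circ> w)"
proof
  fix x
  have "inv \<pi> \<circ> x \<in> symgrp n \<longleftrightarrow> x \<in> symgrp n"
  proof
    assume "inv \<pi> \<circ> x \<in> symgrp n"
    with assms(1) have "\<pi> \<circ> (inv \<pi> \<circ> x) \<in> symgrp n" by (rule symgrp_comp)
    then show "x \<in> symgrp n" by (simp only: symgrp_inv_o(4)[OF assms(1)])
  qed (rule symgrp_comp[OF symgrp_inv[OF assms(1)]])
  then show "ltrans \<pi> (coset_ind n J w) x = coset_ind n J (\<pi> \<circ> w) x"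
    by (simp only: ltrans_def coset_ind_def symgrp_inv_comp[OF assms] comp_assoc)
qed

lemma ltrans_ribbon_vec:
  assumes "\<pi> \<in> symgrp n" "v \<in> symgrp n"
  shows "ltrans \<pi> (ribbon_vec n J v) = ribbon_vec n J (\<pi> \<circ> v)"
proof
  fix x
  have e: "coset_ind n J (v \<circ> c) (inv \<pi> \<circ> x) = coset_ind n J (\<pi> \<circ> v \<circ> c) x" if "c \<in> young n ({1..<n} - J)" for c
    using fun_cong[OF ltrans_coset_ind[OF assms(1) symgrp_comp[OF assms(2) young_symgrp[OF that]]], of J x]
    by (simp only: ltrans_def comp_assoc)
  show "ltrans \<pi> (ribbon_vec n J v) x = ribbon_vec n J (\<pi> \<circ> v) x"
    unfolding ltrans_def ribbon_vec_def by (rule sum.cong[OF refl]) (simp only: e)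
qed

text \<open>The basis falls into blocks by ascent set. Each block spans the ribbon module of its
  set, which is stable under left translation, so the matrix is block diagonal.\<close>

lemma trace_inv_space_decompose:
  assumes \<pi>: "\<pi> \<in> symgrp n" and J: "J \<subseteq> {1..<n}"
  shows "trace_on (inv_space n J) (ltrans \<pi>) =
    (\<Sum>K | J \<subseteq> K \<and> K \<subseteq> {1..<n}. trace_on (cfun.span (ribbon_vec n K ` symgrp n)) (ltrans \<pi>))"
proof -
  let ?G = "symgrp n"
  let ?V = "{v \<in> ?G. J \<subseteq> ascents n v}" and ?A = "\<lambda>K. {v \<in> ?G. ascents n v = K}"
  let ?B = "desc_vec n ` ?V" and ?BK = "\<lambda>K. desc_vec n ` ?A K"
  have indep: "cfun.independent (desc_vec n ` S)" if "S \<subseteq> ?G" for S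
    using that by (intro cfun.independent_mono[OF desc_vec_basis(2)[of n]] image_mono)
  have inj: "inj_on (desc_vec n) S" if "S \<subseteq> ?G" for S
    using that desc_vec_basis(1)[of n] inj_on_subset by blast
  have fin: "finite S" if "S \<subseteq> ?G" for S using that finite_symgrp finite_subset by blast
  have Lsp: "ltrans \<pi> (desc_vec n v) \<in> cfun.span (?BK K)" if v: "v \<in> ?A K" for v K
  proof -
    have K: "K \<subseteq> {1..<n}" using v ascents_subset by blast
    have "ltrans \<pi> (desc_vec n v) = ribbon_vec n K (\<pi> \<circ> v)" using v ltrans_ribbon_vec[OF \<pi>, of v K] by auto
    also have "\<dots> \<in> cfun.span (ribbon_vec n K ` ?G)"
    proof (rule cfun.span_base[OF imageI])
      show "\<pi> \<circ> v \<in> ?G" using v by (intro symgrp_comp[OF \<pi>]) blast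
    qed
    finally show ?thesis by (simp only: ribbon_span_eq[OF K])
  qed
  have tK: "trace_on (cfun.span (ribbon_vec n K ` ?G)) (ltrans \<pi>) =
      (\<Sum>v\<in>?A K. cfun.representation (?BK K) (ltrans \<pi> (desc_vec n v)) (desc_vec n v))" if "K \<subseteq> {1..<n}" for K
  proof -
    have "trace_on (cfun.span (ribbon_vec n K ` ?G)) (ltrans \<pi>) =
      (\<Sum>b\<in>?BK K. cfun.representation (?BK K) (ltrans \<pi> b) b)"
    proof (rule trace_on_basis[OF _ _ _ linear_ltrans])
      show "finite (?BK K)" using fin[of "?A K"] by simp
      show "cfun.independent (?BK K)" by (rule indep) auto
      show sp: "cfun.span (?BK K) = cfun.span (ribbon_vec n K ` ?G)" by (rule ribbon_span_eq[OF that, symmetric])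
      fix b assume "b \<in> ?BK K"
      then obtain v where "v \<in> ?A K" "b = desc_vec n v" by (rule imageE)
      then show "ltrans \<pi> b \<in> cfun.span (ribbon_vec n K ` ?G)" using Lsp[of v K] sp by simp
    qed
    also have "\<dots> = (\<Sum>v\<in>?A K. cfun.representation (?BK K) (ltrans \<pi> (desc_vec n v)) (desc_vec n v))"
      using inj[of "?A K"] by (subst sum.reindex) auto
    finally show ?thesis .
  qed
  have "trace_on (inv_space n J) (ltrans \<pi>) = (\<Sum>b\<in>?B. cfun.representation ?B (ltrans \<pi> b) b)"
  proof (rule trace_on_basis[OF _ _ _ linear_ltrans])
    show "finite ?B" using fin[of ?V] by simp
    show "cfun.independent ?B" by (rule indep) auto
    show sp: "cfun.span ?B = inv_space n J" by (rule inv_space_eq_desc_span[OF J, symmetric])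
    fix b assume "b \<in> ?B"
    then obtain v where v: "v \<in> ?V" "b = desc_vec n v" by (rule imageE)
    have "?BK (ascents n v) \<subseteq> ?B" using v(1) by (intro image_mono) auto
    then have "cfun.span (?BK (ascents n v)) \<subseteq> cfun.span ?B" by (rule cfun.span_mono)
    moreover have "ltrans \<pi> (desc_vec n v) \<in> cfun.span (?BK (ascents n v))" using v(1) by (intro Lsp) auto
    ultimately show "ltrans \<pi> b \<in> inv_space n J" using v(2) sp by auto
  qed
  also have "\<dots> = (\<Sum>v\<in>?V. cfun.representation ?B (ltrans \<pi> (desc_vec n v)) (desc_vec n v))"
    using inj[of ?V] by (subst sum.reindex) auto
  also have "\<dots> = (\<Sum>K | J \<subseteq> K \<and> K \<subseteq> {1..<n}. \<Sum>v\<in>{v \<in> ?V. ascents n v = K}. cfun.representation ?B (ltrans \<pi> (desc_vec n v)) (desc_vec n v))"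
  proof (rule sum.group[symmetric])
    show "finite ?V" by (rule fin) auto
    show "finite {K. J \<subseteq> K \<and> K \<subseteq> {1..<n}}" by (rule finite_subset[of _ "Pow {1..<n}"]) auto
    show "ascents n ` ?V \<subseteq> {K. J \<subseteq> K \<and> K \<subseteq> {1..<n}}" using ascents_subset by auto
  qed
  also have "\<dots> = (\<Sum>K | J \<subseteq> K \<and> K \<subseteq> {1..<n}. trace_on (cfun.span (ribbon_vec n K ` ?G)) (ltrans \<pi>))"
  proof (rule sum.cong[OF refl])
    fix K assume "K \<in> {K. J \<subseteq> K \<and> K \<subseteq> {1..<n}}"
    then have K: "J \<subseteq> K" "K \<subseteq> {1..<n}" by auto
    have eqA: "{v \<in> ?V. ascents n v = K} = ?A K" using K by auto
    have BKB: "?BK K \<subseteq> ?B" using K by (intro image_mono) auto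
    have iB: "cfun.independent ?B" by (rule indep) auto
    show "(\<Sum>v\<in>{v \<in> ?V. ascents n v = K}. cfun.representation ?B (ltrans \<pi> (desc_vec n v)) (desc_vec n v)) =
      trace_on (cfun.span (ribbon_vec n K ` ?G)) (ltrans \<pi>)"
      unfolding eqA tK[OF K(2)]
      by (rule sum.cong[OF refl]) (simp only: cfun.representation_extend[OF iB Lsp BKB])
  qed
  finally show ?thesis .
qed

text \<open>The coset indicators form a basis that left translation permutes, so the trace counts
  fixed cosets; taking the image collects each coset once.\<close>

lemma trace_inv_space:
  assumes \<pi>: "\<pi> \<in> symgrp n"
  shows "trace_on (inv_space n J) (ltrans \<pi>) = of_nat (card (coset_ind n J ` {w \<in> symgrp n. inv w \<circ> (\<pi> \<circ> w) \<in> young n J}))"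
proof -
  let ?B = "coset_ind n J ` symgrp n"
  have finB: "finite ?B" using finite_symgrp by simp
  have disj: "q = coset_ind n J x" if q: "q \<in> ?B" and nz: "q x \<noteq> 0" for q x
  proof -
    obtain w where w: "w \<in> symgrp n" "q = coset_ind n J w" using q by (rule imageE)
    have "x \<in> symgrp n" "inv w \<circ> x \<in> young n J" using nz w by (auto simp: coset_ind_def split: if_splits)
    then show ?thesis using coset_ind_eq_iff[OF w(1), of x J] w(2) by simp
  qed
  have indep: "cfun.independent ?B"
  proof (rule cfun.independent_if_scalars_zero[OF finB])
    fix a q assume z: "(\<Sum>q\<in>?B. (\<lambda>x. a q * q x)) = 0" and q: "q \<in> ?B"
    obtain w where w: "w \<in> symgrp n" "q = coset_ind n J w" using q by (rule imageE)
    have "(\<Sum>r\<in>?B. a r * r w) = (\<Sum>r\<in>?B. if r = q then a q else 0)"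
    proof (rule sum.cong[OF refl])
      fix r assume r: "r \<in> ?B"
      show "a r * r w = (if r = q then a q else 0)"
      proof (cases "r = q")
        case True then show ?thesis using coset_ind_self[OF w(1)] w(2) by simp
      next
        case False
        then have "r w = 0" using disj[OF r, of w] w(2) by blast
        then show ?thesis using False by simp
      qed
    qed
    also have "\<dots> = a q" using finB q by simp
    finally have "a q = (\<Sum>r\<in>?B. (\<lambda>x. a r * r x)) w" by (simp add: sum_fun_apply)
    then show "a q = 0" using z by simp
  qed
  have L: "ltrans \<pi> b \<in> ?B" if "b \<in> ?B" for b
  proof -
    obtain w where w: "w \<in> symgrp n" "b = coset_ind n J w" using \<open>b \<in> ?B\<close> by (rule imageE)
    show ?thesis unfolding w(2) ltrans_coset_ind[OF \<pi> w(1)] by (rule imageI[OF symgrp_comp[OF \<pi> w(1)]])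
  qed
  have "trace_on (inv_space n J) (ltrans \<pi>) = (\<Sum>b\<in>?B. cfun.representation ?B (ltrans \<pi> b) b)"
  proof (rule trace_on_basis[OF finB indep _ linear_ltrans])
    show sp: "cfun.span ?B = inv_space n J" by (rule inv_space_eq_span[symmetric])
    fix b assume "b \<in> ?B"
    from cfun.span_base[OF L[OF this]] show "ltrans \<pi> b \<in> inv_space n J" by (simp only: sp)
  qed
  also have "\<dots> = (\<Sum>b\<in>?B. if ltrans \<pi> b = b then 1 else 0)"
    by (rule sum.cong[OF refl]) (auto simp: cfun.representation_basis[OF indep L])
  also have "\<dots> = of_nat (card {b \<in> ?B. ltrans \<pi> b = b})"
    using sum.inter_filter[OF finB, of "\<lambda>_. 1 :: complex" "\<lambda>b. ltrans \<pi> b = b"] by simp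
  also have "{b \<in> ?B. ltrans \<pi> b = b} = coset_ind n J ` {w \<in> symgrp n. inv w \<circ> (\<pi> \<circ> w) \<in> young n J}"
  proof -
    have "ltrans \<pi> (coset_ind n J w) = coset_ind n J w \<longleftrightarrow> inv w \<circ> (\<pi> \<circ> w) \<in> young n J" if w: "w \<in> symgrp n" for w
      using coset_ind_eq_iff[OF w symgrp_comp[OF \<pi> w], of J] by (auto simp: ltrans_coset_ind[OF \<pi> w])
    then show ?thesis by auto
  qed
  finally show ?thesis .
qed

section \<open>Fixed cosets and weakly increasing words\<close>

lemma card_image_eq_of_same_fibres:
  assumes "\<And>w w'. w \<in> H \<Longrightarrow> w' \<in> H \<Longrightarrow> \<alpha> w = \<alpha> w' \<longleftrightarrow> \<beta> w = \<beta> w'"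
  shows "card (\<alpha> ` H) = card (\<beta> ` H)"
proof -
  let ?g = "\<lambda>y. \<beta> (inv_into H \<alpha> y)"
  have g: "?g (\<alpha> w) = \<beta> w" if "w \<in> H" for w
  proof -
    have "inv_into H \<alpha> (\<alpha> w) \<in> H" "\<alpha> (inv_into H \<alpha> (\<alpha> w)) = \<alpha> w"
      using that by (auto intro: inv_into_into f_inv_into_f)
    then show ?thesis using assms[OF _ that, of "inv_into H \<alpha> (\<alpha> w)"] by simp
  qed
  have "inj_on ?g (\<alpha> ` H)"
  proof (rule inj_onI)
    fix y y' assume y: "y \<in> \<alpha> ` H" "y' \<in> \<alpha> ` H" "?g y = ?g y'"
    then obtain w w' where w: "w \<in> H" "y = \<alpha> w" "w' \<in> H" "y' = \<alpha> w'" by (metis imageE)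
    then have "\<beta> w = \<beta> w'" using y(3) g by simp
    then show "y = y'" using w assms by simp
  qed
  then have "card (?g ` \<alpha> ` H) = card (\<alpha> ` H)" by (rule card_image)
  moreover have "?g ` \<alpha> ` H = \<beta> ` H" using g by (simp add: image_image)
  ultimately show ?thesis by simp
qed

definition mono_words :: "nat \<Rightarrow> nat \<Rightarrow> (nat \<Rightarrow> nat) set" where
  "mono_words n x = {g \<in> {1..n} \<rightarrow>\<^sub>E {1..x}. \<forall>i\<in>{1..<n}. g i \<le> g (Suc i)}"

definition levels :: "nat \<Rightarrow> (nat \<Rightarrow> nat) \<Rightarrow> nat set" where
  "levels n g = {i \<in> {1..<n}. g i = g (Suc i)}"

lemma mono_words_le:
  assumes "g \<in> mono_words n x" "1 \<le> a" "a \<le> b" "b \<le> n"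
  shows "g a \<le> g b"
proof (cases "a = b")
  case False
  then have "a < b" using assms(3) by simp
  then show ?thesis
    by (rule interval_chain[where R = "(\<le>)", rotated])
      (use assms in \<open>auto simp: mono_words_def intro: transpI\<close>)
qed simp

lemma finite_mono_words: "finite (mono_words n x)"
proof -
  have "finite ({1..n} \<rightarrow>\<^sub>E {1..x})" by (intro finite_PiE) auto
  then show ?thesis unfolding mono_words_def by (rule rev_finite_subset) blast
qed

text \<open>Where \<open>g\<close> jumps, \<open>u\<close> cannot carry a position across.
  Conversely, for \<open>u\<close> in the Young subgroup there is no jump between \<open>p\<close>
  and \<open>u p\<close>, so \<open>g\<close> is constant there.\<close>

lemma stabilizer_mono_word:
  assumes g: "g \<in> mono_words n x" and u: "u \<in> symgrp n"
  shows "g \<circ> u = g \<longleftrightarrow> u \<in> young n (levels n g)"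
proof
  assume gu: "g \<circ> u = g"
  have up: "u permutes {1..n}" using u by (simp add: symgrp_iff)
  have "u ` {1..i} = {1..i}" if i: "i \<in> {1..<n} - levels n g" for i
  proof (rule endo_inj_surj)
    show "inj_on u {1..i}" by (rule permutes_inj_on[OF up])
    show "u ` {1..i} \<subseteq> {1..i}"
    proof
      fix y assume "y \<in> u ` {1..i}"
      then obtain p where p: "p \<in> {1..i}" "y = u p" by (rule imageE)
      have pn: "p \<in> {1..n}" using p(1) i by auto
      have yn: "y \<in> {1..n}" using permutes_in_image[OF up, of p] pn p(2) by simp
      have "g y = g p" using fun_cong[OF gu, of p] p(2) by simp
      also have "g p \<le> g i" using p i by (intro mono_words_le[OF g]) auto
      also have "g i < g (Suc i)"
        using mono_words_le[OF g, of i "Suc i"] i by (auto simp: levels_def)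
      finally have "\<not> Suc i \<le> y" using mono_words_le[OF g, of "Suc i" y] yn by auto
      then show "y \<in> {1..i}" using yn by auto
    qed
  qed simp
  then show "u \<in> young n (levels n g)" using u by (simp add: young_def)
next
  assume uy: "u \<in> young n (levels n g)"
  have up: "u permutes {1..n}" using u by (simp add: symgrp_iff)
  show "g \<circ> u = g"
  proof
    fix p
    show "(g \<circ> u) p = g p"
    proof (cases "p \<in> {1..n}")
      case False
      then show ?thesis using permutes_not_in[OF up] by simp
    next
      case pn: True
      then have un: "u p \<in> {1..n}" using permutes_in_image[OF up] by blast
      have lev: "q \<in> levels n g" if "(p \<le> q \<and> q < u p) \<or> (u p \<le> q \<and> q < p)" for q
      proof (rule ccontr)
        assume "q \<notin> levels n g"
        moreover have "q \<in> {1..<n}" using that pn un by auto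
        ultimately have e: "u ` {1..q} = {1..q}" using uy by (simp add: young_def)
        show False
        proof (cases "p \<le> q \<and> q < u p")
          case True
          then have "p \<in> {1..q}" using pn by auto
          then have "u p \<in> {1..q}" using e by blast
          then show False using True by auto
        next
          case False
          then have q: "u p \<le> q" "q < p" using that by auto
          then have "u p \<in> u ` {1..q}" unfolding e using un by auto
          then obtain r where "r \<in> {1..q}" "u p = u r" by (rule imageE)
          then have "p = r" using symgrp_eq_iff[OF u] by simp
          then show False using q \<open>r \<in> {1..q}\<close> by auto
        qed
      qed
      have const: "g a = g b" if "a < b" "\<And>q. a \<le> q \<Longrightarrow> q < b \<Longrightarrow> q \<in> levels n g" for a b
        by (rule interval_chain[where R = "(=)", OF _ that(1)]) (use that(2) in \<open>auto simp: levels_def intro: transpI\<close>)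
      show ?thesis
        using const[of p "u p"] const[of "u p" p] lev by (cases p "u p" rule: linorder_cases) auto
    qed
  qed
qed

text \<open>Both words list the same multiset in sorted order.\<close>

lemma mono_word_unique:
  assumes g: "g \<in> mono_words n x" and g': "g \<circ> u \<in> mono_words n x" and u: "u \<in> symgrp n"
  shows "g \<circ> u = g"
proof -
  have up: "u permutes {1..n}" using u by (simp add: symgrp_iff)
  have sorted: "sorted (map h [1..<Suc n])" if "h \<in> mono_words n x" for h
    unfolding sorted_iff_nth_mono
  proof (intro allI impI)
    fix i j assume ij: "i \<le> j" "j < length (map h [1..<Suc n])"
    then have jn: "j < n" by (simp del: upt_Suc)
    have "h (1 + i) \<le> h (1 + j)" by (rule mono_words_le[OF that]) (use ij jn in simp_all)
    then show "map h [1..<Suc n] ! i \<le> map h [1..<Suc n] ! j" using ij jn by (simp del: upt_Suc)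
  qed
  have "mset (map (g \<circ> u) [1..<Suc n]) = image_mset g (image_mset u (mset_set {1..n}))"
    by (simp del: upt_Suc add: multiset.map_comp atLeastLessThanSuc_atLeastAtMost)
  also have "image_mset u (mset_set {1..n}) = mset_set {1..n}"
    by (rule permutes_image_mset[OF up])
  also have "image_mset g (mset_set {1..n}) = mset (map g [1..<Suc n])"
    by (simp del: upt_Suc add: atLeastLessThanSuc_atLeastAtMost)
  finally have "sort (map g [1..<Suc n]) = map (g \<circ> u) [1..<Suc n]"
    by (rule properties_for_sort) (rule sorted[OF g'])
  moreover have "sort (map g [1..<Suc n]) = map g [1..<Suc n]"
    by (rule sorted_sort_id[OF sorted[OF g]])
  ultimately have eq: "map (g \<circ> u) [1..<Suc n] = map g [1..<Suc n]" by simp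
  show ?thesis
  proof
    fix p
    show "(g \<circ> u) p = g p"
    proof (cases "p \<in> {1..n}")
      case True
      then have "p \<in> set [1..<Suc n]" by auto
      then show ?thesis using eq unfolding map_eq_conv by blast
    next
      case False
      then show ?thesis using permutes_not_in[OF up] by simp
    qed
  qed
qed

text \<open>A rearrangement of largest \<open>weight\<close> cannot have an adjacent
  descent.\<close>

lemma ex_mono_word:
  assumes f: "f \<in> {1..n} \<rightarrow>\<^sub>E {1..x}"
  shows "\<exists>w\<in>symgrp n. f \<circ> w \<in> mono_words n x"
proof -
  let ?h = "\<lambda>w. weight n (\<lambda>p. int (f (w p)))"
  have fin: "finite (?h ` symgrp n)" using finite_symgrp by simp
  have "Max (?h ` symgrp n) \<in> ?h ` symgrp n"
    by (rule Max_in[OF fin]) (use symgrp_id in blast)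
  then obtain w where w: "w \<in> symgrp n" "?h w = Max (?h ` symgrp n)" by auto
  have wp: "w permutes {1..n}" using w(1) by (simp add: symgrp_iff)
  have "f (w i) \<le> f (w (Suc i))" if i: "i \<in> {1..<n}" for i
  proof -
    have "transpose i (Suc i) \<in> symgrp n"
      using young_symgrp[OF adjacent_transpose_young[OF i i]] .
    then have "w \<circ> transpose i (Suc i) \<in> symgrp n" by (rule symgrp_comp[OF w(1)])
    then have "?h (w \<circ> transpose i (Suc i)) \<in> ?h ` symgrp n" by (rule imageI)
    then have "?h (w \<circ> transpose i (Suc i)) \<le> ?h w"
      unfolding w(2) by (rule Max_ge[OF fin])
    then show ?thesis
      using weight_adjacent_transpose[OF i, of "\<lambda>p. int (f (w p))"] by (simp add: o_def)
  qed
  moreover have "f \<circ> w \<in> {1..n} \<rightarrow>\<^sub>E {1..x}"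
  proof (rule PiE_I)
    fix p assume "p \<in> {1..n}"
    then have "w p \<in> {1..n}" using permutes_in_image[OF wp] by blast
    then show "(f \<circ> w) p \<in> {1..x}" using f by auto
  next
    fix p assume "p \<notin> {1..n}"
    then show "(f \<circ> w) p = undefined" using permutes_not_in[OF wp] f by auto
  qed
  ultimately show ?thesis using w(1) by (auto simp: mono_words_def)
qed

text \<open>The left side counts the words fixed by \<pi>. Each word is
  \<open>g \<circ> inv w\<close> for exactly one increasing word \<open>g\<close>, and the fixed
  words belonging to \<open>g\<close> correspond to the fixed cosets of the stabilizer of
  \<open>g\<close>, whose number is the trace.\<close>

lemma power_num_cycles_eq_sum_traces:
  assumes \<pi>: "\<pi> \<in> symgrp n"
  shows "of_nat x ^ num_cycles n \<pi> = (\<Sum>g\<in>mono_words n x. trace_on (inv_space n (levels n g)) (ltrans \<pi>))"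
proof -
  let ?G = "symgrp n"
  let ?Inv = "{f \<in> {1..n} \<rightarrow>\<^sub>E {1..x}. \<forall>a\<in>{1..n}. f (\<pi> a) = f a}"
  let ?H = "\<lambda>g. {w \<in> ?G. inv w \<circ> (\<pi> \<circ> w) \<in> young n (levels n g)}"
  let ?S = "\<lambda>g. (\<lambda>w. g \<circ> inv w) ` ?H g"
  have \<pi>p: "\<pi> permutes {1..n}" using \<pi> by (simp add: symgrp_iff)
  have inv_iff: "w \<in> ?H g \<longleftrightarrow> g \<circ> inv w \<circ> \<pi> = g \<circ> inv w" if "g \<in> mono_words n x" "w \<in> ?G" for g w
  proof -
    have "w \<in> ?H g \<longleftrightarrow> g \<circ> (inv w \<circ> (\<pi> \<circ> w)) = g"
      using stabilizer_mono_word[OF that(1) symgrp_comp[OF symgrp_inv[OF that(2)] symgrp_comp[OF \<pi> that(2)]]] that(2) by simp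
    also have "\<dots> \<longleftrightarrow> g \<circ> inv w \<circ> \<pi> = g \<circ> inv w"
    proof
      assume "g \<circ> (inv w \<circ> (\<pi> \<circ> w)) = g"
      then have "(g \<circ> (inv w \<circ> (\<pi> \<circ> w))) \<circ> inv w = g \<circ> inv w" by simp
      then show "g \<circ> inv w \<circ> \<pi> = g \<circ> inv w" by (simp only: comp_assoc symgrp_inv_o(1)[OF that(2)] comp_id)
    next
      assume "g \<circ> inv w \<circ> \<pi> = g \<circ> inv w"
      then have "(g \<circ> inv w \<circ> \<pi>) \<circ> w = (g \<circ> inv w) \<circ> w" by simp
      then show "g \<circ> (inv w \<circ> (\<pi> \<circ> w)) = g" by (simp only: comp_assoc symgrp_inv_o(2)[OF that(2)] comp_id)
    qed
    finally show ?thesis .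
  qed
  have memPi: "g \<circ> inv w \<in> {1..n} \<rightarrow>\<^sub>E {1..x}" if "g \<in> mono_words n x" "w \<in> ?G" for g w
  proof -
    have wp: "inv w permutes {1..n}" using symgrp_inv[OF that(2)] by (simp add: symgrp_iff)
    have g: "g \<in> {1..n} \<rightarrow>\<^sub>E {1..x}" using that(1) by (simp add: mono_words_def)
    show ?thesis
    proof (rule PiE_I)
      fix p assume "p \<in> {1..n}"
      then have "inv w p \<in> {1..n}" using permutes_in_image[OF wp] by blast
      then show "(g \<circ> inv w) p \<in> {1..x}" using g by auto
    next
      fix p assume "p \<notin> {1..n}"
      then show "(g \<circ> inv w) p = undefined" using permutes_not_in[OF wp] g by auto
    qed
  qed
  have Inv: "?Inv = (\<Union>g\<in>mono_words n x. ?S g)"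
  proof (intro equalityI subsetI)
    fix f assume f: "f \<in> ?Inv"
    then have "f \<in> {1..n} \<rightarrow>\<^sub>E {1..x}" by blast
    then obtain w where w: "w \<in> ?G" "f \<circ> w \<in> mono_words n x" using bexE[OF ex_mono_word] by metis
    have fw: "f = (f \<circ> w) \<circ> inv w" by (simp only: comp_assoc symgrp_inv_o(1)[OF w(1)] comp_id)
    have "f \<circ> \<pi> = f"
    proof
      fix a
      show "(f \<circ> \<pi>) a = f a" using f permutes_not_in[OF \<pi>p, of a] by (cases "a \<in> {1..n}") auto
    qed
    then have "w \<in> ?H (f \<circ> w)" unfolding inv_iff[OF w(2,1)] by (simp only: fw[symmetric])
    then have "f \<in> ?S (f \<circ> w)" by (rule rev_image_eqI) (simp only: fw[symmetric])
    then show "f \<in> (\<Union>g\<in>mono_words n x. ?S g)" using w(2) by blast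
  next
    fix f assume "f \<in> (\<Union>g\<in>mono_words n x. ?S g)"
    then obtain g w where g: "g \<in> mono_words n x" "w \<in> ?H g" "f = g \<circ> inv w" by blast
    have w: "w \<in> ?G" using g(2) by blast
    have f\<pi>: "f \<circ> \<pi> = f" using inv_iff[OF g(1) w] g(2,3) by simp
    have "f (\<pi> a) = f a" for a using fun_cong[OF f\<pi>, of a] by simp
    then show "f \<in> ?Inv" using memPi[OF g(1) w] g(3) by simp
  qed
  have disj: "?S g \<inter> ?S g' = {}" if "g \<in> mono_words n x" "g' \<in> mono_words n x" "g \<noteq> g'" for g g'
  proof (rule ccontr)
    assume "?S g \<inter> ?S g' \<noteq> {}"
    then obtain w w' where w: "w \<in> ?G" "w' \<in> ?G" "g \<circ> inv w = g' \<circ> inv w'" by blast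
    have "(g \<circ> inv w) \<circ> w' = (g' \<circ> inv w') \<circ> w'" using w(3) by simp
    then have e: "g \<circ> (inv w \<circ> w') = g'" by (simp only: comp_assoc symgrp_inv_o(2)[OF w(2)] comp_id)
    have "g \<circ> (inv w \<circ> w') = g"
    proof (rule mono_word_unique[OF that(1)])
      show "g \<circ> (inv w \<circ> w') \<in> mono_words n x" using e that(2) by simp
      show "inv w \<circ> w' \<in> ?G" by (rule symgrp_comp[OF symgrp_inv[OF w(1)] w(2)])
    qed
    then show False using e that(3) by simp
  qed
  have finS: "finite (?S g)" for g using finite_symgrp[of n] by simp
  have "(of_nat (x ^ num_cycles n \<pi>) :: complex) = of_nat (card ?Inv)"
    using card_invariant_colourings[OF _ \<pi>p, of "{1..x}"] by (simp add: num_cycles_eq_cyc)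
  also have "card ?Inv = (\<Sum>g\<in>mono_words n x. card (?S g))"
    unfolding Inv using disj finS finite_mono_words by (intro card_UN_disjoint) auto
  also have "of_nat (\<Sum>g\<in>mono_words n x. card (?S g)) = (\<Sum>g\<in>mono_words n x. (of_nat (card (?S g)) :: complex))"
    by (rule of_nat_sum)
  also have "\<dots> = (\<Sum>g\<in>mono_words n x. trace_on (inv_space n (levels n g)) (ltrans \<pi>))"
  proof (rule sum.cong[OF refl])
    fix g assume g: "g \<in> mono_words n x"
    have "card (coset_ind n (levels n g) ` ?H g) = card (?S g)"
    proof (rule card_image_eq_of_same_fibres)
      fix w w' assume "w \<in> ?H g" "w' \<in> ?H g"
      then have w: "w \<in> ?G" "w' \<in> ?G" by auto
      have "coset_ind n (levels n g) w = coset_ind n (levels n g) w' \<longleftrightarrow> g \<circ> (inv w \<circ> w') = g"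
        using coset_ind_eq_iff[OF w] stabilizer_mono_word[OF g symgrp_comp[OF symgrp_inv[OF w(1)] w(2)]] by simp
      also have "\<dots> \<longleftrightarrow> g \<circ> inv w = g \<circ> inv w'"
      proof
        assume "g \<circ> (inv w \<circ> w') = g"
        then have "(g \<circ> (inv w \<circ> w')) \<circ> inv w' = g \<circ> inv w'" by simp
        then show "g \<circ> inv w = g \<circ> inv w'" by (simp only: comp_assoc symgrp_inv_o(1)[OF w(2)] comp_id)
      next
        assume "g \<circ> inv w = g \<circ> inv w'"
        then have "(g \<circ> inv w) \<circ> w' = (g \<circ> inv w') \<circ> w'" by simp
        then show "g \<circ> (inv w \<circ> w') = g" by (simp only: comp_assoc symgrp_inv_o(2)[OF w(2)] comp_id)
      qed
      finally show "coset_ind n (levels n g) w = coset_ind n (levels n g) w' \<longleftrightarrow> g \<circ> inv w = g \<circ> inv w'" .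
    qed
    then show "of_nat (card (?S g)) = trace_on (inv_space n (levels n g)) (ltrans \<pi>)"
      by (simp only: trace_inv_space[OF \<pi>])
  qed
  finally show ?thesis by simp
qed

text \<open>Pascal's rule in \<open>x\<close>, according to whether the last letter is
  \<open>Suc x\<close>. If it is, the remaining letters are bounded by \<open>Suc x\<close> when
  \<open>n \<in> K\<close> permits a tie with the last one, and by \<open>x\<close>
  otherwise.\<close>

lemma card_mono_words_levels:
  "card {g \<in> mono_words n x. levels n g \<subseteq> K} = (x + card (K \<inter> {1..<n})) choose n"
proof (induct n arbitrary: x)
  case 0
  have "{g \<in> mono_words 0 x. levels 0 g \<subseteq> K} = {\<lambda>_. undefined}"
    by (auto simp: mono_words_def levels_def)
  then show ?case by simp
next
  case (Suc n)
  let ?S = "\<lambda>n x. {g \<in> mono_words n x. levels n g \<subseteq> K}"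
  define k where "k = card (K \<inter> {1..<n})"
  define k' where "k' = card (K \<inter> {1..<Suc n})"
  have IH: "card (?S n x) = (x + k) choose n" for x unfolding k_def by (rule Suc)
  have finS: "finite (?S n x)" for n x using finite_mono_words by simp
  have "card (?S (Suc n) x) = (x + k') choose Suc n"
  proof (induct x)
    case 0
    have "?S (Suc n) 0 = {}" by (auto simp: mono_words_def PiE_def Pi_def)
    moreover have "k' < Suc n"
      using card_mono[of "{1..<Suc n}" "K \<inter> {1..<Suc n}"] by (simp add: k'_def)
    ultimately show ?case by (simp only: card.empty) simp
  next
    case (Suc x)
    \<comment> \<open>For \<open>n = 0\<close> there is no preceding letter to tie with, although
      \<open>0\<close> may belong to \<open>K\<close>.\<close>
    let ?y = "if n \<in> K \<and> n \<ge> 1 then Suc x else x"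
    let ?T = "{g \<in> ?S (Suc n) (Suc x). g (Suc n) = Suc x}"
    have top: "g i \<le> g (Suc n)" if "g \<in> mono_words (Suc n) z" "1 \<le> i" "i \<le> Suc n" for g i z
      using mono_words_le[OF that(1,2,3)] by simp
    have split: "?S (Suc n) (Suc x) = ?S (Suc n) x \<union> ?T"
    proof (intro equalityI subsetI)
      fix g assume g: "g \<in> ?S (Suc n) (Suc x)"
      show "g \<in> ?S (Suc n) x \<union> ?T"
      proof (cases "g (Suc n) = Suc x")
        case True then show ?thesis using g by simp
      next
        case False
        have gm: "g \<in> mono_words (Suc n) (Suc x)" using g by simp
        have "g i \<in> {1..x}" if "i \<in> {1..Suc n}" for i
        proof -
          have "g i \<in> {1..Suc x}" "g (Suc n) \<in> {1..Suc x}" using gm that by (auto simp: mono_words_def PiE_def Pi_def)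
          moreover have "g i \<le> g (Suc n)" using that by (intro top[OF gm]) auto
          ultimately show ?thesis using False by auto
        qed
        then have "g \<in> {1..Suc n} \<rightarrow>\<^sub>E {1..x}" using gm by (auto simp: mono_words_def PiE_def Pi_def)
        then have "g \<in> mono_words (Suc n) x" using gm by (simp add: mono_words_def)
        then show ?thesis using g by simp
      qed
    next
      fix g assume "g \<in> ?S (Suc n) x \<union> ?T"
      moreover have "mono_words (Suc n) x \<subseteq> mono_words (Suc n) (Suc x)"
        by (fastforce simp: mono_words_def PiE_def Pi_def)
      ultimately show "g \<in> ?S (Suc n) (Suc x)" by blast
    qed
    have disj: "?S (Suc n) x \<inter> ?T = {}"
      by (fastforce simp: mono_words_def PiE_def Pi_def)
    have bij: "bij_betw (\<lambda>g. restrict g {1..n}) ?T (?S n ?y)"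
    proof (rule bij_betwI[where g = "\<lambda>h. h(Suc n := Suc x)"])
      show "(\<lambda>g. restrict g {1..n}) \<in> ?T \<rightarrow> ?S n ?y"
      proof
        fix g assume g: "g \<in> ?T"
        then have gm: "g \<in> mono_words (Suc n) (Suc x)" and gK: "levels (Suc n) g \<subseteq> K" and gt: "g (Suc n) = Suc x" by auto
        have rng: "g i \<in> {1..?y}" if i: "i \<in> {1..n}" for i
        proof -
          have "g i \<in> {1..Suc x}" using gm i by (auto simp: mono_words_def PiE_def Pi_def)
          moreover have "g i \<le> x" if "n \<notin> K"
          proof -
            have "n \<notin> levels (Suc n) g" using gK that by blast
            then have "g n \<noteq> Suc x" using i gt by (auto simp: levels_def)
            moreover have "g n \<le> Suc x" using top[OF gm, of n] i gt by simp
            moreover have "g i \<le> g n" using mono_words_le[OF gm, of i n] i by auto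
            ultimately show ?thesis by simp
          qed
          ultimately show ?thesis using i by auto
        qed
        have "restrict g {1..n} \<in> mono_words n ?y"
          using rng gm by (auto simp: mono_words_def)
        moreover have "levels n (restrict g {1..n}) \<subseteq> levels (Suc n) g" by (auto simp: levels_def)
        ultimately show "restrict g {1..n} \<in> ?S n ?y" using gK by blast
      qed
      show "(\<lambda>h. h(Suc n := Suc x)) \<in> ?S n ?y \<rightarrow> ?T"
      proof
        fix h assume h: "h \<in> ?S n ?y"
        let ?g = "h(Suc n := Suc x)"
        have hm: "h \<in> mono_words n ?y" and hK: "levels n h \<subseteq> K" using h by auto
        have hr: "h i \<in> {1..?y}" if "i \<in> {1..n}" for i using hm that by (auto simp: mono_words_def PiE_def Pi_def)
        have hle: "h i \<le> Suc x" if "i \<in> {1..n}" for i using hr[OF that] by (auto split: if_splits)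
        have "?g \<in> {1..Suc n} \<rightarrow>\<^sub>E {1..Suc x}"
        proof (rule PiE_I)
          fix i assume "i \<in> {1..Suc n}"
          then show "?g i \<in> {1..Suc x}" using hr[of i] hle[of i] by (cases "i = Suc n") auto
        next
          fix i assume "i \<notin> {1..Suc n}"
          then show "?g i = undefined" using hm by (auto simp: mono_words_def PiE_def extensional_def)
        qed
        moreover have "?g i \<le> ?g (Suc i)" if "i \<in> {1..<Suc n}" for i
          using that hle[of i] hm by (cases "i = n") (auto simp: mono_words_def)
        moreover have "levels (Suc n) ?g \<subseteq> K"
        proof
          fix i assume i: "i \<in> levels (Suc n) ?g"
          show "i \<in> K"
          proof (cases "i = n")
            case True
            then have "h n = Suc x" "n \<ge> 1" using i by (auto simp: levels_def)
            then show ?thesis using hr[of n] True by (auto split: if_splits)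
          next
            case False
            then have "i \<in> levels n h" using i by (auto simp: levels_def)
            then show ?thesis using hK by blast
          qed
        qed
        ultimately show "?g \<in> ?T" by (simp add: mono_words_def)
      qed
    next
      fix g assume "g \<in> ?T"
      then show "(restrict g {1..n})(Suc n := Suc x) = g"
        by (auto simp: mono_words_def PiE_def extensional_def fun_eq_iff)
    next
      fix h assume "h \<in> ?S n ?y"
      then show "restrict (h(Suc n := Suc x)) {1..n} = h"
        by (auto simp: mono_words_def PiE_def extensional_def fun_eq_iff)
    qed
    have "finite ?T" by (rule finite_subset[OF _ finS[of "Suc n" "Suc x"]]) blast
    have "card (?S (Suc n) (Suc x)) = card (?S (Suc n) x \<union> ?T)" by (rule arg_cong[OF split])
    also have "\<dots> = card (?S (Suc n) x) + card ?T"
      by (rule card_Un_disjoint[OF finS \<open>finite ?T\<close> disj])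
    also have "card ?T = (?y + k) choose n" unfolding bij_betw_same_card[OF bij] by (rule IH)
    also have "?y + k = x + k'"
    proof (cases "n \<in> K \<and> n \<ge> 1")
      case True
      then have "K \<inter> {1..<Suc n} = insert n (K \<inter> {1..<n})" by auto
      then have "k' = Suc k" by (simp add: k'_def k_def)
      then show ?thesis using True by simp
    next
      case False
      then have "K \<inter> {1..<Suc n} = K \<inter> {1..<n}" by (auto simp: less_Suc_eq)
      then have "k' = k" by (simp only: k'_def k_def)
      then show ?thesis using False by simp
    qed
    finally show ?case using Suc by simp
  qed
  then show ?case unfolding k'_def .
qed

text \<open>The ribbon of \<open>K\<close> receives one contribution from each increasing word whose
  levels lie in \<open>K\<close>.\<close>

lemma power_num_cycles_eq_sum_ribbon_traces:
  assumes \<pi>: "\<pi> \<in> symgrp n"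
  shows "of_nat x ^ num_cycles n \<pi> = (\<Sum>K\<in>Pow {1..<n}.
    trace_on (cfun.span (ribbon_vec n K ` symgrp n)) (ltrans \<pi>) * of_nat ((x + card K) choose n))"
proof -
  let ?t = "\<lambda>K. trace_on (cfun.span (ribbon_vec n K ` symgrp n)) (ltrans \<pi>)"
  have lev: "levels n g \<subseteq> {1..<n}" for g by (auto simp: levels_def)
  have "of_nat x ^ num_cycles n \<pi> = (\<Sum>g\<in>mono_words n x. \<Sum>K | levels n g \<subseteq> K \<and> K \<subseteq> {1..<n}. ?t K)"
    by (simp only: power_num_cycles_eq_sum_traces[OF \<pi>] trace_inv_space_decompose[OF \<pi> lev])
  also have "\<dots> = (\<Sum>g\<in>mono_words n x. \<Sum>K\<in>Pow {1..<n}. if levels n g \<subseteq> K then ?t K else 0)"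
  proof (rule sum.cong[OF refl])
    fix g
    have "{K. levels n g \<subseteq> K \<and> K \<subseteq> {1..<n}} = {K \<in> Pow {1..<n}. levels n g \<subseteq> K}" by auto
    then show "(\<Sum>K | levels n g \<subseteq> K \<and> K \<subseteq> {1..<n}. ?t K) = (\<Sum>K\<in>Pow {1..<n}. if levels n g \<subseteq> K then ?t K else 0)"
      using sum.inter_filter[of "Pow {1..<n}" ?t "\<lambda>K. levels n g \<subseteq> K"] by simp
  qed
  also have "\<dots> = (\<Sum>K\<in>Pow {1..<n}. \<Sum>g\<in>mono_words n x. if levels n g \<subseteq> K then ?t K else 0)"
    by (rule sum.swap)
  also have "\<dots> = (\<Sum>K\<in>Pow {1..<n}. ?t K * of_nat ((x + card K) choose n))"
  proof (rule sum.cong[OF refl])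
    fix K assume "K \<in> Pow {1..<n}"
    then have K: "K \<inter> {1..<n} = K" by auto
    have "(\<Sum>g\<in>mono_words n x. if levels n g \<subseteq> K then ?t K else 0) = (\<Sum>g\<in>{g \<in> mono_words n x. levels n g \<subseteq> K}. ?t K)"
      using sum.inter_filter[OF finite_mono_words[of n x], of "\<lambda>_. ?t K" "\<lambda>g. levels n g \<subseteq> K"] by simp
    also have "\<dots> = of_nat (card {g \<in> mono_words n x. levels n g \<subseteq> K}) * ?t K" by (rule sum_constant)
    also have "\<dots> = ?t K * of_nat ((x + card K) choose n)"
      by (simp only: card_mono_words_levels K mult.commute)
    finally show "(\<Sum>g\<in>mono_words n x. if levels n g \<subseteq> K then ?t K else 0) = ?t K * of_nat ((x + card K) choose n)" .
  qed
  finally show ?thesis .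
qed

section \<open>Border shapes and subsets\<close>

lemma finite_downset_nat:
  assumes "finite (S :: nat set)" "\<And>c c'. c \<in> S \<Longrightarrow> c' \<le> c \<Longrightarrow> c' \<in> S"
  shows "S = {..<card S}"
proof (cases "S = {}")
  case False
  have "S = {..Max S}"
  proof (intro equalityI subsetI)
    fix c assume "c \<in> {..Max S}"
    then show "c \<in> S" using assms(2)[OF Max_in[OF assms(1) False]] by simp
  qed (use assms(1) in auto)
  then have "card S = Suc (Max S)" by (metis card_atMost)
  then show ?thesis using \<open>S = {..Max S}\<close> by (metis lessThan_Suc_atMost)
qed simp

lemma downset_diagram:
  assumes fin: "finite D" and down: "\<And>r c r' c'. (r, c) \<in> D \<Longrightarrow> r' \<le> r \<Longrightarrow> c' \<le> c \<Longrightarrow> (r', c') \<in> D"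
  shows "\<exists>\<mu>. is_partition \<mu> \<and> diagram \<mu> = D"
proof (intro exI conjI)
  let ?C = "\<lambda>r. {c. (r, c) \<in> D}"
  let ?\<mu> = "\<lambda>r. card (?C r)"
  have finC: "finite (?C r)" for r
    by (rule finite_subset[OF _ finite_imageI[OF fin, of snd]]) force
  have C: "?C r = {..<?\<mu> r}" for r
    by (rule finite_downset_nat[OF finC]) (use down in blast)
  show "diagram ?\<mu> = D"
  proof -
    have "c < ?\<mu> r \<longleftrightarrow> (r, c) \<in> D" for r c using C[of r] by blast
    then show ?thesis by (auto simp: diagram_def)
  qed
  show "is_partition ?\<mu>"
    unfolding is_partition_def
  proof
    show "antimono ?\<mu>"
      by (rule antimonoI, rule card_mono[OF finC]) (use down in blast)
    have "{r. ?\<mu> r \<noteq> 0} \<subseteq> fst ` D" by (force simp: card_gt_0_iff finC)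
    then show "finite {r. ?\<mu> r \<noteq> 0}" using fin finite_subset by blast
  qed
qed

text \<open>An intrinsic form of skewness: convexity in the product order on boxes, with no pair of
  partitions to choose.\<close>

definition convex_shape :: "box set \<Rightarrow> bool" where
  "convex_shape \<beta> \<longleftrightarrow> (\<forall>a\<in>\<beta>. \<forall>b\<in>\<beta>. \<forall>r c. fst a \<le> r \<and> r \<le> fst b \<and> snd a \<le> c \<and> c \<le> snd b \<longrightarrow> (r, c) \<in> \<beta>)"

lemma convex_shapeD:
  "convex_shape \<beta> \<Longrightarrow> a \<in> \<beta> \<Longrightarrow> b \<in> \<beta> \<Longrightarrow> fst a \<le> r \<Longrightarrow> r \<le> fst b \<Longrightarrow> snd a \<le> c \<Longrightarrow> c \<le> snd b \<Longrightarrow> (r, c) \<in> \<beta>"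
  unfolding convex_shape_def by blast

text \<open>The outer partition is the down-closure of \<beta>; what it has beyond \<beta> is again
  a down-set by convexity and serves as the inner partition.\<close>

lemma skew_shape_iff_convex:
  assumes fin: "finite \<beta>"
  shows "skew_shape \<beta> \<longleftrightarrow> convex_shape \<beta>"
proof
  assume "skew_shape \<beta>"
  then obtain \<kappa> \<mu> where k: "is_partition \<kappa>" "is_partition \<mu>" "\<beta> = diagram \<kappa> - diagram \<mu>"
    unfolding skew_shape_def by blast
  have anti: "r \<le> r' \<Longrightarrow> \<kappa> r' \<le> \<kappa> r" "r \<le> r' \<Longrightarrow> \<mu> r' \<le> \<mu> r" for r r'
    using k(1,2) by (auto simp: is_partition_def dest: antimonoD)
  show "convex_shape \<beta>"
    unfolding convex_shape_def
  proof (intro ballI allI impI)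
    fix a b r c assume a: "a \<in> \<beta>" "b \<in> \<beta>" "fst a \<le> r \<and> r \<le> fst b \<and> snd a \<le> c \<and> c \<le> snd b"
    have "snd b < \<kappa> (fst b)" using a(2) by (auto simp: k(3) diagram_def)
    then have "c < \<kappa> r" using anti(1)[of r "fst b"] a(3) by simp
    moreover have "\<mu> (fst a) \<le> snd a" using a(1) by (auto simp: k(3) diagram_def)
    then have "\<mu> r \<le> c" using anti(2)[of "fst a" r] a(3) by simp
    ultimately show "(r, c) \<in> \<beta>" by (simp add: k(3) diagram_def)
  qed
next
  assume conv: "convex_shape \<beta>"
  define D where "D = {(r, c). \<exists>b\<in>\<beta>. r \<le> fst b \<and> c \<le> snd b}"
  have "D \<subseteq> (\<Union>b\<in>\<beta>. {..fst b} \<times> {..snd b})" by (auto simp: D_def)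
  moreover have "finite (\<Union>b\<in>\<beta>. {..fst b} \<times> {..snd b})" using fin by blast
  ultimately have finD: "finite D" by (rule finite_subset)
  have sub: "\<beta> \<subseteq> D" by (force simp: D_def)
  have downD: "(r', c') \<in> D" if "(r, c) \<in> D" "r' \<le> r" "c' \<le> c" for r c r' c'
    using that unfolding D_def by (auto intro: order_trans)
  obtain \<kappa> where \<kappa>: "is_partition \<kappa>" "diagram \<kappa> = D" 
  proof -
    have "\<exists>\<kappa>. is_partition \<kappa> \<and> diagram \<kappa> = D" by (rule downset_diagram[OF finD]) (use downD in blast)
    then show ?thesis using that by blast
  qed
  have downE: "(r', c') \<in> D - \<beta>" if rcD: "(r, c) \<in> D - \<beta>" and rc': "r' \<le> r" "c' \<le> c" for r c r' c'
  proof -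
    have "(r', c') \<notin> \<beta>"
    proof
      assume m: "(r', c') \<in> \<beta>"
      obtain b where b: "b \<in> \<beta>" "r \<le> fst b" "c \<le> snd b" using rcD unfolding D_def by blast
      have "(r, c) \<in> \<beta>" by (rule convex_shapeD[OF conv m b(1)]) (use rc' b in simp_all)
      then show False using rcD by simp
    qed
    then show ?thesis using downD[of r c r' c'] rcD rc' by blast
  qed
  obtain \<mu> where \<mu>: "is_partition \<mu>" "diagram \<mu> = D - \<beta>"
  proof -
    have "\<exists>\<mu>. is_partition \<mu> \<and> diagram \<mu> = D - \<beta>" by (rule downset_diagram[OF finite_Diff[OF finD]]) (use downE in blast)
    then show ?thesis using that by blast
  qed
  show "skew_shape \<beta>"
    unfolding skew_shape_def
  proof (intro exI conjI)
    show "diagram \<mu> \<subseteq> diagram \<kappa>" "\<beta> = diagram \<kappa> - diagram \<mu>" using \<kappa> \<mu> sub by auto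
  qed (fact \<kappa>(1) \<mu>(1))+
qed

text \<open>The ribbon of \<open>K\<close> is traversed from its bottom left box (index \<open>1\<close>) to its top right box (index \<open>n\<close>);
  the step from box \<open>p\<close> to box \<open>p + 1\<close> goes right if \<open>p \<in> K\<close> and up otherwise.\<close>

definition rib_row :: "nat \<Rightarrow> nat set \<Rightarrow> nat \<Rightarrow> nat" where
  "rib_row n K p = card {i \<in> {1..<n} - K. p \<le> i}"

definition rib_col :: "nat set \<Rightarrow> nat \<Rightarrow> nat" where
  "rib_col K p = card {i \<in> K. i < p}"

definition rib_box :: "nat \<Rightarrow> nat set \<Rightarrow> nat \<Rightarrow> box" where
  "rib_box n K p = (rib_row n K p, rib_col K p)"

definition ribbon :: "nat \<Rightarrow> nat set \<Rightarrow> box set" where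
  "ribbon n K = rib_box n K ` {1..n}"

section \<open>Geometry of a ribbon\<close>

lemma rib_row_Suc:
  assumes "p \<in> {1..<n}"
  shows "rib_row n K p = (if p \<in> K then rib_row n K (Suc p) else Suc (rib_row n K (Suc p)))"
proof (cases "p \<in> K")
  case True
  then have "{i \<in> {1..<n} - K. p \<le> i} = {i \<in> {1..<n} - K. Suc p \<le> i}" by (auto simp: Suc_le_eq le_less)
  then show ?thesis using True by (simp only: rib_row_def if_True)
next
  case False
  then have "{i \<in> {1..<n} - K. p \<le> i} = insert p {i \<in> {1..<n} - K. Suc p \<le> i}" using assms by (auto simp: Suc_le_eq le_less)
  then show ?thesis using False by (simp add: rib_row_def)
qed

lemma rib_col_Suc:
  assumes "finite K"
  shows "rib_col K (Suc p) = (if p \<in> K then Suc (rib_col K p) else rib_col K p)"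
proof (cases "p \<in> K")
  case True
  then have "{i \<in> K. i < Suc p} = insert p {i \<in> K. i < p}" by (auto simp: less_Suc_eq)
  then show ?thesis using True assms by (simp add: rib_col_def)
next
  case False
  then have "{i \<in> K. i < Suc p} = {i \<in> K. i < p}" by (auto simp: less_Suc_eq)
  then show ?thesis using False by (simp add: rib_col_def)
qed

lemma rib_row_last: "rib_row n K n = 0"
  by (simp add: rib_row_def)

lemma rib_col_first: "K \<subseteq> {1..<n} \<Longrightarrow> rib_col K 1 = 0"
  by (auto simp: rib_col_def)

lemma rib_row_first: "K \<subseteq> {1..<n} \<Longrightarrow> rib_row n K 1 = n - 1 - card K"
proof -
  assume K: "K \<subseteq> {1..<n}"
  have "{i \<in> {1..<n} - K. 1 \<le> i} = {1..<n} - K" by auto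
  then show ?thesis using K by (simp add: rib_row_def card_Diff_subset finite_subset)
qed

text \<open>Every step, right or up, raises column minus row by one. Hence this difference
  determines the index of a box, which excludes coincident boxes and 2 by 2 squares.\<close>

lemma rib_content:
  assumes K: "K \<subseteq> {1..<n}" and "1 \<le> p" "p \<le> n"
  shows "int (rib_col K p) - int (rib_row n K p) = int p - 1 - int (n - 1 - card K)"
  using assms(2,3)
proof (induct p rule: nat_induct_at_least)
  case base
  show ?case by (simp only: rib_col_first[OF K] rib_row_first[OF K])
next
  case (Suc p)
  have fin: "finite K" using K finite_subset by blast
  have p: "p \<in> {1..<n}" using Suc by auto
  have IH: "int (rib_col K p) - int (rib_row n K p) = int p - 1 - int (n - 1 - card K)"
    by (rule Suc(2)) (use Suc(3) in simp)
  show ?case using IH rib_row_Suc[OF p, of K] rib_col_Suc[OF fin, of p] by (cases "p \<in> K") simp_all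
qed

lemma rib_row_antimono: "p \<le> q \<Longrightarrow> rib_row n K q \<le> rib_row n K p"
  unfolding rib_row_def by (rule card_mono) auto

lemma rib_col_mono: "finite K \<Longrightarrow> p \<le> q \<Longrightarrow> rib_col K p \<le> rib_col K q"
  unfolding rib_col_def by (rule card_mono) auto

lemma rib_box_inj:
  assumes "K \<subseteq> {1..<n}" "rib_box n K p = rib_box n K q" "p \<in> {1..n}" "q \<in> {1..n}"
  shows "p = q"
proof -
  have "rib_row n K p = rib_row n K q" "rib_col K p = rib_col K q" using assms(2) by (simp_all add: rib_box_def)
  moreover have "1 \<le> p" "p \<le> n" "1 \<le> q" "q \<le> n" using assms(3,4) by auto
  ultimately show ?thesis using rib_content[OF assms(1), of p] rib_content[OF assms(1), of q] by linarith
qed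

lemma rib_row_intermediate:
  assumes "p \<in> {1..n}" "q \<in> {1..n}" "p \<le> q" "rib_row n K q \<le> r" "r \<le> rib_row n K p"
  shows "\<exists>s\<in>{p..q}. rib_row n K s = r"
proof -
  have "\<exists>i\<ge>p. i \<le> q \<and> - int (rib_row n K i) = - int r"
  proof (rule nat_intermed_int_val)
    show "\<forall>i. p \<le> i \<and> i < q \<longrightarrow> \<bar>- int (rib_row n K (Suc i)) - - int (rib_row n K i)\<bar> \<le> 1"
    proof (intro allI impI)
      fix i assume "p \<le> i \<and> i < q"
      then have "i \<in> {1..<n}" using assms by auto
      from rib_row_Suc[OF this, of K] show "\<bar>- int (rib_row n K (Suc i)) - - int (rib_row n K i)\<bar> \<le> 1"
        by (auto split: if_splits)
    qed
  qed (use assms in auto)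
  then show ?thesis by auto
qed

lemma rib_col_intermediate:
  assumes "finite K" "p \<le> q" "rib_col K p \<le> c" "c \<le> rib_col K q"
  shows "\<exists>s\<in>{p..q}. rib_col K s = c"
proof -
  have "\<exists>i\<ge>p. i \<le> q \<and> int (rib_col K i) = int c"
    by (rule nat_intermed_int_val) (use assms rib_col_Suc[OF assms(1)] in auto)
  then show ?thesis by auto
qed

text \<open>Along a ribbon rows weakly decrease and columns weakly increase, so two boxes comparable
  in the product order share a row or a column, and the boxes between them are met on the
  way.\<close>

lemma convex_ribbon:
  assumes K: "K \<subseteq> {1..<n}"
  shows "convex_shape (ribbon n K)"
  unfolding convex_shape_def
proof (intro ballI allI impI)
  fix a b r c assume a: "a \<in> ribbon n K" and b: "b \<in> ribbon n K" and rc: "fst a \<le> r \<and> r \<le> fst b \<and> snd a \<le> c \<and> c \<le> snd b"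
  have finK: "finite K" using K finite_subset by blast
  obtain p where p: "p \<in> {1..n}" "a = rib_box n K p" using a unfolding ribbon_def by (rule imageE)
  obtain q where q: "q \<in> {1..n}" "b = rib_box n K q" using b unfolding ribbon_def by (rule imageE)
  have rc': "rib_row n K p \<le> r" "r \<le> rib_row n K q" "rib_col K p \<le> c" "c \<le> rib_col K q"
    using rc p(2) q(2) by (auto simp: rib_box_def)
  have "\<exists>s\<in>{1..n}. rib_row n K s = r \<and> rib_col K s = c"
  proof (cases "p \<le> q")
    case True
    have rr: "rib_row n K q \<le> rib_row n K p" by (rule rib_row_antimono[OF True])
    obtain s where s: "s \<in> {p..q}" "rib_col K s = c" using rib_col_intermediate[OF finK True rc'(3,4)] by blast
    have "rib_row n K q \<le> rib_row n K s" "rib_row n K s \<le> rib_row n K p"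
      using s(1) by (auto intro: rib_row_antimono)
    then have "rib_row n K s = r" using rr rc' by simp
    moreover have "s \<in> {1..n}" using s(1) p(1) q(1) by auto
    ultimately show ?thesis using s(2) by blast
  next
    case False
    then have qp: "q \<le> p" by simp
    have cc: "rib_col K q \<le> rib_col K p" by (rule rib_col_mono[OF finK qp])
    obtain s where s: "s \<in> {q..p}" "rib_row n K s = r" using rib_row_intermediate[OF q(1) p(1) qp rc'(1,2)] by blast
    have "rib_col K q \<le> rib_col K s" "rib_col K s \<le> rib_col K p"
      using s(1) by (auto intro: rib_col_mono[OF finK])
    then have "rib_col K s = c" using cc rc' by simp
    moreover have "s \<in> {1..n}" using s(1) p(1) q(1) by auto
    ultimately show ?thesis using s(2) by blast
  qed
  then show "(r, c) \<in> ribbon n K" unfolding ribbon_def rib_box_def by force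
qed

lemma adjacent_sym: "adjacent x y \<Longrightarrow> adjacent y x"
  by (auto simp: adjacent_def)

lemma adjacent_rib_box:
  assumes "K \<subseteq> {1..<n}" "p \<in> {1..<n}"
  shows "adjacent (rib_box n K p) (rib_box n K (Suc p))"
proof -
  have "finite K" using assms(1) finite_subset by blast
  from rib_col_Suc[OF this, of p] rib_row_Suc[OF assms(2), of K]
  show ?thesis by (auto simp: adjacent_def rib_box_def split: if_splits)
qed

lemma connected_ribbon:
  assumes K: "K \<subseteq> {1..<n}"
  shows "connected_shape (ribbon n K)"
proof -
  let ?R = "{(a, b). a \<in> ribbon n K \<and> b \<in> ribbon n K \<and> adjacent a b}"
  let ?b = "rib_box n K"
  have mem: "?b p \<in> ribbon n K" if "p \<in> {1..n}" for p using that unfolding ribbon_def by (rule imageI)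
  have R: "(?b p, ?b (Suc p)) \<in> ?R" "(?b (Suc p), ?b p) \<in> ?R" if "p \<in> {1..<n}" for p
    using adjacent_rib_box[OF K that] adjacent_sym mem[of p] mem[of "Suc p"] that by auto
  have path: "(?b p, ?b q) \<in> ?R\<^sup>* \<and> (?b q, ?b p) \<in> ?R\<^sup>*" if "1 \<le> p" "p \<le> q" "q \<le> n" for p q
    using that(2,3)
  proof (induct q rule: dec_induct)
    case (step q)
    then have q: "q \<in> {1..<n}" using that(1) by auto
    have IH: "(?b p, ?b q) \<in> ?R\<^sup>*" "(?b q, ?b p) \<in> ?R\<^sup>*" using step by auto
    show ?case
      using rtrancl_into_rtrancl[OF IH(1) R(1)[OF q]] converse_rtrancl_into_rtrancl[OF R(2)[OF q] IH(2)] by (rule conjI)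
  qed simp
  show ?thesis
    unfolding connected_shape_def
  proof (intro ballI)
    fix x y assume "x \<in> ribbon n K" "y \<in> ribbon n K"
    then obtain p q where pq: "p \<in> {1..n}" "x = ?b p" "q \<in> {1..n}" "y = ?b q"
      unfolding ribbon_def by (metis imageE)
    show "(x, y) \<in> ?R\<^sup>*"
      using path[of p q] path[of q p] pq by (cases "p \<le> q") auto
  qed
qed

lemma ribbon_border_shape:
  assumes n: "n \<ge> 1" and K: "K \<subseteq> {1..<n}"
  shows "ribbon n K \<in> border_shapes n (n - card K)"
proof -
  let ?\<beta> = "ribbon n K"
  have fin: "finite ?\<beta>" by (simp add: ribbon_def)
  have cK: "card K \<le> n - 1" using card_mono[OF _ K] by simp
  have "\<not> contains_square ?\<beta>"
  proof
    assume "contains_square ?\<beta>"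
    then obtain r c where rc: "(r, c) \<in> ?\<beta>" "(Suc r, Suc c) \<in> ?\<beta>" unfolding contains_square_def by auto
    obtain p where p: "p \<in> {1..n}" "(r, c) = rib_box n K p" using rc(1) unfolding ribbon_def by (rule imageE)
    obtain q where q: "q \<in> {1..n}" "(Suc r, Suc c) = rib_box n K q" using rc(2) unfolding ribbon_def by (rule imageE)
    have "r = rib_row n K p" "c = rib_col K p" "Suc r = rib_row n K q" "Suc c = rib_col K q"
      using p(2) q(2) by (simp_all add: rib_box_def)
    moreover have "1 \<le> p" "p \<le> n" "1 \<le> q" "q \<le> n" using p(1) q(1) by auto
    ultimately have "p = q" using rib_content[OF K, of p] rib_content[OF K, of q] by linarith
    then have "(r, c) = (Suc r, Suc c)" using p(2) q(2) by simp
    then show False by simp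
  qed
  moreover have "0 \<in> fst ` ?\<beta>"
  proof (rule image_eqI)
    show "rib_box n K n \<in> ?\<beta>" unfolding ribbon_def using n by (intro imageI) simp
  qed (simp add: rib_box_def rib_row_last)
  moreover have "0 \<in> snd ` ?\<beta>"
  proof (rule image_eqI)
    show "rib_box n K 1 \<in> ?\<beta>" unfolding ribbon_def using n by (intro imageI) simp
    show "0 = snd (rib_box n K 1)" by (simp only: rib_box_def snd_conv rib_col_first[OF K])
  qed
  moreover have "card ?\<beta> = n"
    unfolding ribbon_def using rib_box_inj[OF K] by (subst card_image) (auto intro: inj_onI)
  moreover have "card (fst ` ?\<beta>) = n - card K"
  proof -
    let ?M = "n - 1 - card K"
    have "fst ` ?\<beta> = {0..?M}"
    proof (intro equalityI subsetI)
      fix r assume "r \<in> fst ` ?\<beta>"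
      then obtain p where p: "p \<in> {1..n}" "r = rib_row n K p" by (auto simp: ribbon_def rib_box_def)
      then show "r \<in> {0..?M}" using rib_row_antimono[of 1 p n K] by (simp only: rib_row_first[OF K]) auto
    next
      fix r assume r: "r \<in> {0..?M}"
      have "\<exists>s\<in>{1..n}. rib_row n K s = r"
        by (rule rib_row_intermediate) (use r n rib_row_first[OF K] rib_row_last[of n K] in auto)
      then show "r \<in> fst ` ?\<beta>" by (force simp: ribbon_def rib_box_def)
    qed
    then show ?thesis using n cK by simp
  qed
  ultimately show ?thesis
    unfolding border_shapes_def
    using skew_shape_iff_convex[OF fin] convex_ribbon[OF K] connected_ribbon[OF K] by simp
qed

text \<open>By \<open>rib_content\<close>, column minus row at index \<open>p\<close> depends on
  \<open>K\<close> only through \<open>card K\<close>. Equal ribbons therefore agree index by index,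
  and the direction of every step can be read off.\<close>

lemma ribbon_inj:
  assumes K: "K \<subseteq> {1..<n}" "K' \<subseteq> {1..<n}" "card K = card K'" "ribbon n K = ribbon n K'"
  shows "K = K'"
proof -
  have b: "rib_box n K p = rib_box n K' p" if p: "p \<in> {1..n}" for p
  proof -
    have "rib_box n K p \<in> ribbon n K" unfolding ribbon_def using p by (rule imageI)
    then have "rib_box n K p \<in> ribbon n K'" by (simp only: K(4))
    then obtain q where q: "q \<in> {1..n}" "rib_box n K p = rib_box n K' q" unfolding ribbon_def by (rule imageE)
    then have "rib_row n K p = rib_row n K' q" "rib_col K p = rib_col K' q" by (simp_all add: rib_box_def)
    moreover have "1 \<le> p" "p \<le> n" "1 \<le> q" "q \<le> n" using p q(1) by auto
    ultimately have "p = q"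
      using rib_content[OF K(1), of p] rib_content[OF K(2), of q] unfolding K(3) by linarith
    then show ?thesis using q by simp
  qed
  have "p \<in> K \<longleftrightarrow> p \<in> K'" if p: "p \<in> {1..<n}" for p
  proof -
    have "rib_row n K p = rib_row n K' p" "rib_row n K (Suc p) = rib_row n K' (Suc p)"
      using b[of p] b[of "Suc p"] p by (auto simp: rib_box_def)
    then show ?thesis using rib_row_Suc[OF p, of K] rib_row_Suc[OF p, of K'] by (auto split: if_splits)
  qed
  then show ?thesis using K(1,2) by blast
qed

section \<open>Border shapes are ribbons\<close>

definition content :: "box \<Rightarrow> int" where
  "content x = int (snd x) - int (fst x)"

lemma content_adjacent: "adjacent x y \<Longrightarrow> \<bar>content x - content y\<bar> = 1"
  by (auto simp: adjacent_def content_def)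

text \<open>Contents change by exactly one along a step, so a path cannot jump over a value.\<close>

lemma path_crosses_content:
  assumes "(x, y) \<in> {(a, b). a \<in> \<beta> \<and> b \<in> \<beta> \<and> adjacent a b}\<^sup>*" "content x \<le> t" "t < content y"
  shows "\<exists>u\<in>\<beta>. \<exists>v\<in>\<beta>. adjacent u v \<and> content u = t \<and> content v = t + 1"
  using assms(1,3)
proof (induct rule: rtrancl_induct)
  case base
  then show ?case using assms(2) by simp
next
  case (step y z)
  show ?case
  proof (cases "t < content y")
    case True then show ?thesis using step by blast
  next
    case False
    have yz: "y \<in> \<beta>" "z \<in> \<beta>" "adjacent y z" using step(2) by auto
    have "content y = t" "content z = t + 1"
      using content_adjacent[OF yz(3)] False step(4) by auto
    then show ?thesis using yz by blast
  qed
qed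

text \<open>Two distinct boxes of equal content are comparable and differ in both coordinates;
  convexity then fills in a square.\<close>

lemma content_inj:
  assumes conv: "convex_shape \<beta>" and ns: "\<not> contains_square \<beta>"
  shows "inj_on content \<beta>"
proof -
  have less: False if xy: "x \<in> \<beta>" "y \<in> \<beta>" "content x = content y" "fst x < fst y" for x y
  proof -
    have c: "snd x < snd y" using xy(3,4) by (simp add: content_def)
    have m: "(r, c) \<in> \<beta>" if "fst x \<le> r" "r \<le> Suc (fst x)" "snd x \<le> c" "c \<le> Suc (snd x)" for r c
      by (rule convex_shapeD[OF conv xy(1,2)]) (use that xy(4) c in auto)
    have "contains_square \<beta>"
    proof -
      have "{(fst x, snd x), (fst x, Suc (snd x)), (Suc (fst x), snd x), (Suc (fst x), Suc (snd x))} \<subseteq> \<beta>"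
        using m xy(1) by simp
      then show ?thesis unfolding contains_square_def by blast
    qed
    then show False using ns by simp
  qed
  show ?thesis
  proof (rule inj_onI)
    fix x y assume xy: "x \<in> \<beta>" "y \<in> \<beta>" "content x = content y"
    have "fst x = fst y" using less[OF xy] less[OF xy(2,1) xy(3)[symmetric]] by (metis linorder_neqE_nat)
    then show "x = y" using xy(3) by (simp add: content_def prod_eq_iff)
  qed
qed

text \<open>Connectedness makes the contents an interval, and \<open>content_inj\<close> leaves one
  box for each content. Ordering the boxes by content gives the path, and \<open>K\<close> records
  its horizontal steps.\<close>

lemma border_shape_is_ribbon:
  assumes n: "n \<ge> 1" and \<beta>: "\<beta> \<in> border_shapes n m"
  shows "\<exists>K\<subseteq>{1..<n}. \<beta> = ribbon n K"
proof -
  have card\<beta>: "card \<beta> = n" and ns: "\<not> contains_square \<beta>" and con: "connected_shape \<beta>"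
    and z: "0 \<in> fst ` \<beta>" "0 \<in> snd ` \<beta>"
    using \<beta> by (simp_all add: border_shapes_def)
  have fin: "finite \<beta>" by (rule card_ge_0_finite) (use card\<beta> n in simp)
  have conv: "convex_shape \<beta>" using \<beta> skew_shape_iff_convex[OF fin] by (auto simp: border_shapes_def)
  have inj: "inj_on content \<beta>" by (rule content_inj[OF conv ns])
  have ne: "\<beta> \<noteq> {}" using card\<beta> n by auto
  define a where "a = Min (content ` \<beta>)"
  define z where "z = Max (content ` \<beta>)"
  have aS: "a \<in> content ` \<beta>" and zS: "z \<in> content ` \<beta>"
    unfolding a_def z_def using fin ne by auto
  obtain x where x: "x \<in> \<beta>" "content x = a" using aS by auto
  obtain y where y: "y \<in> \<beta>" "content y = z" using zS by auto
  have cross: "\<exists>u\<in>\<beta>. \<exists>v\<in>\<beta>. adjacent u v \<and> content u = t \<and> content v = t + 1" if "a \<le> t" "t < z" for t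
  proof (rule path_crosses_content)
    show "(x, y) \<in> {(a, b). a \<in> \<beta> \<and> b \<in> \<beta> \<and> adjacent a b}\<^sup>*" using con x(1) y(1) unfolding connected_shape_def by blast
  qed (use that x y in auto)
  have S: "content ` \<beta> = {a..z}"
  proof (intro equalityI subsetI)
    fix t assume "t \<in> content ` \<beta>"
    then show "t \<in> {a..z}" using fin by (simp add: a_def z_def)
  next
    fix t assume t: "t \<in> {a..z}"
    show "t \<in> content ` \<beta>"
    proof (cases "t = z")
      case True then show ?thesis using zS by simp
    next
      case False
      then show ?thesis using cross[of t] t by force
    qed
  qed
  have "a \<le> z" using aS unfolding S by simp
  have "card {a..z} = n" using card_image[OF inj] card\<beta> S by simp
  then have zn: "z = a + int n - 1" using \<open>a \<le> z\<close> by simp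
  define b where "b p = inv_into \<beta> content (a + int p - 1)" for p
  have b: "b p \<in> \<beta>" "content (b p) = a + int p - 1" if "p \<in> {1..n}" for p
  proof -
    have "a + int p - 1 \<in> content ` \<beta>" unfolding S zn using that by auto
    then show "b p \<in> \<beta>" "content (b p) = a + int p - 1"
      unfolding b_def by (rule inv_into_into, rule f_inv_into_f)
  qed
  have b_unique: "u = b p" if "u \<in> \<beta>" "content u = a + int p - 1" "p \<in> {1..n}" for u p
    using inj_onD[OF inj _ that(1) b(1)[OF that(3)]] that b(2)[OF that(3)] by simp
  have \<beta>b: "\<beta> = b ` {1..n}"
  proof (intro equalityI subsetI)
    fix u assume u: "u \<in> \<beta>"
    then have "content u \<in> {a..z}" using S by blast
    then have "content u = a + int (nat (content u - a + 1)) - 1" "nat (content u - a + 1) \<in> {1..n}"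
      using zn by auto
    then show "u \<in> b ` {1..n}" using b_unique[OF u] by blast
  qed (use b(1) in blast)
  define K where "K = {p \<in> {1..<n}. fst (b p) = fst (b (Suc p))}"
  have K: "K \<subseteq> {1..<n}" by (auto simp: K_def)
  have finK: "finite K" using K finite_subset by blast
  have rstep: "(p \<in> K \<longrightarrow> fst (b p) = fst (b (Suc p)) \<and> snd (b (Suc p)) = Suc (snd (b p))) \<and>
      (p \<notin> K \<longrightarrow> fst (b p) = Suc (fst (b (Suc p))) \<and> snd (b (Suc p)) = snd (b p))" if p: "p \<in> {1..<n}" for p
  proof -
    have "a \<le> a + int p - 1" "a + int p - 1 < z" using p zn by auto
    from cross[OF this] obtain u v where uv: "u \<in> \<beta>" "v \<in> \<beta>" "adjacent u v" "content u = a + int p - 1" "content v = a + int p"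
      by auto
    have "u = b p" using p by (intro b_unique uv) auto
    moreover have "v = b (Suc p)" using p uv(5) by (intro b_unique uv) auto
    ultimately have "adjacent (b p) (b (Suc p))" "content (b (Suc p)) = content (b p) + 1" using uv by auto
    then show ?thesis using p by (auto simp: K_def adjacent_def content_def)
  qed
  have rowdec: "fst (b n) \<le> fst (b p)" if "p \<in> {1..n}" for p
  proof -
    have "1 \<le> p" "p \<le> n" using that by auto
    from this(2,1) show ?thesis
    proof (induct p rule: inc_induct)
      case (step p)
      then have "p \<in> {1..<n}" by auto
      from rstep[OF this] step show ?case by (cases "p \<in> K") auto
    qed simp
  qed
  have colinc: "snd (b 1) \<le> snd (b p)" if "p \<in> {1..n}" for p
  proof -
    have "1 \<le> p" "p \<le> n" using that by auto
    then show ?thesis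
    proof (induct p rule: dec_induct)
      case (step p)
      then have "p \<in> {1..<n}" by auto
      from rstep[OF this] step show ?case by (cases "p \<in> K") auto
    qed simp
  qed
  \<comment> \<open>Here the translation is fixed: the last box lies in the top row and the first in
    the leftmost column, and both are numbered 0 by the choice of representative.\<close>
  have r0: "fst (b n) = 0"
  proof -
    obtain u where "u \<in> \<beta>" "fst u = 0" using z(1) by auto
    then obtain p where "p \<in> {1..n}" "u = b p" unfolding \<beta>b by blast
    then show ?thesis using rowdec[of p] \<open>fst u = 0\<close> by simp
  qed
  have c0: "snd (b 1) = 0"
  proof -
    obtain u where "u \<in> \<beta>" "snd u = 0" using z(2) by auto
    then obtain p where "p \<in> {1..n}" "u = b p" unfolding \<beta>b by blast
    then show ?thesis using colinc[of p] \<open>snd u = 0\<close> by simp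
  qed
  have row: "fst (b p) = rib_row n K p" if "1 \<le> p" "p \<le> n" for p
    using that(2,1)
  proof (induct p rule: inc_induct)
    case base
    then show ?case using r0 rib_row_last by simp
  next
    case (step p)
    then have p: "p \<in> {1..<n}" by auto
    have IH: "fst (b (Suc p)) = rib_row n K (Suc p)" using step by simp
    from rstep[OF p] show ?case
      using rib_row_Suc[OF p, of K] IH by (cases "p \<in> K") auto
  qed
  have col: "snd (b p) = rib_col K p" if "1 \<le> p" "p \<le> n" for p
    using that
  proof (induct p rule: dec_induct)
    case base
    then show ?case using c0 rib_col_first[OF K] by simp
  next
    case (step p)
    then have p: "p \<in> {1..<n}" by auto
    have IH: "snd (b p) = rib_col K p" using step by simp
    from rstep[OF p] show ?case
      using rib_col_Suc[OF finK, of p] IH by (cases "p \<in> K") auto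
  qed
  have "\<beta> = ribbon n K"
    unfolding \<beta>b ribbon_def by (rule image_cong[OF refl]) (simp add: rib_box_def prod_eq_iff row col)
  then show ?thesis using K by blast
qed

text \<open>A ribbon with \<open>i + 1\<close> rows has \<open>i\<close> upward steps among its
  \<open>n - 1\<close> steps, leaving \<open>n - 1 - i\<close> to the right.\<close>

lemma bij_betw_ribbon:
  assumes "n \<ge> 1" "i \<le> n - 1"
  shows "bij_betw (ribbon n) {K \<in> Pow {1..<n}. card K = n - 1 - i} (border_shapes n (i + 1))"
  unfolding bij_betw_def
proof
  show "inj_on (ribbon n) {K \<in> Pow {1..<n}. card K = n - 1 - i}"
  proof (rule inj_onI)
    fix K K' assume "K \<in> {K \<in> Pow {1..<n}. card K = n - 1 - i}" "K' \<in> {K \<in> Pow {1..<n}. card K = n - 1 - i}"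
      and eq: "ribbon n K = ribbon n K'"
    then have "K \<subseteq> {1..<n}" "K' \<subseteq> {1..<n}" "card K = card K'" by auto
    then show "K = K'" using eq by (rule ribbon_inj)
  qed
  show "ribbon n ` {K \<in> Pow {1..<n}. card K = n - 1 - i} = border_shapes n (i + 1)"
  proof (intro equalityI subsetI)
    fix \<beta> assume "\<beta> \<in> ribbon n ` {K \<in> Pow {1..<n}. card K = n - 1 - i}"
    then obtain K where K: "K \<subseteq> {1..<n}" "card K = n - 1 - i" "\<beta> = ribbon n K" by auto
    have "n - card K = i + 1" using assms K(2) by simp
    then show "\<beta> \<in> border_shapes n (i + 1)" using ribbon_border_shape[OF assms(1) K(1)] K(3) by simp
  next
    fix \<beta> assume \<beta>: "\<beta> \<in> border_shapes n (i + 1)"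
    obtain K where K: "K \<subseteq> {1..<n}" "\<beta> = ribbon n K" using border_shape_is_ribbon[OF assms(1) \<beta>] by blast
    have "card K \<le> n - 1" using card_mono[OF _ K(1)] by simp
    moreover have "n - card K = i + 1"
      using \<beta> ribbon_border_shape[OF assms(1) K(1)] K(2) by (simp add: border_shapes_def)
    ultimately have "card K = n - 1 - i" by simp
    then show "\<beta> \<in> ribbon n ` {K \<in> Pow {1..<n}. card K = n - 1 - i}" using K by blast
  qed
qed

section \<open>Specht modules of ribbons\<close>

text \<open>The value 0 off the ribbon matches the convention of \<open>tableaux\<close>, since
  permutations in \<open>symgrp n\<close> fix 0.\<close>

definition rib_index :: "nat \<Rightarrow> nat set \<Rightarrow> box \<Rightarrow> nat" where
  "rib_index n K x = (if x \<in> ribbon n K then inv_into {1..n} (rib_box n K) x else 0)"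

definition rib_tableau :: "nat \<Rightarrow> nat set \<Rightarrow> (nat \<Rightarrow> nat) \<Rightarrow> tableau" where
  "rib_tableau n K w = w \<circ> rib_index n K"

definition rib_tabloid :: "nat \<Rightarrow> nat set \<Rightarrow> (nat \<Rightarrow> nat) \<Rightarrow> tabloid" where
  "rib_tabloid n K w = tabloid_of n (ribbon n K) (rib_tableau n K w)"

section \<open>Tableaux, row groups and column groups of a ribbon\<close>

lemma rib_index_box:
  assumes "K \<subseteq> {1..<n}" "p \<in> {1..n}"
  shows "rib_index n K (rib_box n K p) = p"
proof -
  have "inj_on (rib_box n K) {1..n}" by (rule inj_onI) (rule rib_box_inj[OF assms(1)])
  moreover have "rib_box n K p \<in> ribbon n K" unfolding ribbon_def using assms(2) by (rule imageI)
  ultimately show ?thesis using assms(2) by (simp add: rib_index_def inv_into_f_f)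
qed

lemma rib_index_in:
  assumes "x \<in> ribbon n K"
  shows "rib_index n K x \<in> {1..n}" "rib_box n K (rib_index n K x) = x"
proof -
  have x: "x \<in> rib_box n K ` {1..n}" using assms by (simp add: ribbon_def)
  have e: "rib_index n K x = inv_into {1..n} (rib_box n K) x" using assms by (simp add: rib_index_def)
  show "rib_index n K x \<in> {1..n}" unfolding e by (rule inv_into_into[OF x])
  show "rib_box n K (rib_index n K x) = x" unfolding e by (rule f_inv_into_f[OF x])
qed

lemma rib_tableau_image:
  assumes K: "K \<subseteq> {1..<n}"
  shows "rib_tableau n K w ` {b \<in> ribbon n K. Q b} = w ` {p \<in> {1..n}. Q (rib_box n K p)}"
proof (intro equalityI subsetI)
  fix y assume "y \<in> rib_tableau n K w ` {b \<in> ribbon n K. Q b}"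
  then obtain b where b: "b \<in> ribbon n K" "Q b" "y = w (rib_index n K b)" by (auto simp: rib_tableau_def)
  then have "rib_index n K b \<in> {p \<in> {1..n}. Q (rib_box n K p)}" using rib_index_in[OF b(1)] by simp
  then show "y \<in> w ` {p \<in> {1..n}. Q (rib_box n K p)}" unfolding b(3) by (rule imageI)
next
  fix y assume "y \<in> w ` {p \<in> {1..n}. Q (rib_box n K p)}"
  then obtain p where p: "p \<in> {1..n}" "Q (rib_box n K p)" "y = w p" by auto
  have "rib_box n K p \<in> {b \<in> ribbon n K. Q b}" unfolding ribbon_def using p by auto
  moreover have "y = rib_tableau n K w (rib_box n K p)"
    using rib_index_box[OF K p(1)] p(3) by (simp add: rib_tableau_def)
  ultimately show "y \<in> rib_tableau n K w ` {b \<in> ribbon n K. Q b}" by (rule rev_image_eqI)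
qed

lemma tableaux_ribbon:
  assumes K: "K \<subseteq> {1..<n}"
  shows "tableaux n (ribbon n K) = rib_tableau n K ` symgrp n"
proof (intro equalityI subsetI)
  have bb: "bij_betw (rib_box n K) {1..n} (ribbon n K)"
    unfolding bij_betw_def ribbon_def by (auto intro!: inj_onI rib_box_inj[OF K])
  fix t assume "t \<in> tableaux n (ribbon n K)"
  then have t: "bij_betw t (ribbon n K) {1..n}" "\<And>b. b \<notin> ribbon n K \<Longrightarrow> t b = 0" by (auto simp: tableaux_def)
  define w where "w p = (if p \<in> {1..n} then t (rib_box n K p) else p)" for p
  have "bij_betw w {1..n} {1..n}"
  proof -
    have "bij_betw (t \<circ> rib_box n K) {1..n} {1..n}" using bb t(1) by (rule bij_betw_trans)
    moreover have "bij_betw (t \<circ> rib_box n K) {1..n} {1..n} = bij_betw w {1..n} {1..n}"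
      by (rule bij_betw_cong) (simp add: w_def)
    ultimately show ?thesis by simp
  qed
  then have "w permutes {1..n}" by (rule bij_imp_permutes) (auto simp: w_def)
  moreover have "t = rib_tableau n K w"
  proof
    fix x
    show "t x = rib_tableau n K w x"
    proof (cases "x \<in> ribbon n K")
      case True
      then show ?thesis using rib_index_in[OF True] by (simp add: rib_tableau_def w_def)
    next
      case False
      then show ?thesis using t(2) by (simp add: rib_tableau_def w_def rib_index_def)
    qed
  qed
  ultimately show "t \<in> rib_tableau n K ` symgrp n" by (simp add: symgrp_iff)
next
  fix t assume "t \<in> rib_tableau n K ` symgrp n"
  then obtain w where w: "w \<in> symgrp n" "t = rib_tableau n K w" by (rule imageE)
  have wp: "w permutes {1..n}" using w(1) by (simp add: symgrp_iff)
  have "bij_betw (rib_index n K) (ribbon n K) {1..n}"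
  proof (rule bij_betwI[where g = "rib_box n K"])
    show "rib_index n K \<in> ribbon n K \<rightarrow> {1..n}" by (rule funcsetI) (rule rib_index_in(1))
    show "rib_box n K \<in> {1..n} \<rightarrow> ribbon n K" unfolding ribbon_def by (rule funcsetI) (rule imageI)
  qed (simp_all only: rib_index_box[OF K] rib_index_in(2))
  then have "bij_betw (w \<circ> rib_index n K) (ribbon n K) {1..n}"
    using permutes_imp_bij[OF wp] by (rule bij_betw_trans)
  moreover have "w 0 = 0" by (rule permutes_not_in[OF wp]) simp
  ultimately show "t \<in> tableaux n (ribbon n K)" by (simp add: tableaux_def w(2) rib_tableau_def rib_index_def)
qed

lemma rib_tableau_inj:
  assumes K: "K \<subseteq> {1..<n}" and w: "w \<in> symgrp n" "w' \<in> symgrp n" "rib_tableau n K w = rib_tableau n K w'"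
  shows "w = w'"
proof
  fix p
  show "w p = w' p"
  proof (cases "p \<in> {1..n}")
    case True
    have "rib_tableau n K w (rib_box n K p) = rib_tableau n K w' (rib_box n K p)" by (simp only: w(3))
    then show ?thesis by (simp add: rib_tableau_def rib_index_box[OF K True])
  next
    case False
    then show ?thesis using w(1,2) permutes_not_in by (simp add: symgrp_iff permutes_not_in)
  qed
qed

lemma preserves_fibres_iff:
  fixes c :: "nat \<Rightarrow> nat"
  assumes u: "u permutes {1..n}"
  shows "(\<forall>r. u ` {p \<in> {1..n}. c p = r} = {p \<in> {1..n}. c p = r}) \<longleftrightarrow> (\<forall>p\<in>{1..n}. c (u p) = c p)"
proof
  assume h: "\<forall>r. u ` {p \<in> {1..n}. c p = r} = {p \<in> {1..n}. c p = r}"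
  show "\<forall>p\<in>{1..n}. c (u p) = c p"
  proof
    fix p assume "p \<in> {1..n}"
    then have "u p \<in> u ` {q \<in> {1..n}. c q = c p}" by (intro imageI) simp
    then show "c (u p) = c p" using h by simp
  qed
next
  assume h: "\<forall>p\<in>{1..n}. c (u p) = c p"
  show "\<forall>r. u ` {p \<in> {1..n}. c p = r} = {p \<in> {1..n}. c p = r}"
  proof
    fix r
    show "u ` {p \<in> {1..n}. c p = r} = {p \<in> {1..n}. c p = r}"
    proof (rule endo_inj_surj)
      show "u ` {p \<in> {1..n}. c p = r} \<subseteq> {p \<in> {1..n}. c p = r}"
        using h permutes_in_image[OF u] by auto
      show "inj_on u {p \<in> {1..n}. c p = r}" by (rule permutes_inj_on[OF u])
    qed simp
  qed
qed

text \<open>Reduces the stabilizer of all rows, or of all columns, to that of an increasing word,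
  which \<open>stabilizer_mono_word\<close> identifies.\<close>

lemma preserves_mono_fibres_iff:
  fixes c :: "nat \<Rightarrow> nat"
  assumes u: "u \<in> symgrp n" and g: "g \<in> mono_words n x"
    and cg: "\<And>p q. p \<in> {1..n} \<Longrightarrow> q \<in> {1..n} \<Longrightarrow> c p = c q \<longleftrightarrow> g p = g q"
  shows "(\<forall>r. u ` {p \<in> {1..n}. c p = r} = {p \<in> {1..n}. c p = r}) \<longleftrightarrow> u \<in> young n (levels n g)"
proof -
  have up: "u permutes {1..n}" using u by (simp add: symgrp_iff)
  have "(\<forall>r. u ` {p \<in> {1..n}. c p = r} = {p \<in> {1..n}. c p = r}) \<longleftrightarrow> (\<forall>p\<in>{1..n}. c (u p) = c p)"
    by (rule preserves_fibres_iff[OF up])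
  also have "\<dots> \<longleftrightarrow> (\<forall>p\<in>{1..n}. g (u p) = g p)"
    using cg permutes_in_image[OF up] by blast
  also have "\<dots> \<longleftrightarrow> g \<circ> u = g"
  proof
    assume h: "\<forall>p\<in>{1..n}. g (u p) = g p"
    show "g \<circ> u = g"
    proof
      fix p show "(g \<circ> u) p = g p" using h permutes_not_in[OF up, of p] by (cases "p \<in> {1..n}") auto
    qed
  next
    assume h: "g \<circ> u = g"
    show "\<forall>p\<in>{1..n}. g (u p) = g p" using fun_cong[OF h] by simp
  qed
  also have "\<dots> \<longleftrightarrow> u \<in> young n (levels n g)" by (rule stabilizer_mono_word[OF g u])
  finally show ?thesis .
qed

lemma preserves_rows_iff:
  assumes K: "K \<subseteq> {1..<n}" and u: "u \<in> symgrp n"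
  shows "(\<forall>r. u ` {p \<in> {1..n}. fst (rib_box n K p) = r} = {p \<in> {1..n}. fst (rib_box n K p) = r}) \<longleftrightarrow> u \<in> young n K"
proof -
  \<comment> \<open>Row numbers decrease along the ribbon; subtracting them from
    \<open>Suc n\<close> makes the word increasing and keeps its letters positive.\<close>
  define g where "g = (\<lambda>p\<in>{1..n}. Suc n - rib_row n K p)"
  have le: "rib_row n K p < n" if "p \<in> {1..n}" for p
  proof -
    have "rib_row n K p \<le> card {1..<n}" unfolding rib_row_def by (rule card_mono) auto
    then show ?thesis using that by auto
  qed
  have "g \<in> mono_words n (Suc n)"
    unfolding mono_words_def
  proof (intro CollectI conjI ballI)
    show "g \<in> {1..n} \<rightarrow>\<^sub>E {1..Suc n}"
    proof (rule PiE_I)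
      fix p assume "p \<in> {1..n}"
      then show "g p \<in> {1..Suc n}" using le[of p] by (simp add: g_def)
    qed (auto simp: g_def)
    fix i assume "i \<in> {1..<n}"
    then show "g i \<le> g (Suc i)" using rib_row_antimono[of i "Suc i" n K] by (auto simp: g_def)
  qed
  moreover have "levels n g = K"
  proof -
    have "g i = g (Suc i) \<longleftrightarrow> i \<in> K" if i: "i \<in> {1..<n}" for i
    proof -
      have "rib_row n K i < n" "rib_row n K (Suc i) < n" using le[of i] le[of "Suc i"] i by auto
      then show ?thesis using rib_row_Suc[OF i, of K] i by (auto simp: g_def split: if_splits)
    qed
    then show ?thesis using K by (auto simp: levels_def)
  qed
  moreover have "fst (rib_box n K p) = fst (rib_box n K q) \<longleftrightarrow> g p = g q" if "p \<in> {1..n}" "q \<in> {1..n}" for p q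
    using le[OF that(1)] le[OF that(2)] that by (auto simp: g_def rib_box_def)
  ultimately show ?thesis using preserves_mono_fibres_iff[OF u, of g "Suc n" "\<lambda>p. fst (rib_box n K p)"] by simp
qed

lemma preserves_columns_iff:
  assumes K: "K \<subseteq> {1..<n}" and u: "u \<in> symgrp n"
  shows "(\<forall>r. u ` {p \<in> {1..n}. snd (rib_box n K p) = r} = {p \<in> {1..n}. snd (rib_box n K p) = r}) \<longleftrightarrow> u \<in> young n ({1..<n} - K)"
proof -
  define g where "g = (\<lambda>p\<in>{1..n}. Suc (rib_col K p))"
  have finK: "finite K" using K finite_subset by blast
  have le: "rib_col K p < n" if "p \<in> {1..n}" for p
  proof -
    have "rib_col K p \<le> card {1..<n}" unfolding rib_col_def by (rule card_mono) (use K in auto)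
    then show ?thesis using that by auto
  qed
  have "g \<in> mono_words n (Suc n)"
    unfolding mono_words_def
  proof (intro CollectI conjI ballI)
    show "g \<in> {1..n} \<rightarrow>\<^sub>E {1..Suc n}"
    proof (rule PiE_I)
      fix p assume "p \<in> {1..n}"
      then show "g p \<in> {1..Suc n}" using le[of p] by (simp add: g_def)
    qed (auto simp: g_def)
    fix i assume "i \<in> {1..<n}"
    then show "g i \<le> g (Suc i)" using rib_col_mono[OF finK, of i "Suc i"] by (auto simp: g_def)
  qed
  moreover have "levels n g = {1..<n} - K"
  proof -
    have "g i = g (Suc i) \<longleftrightarrow> i \<notin> K" if i: "i \<in> {1..<n}" for i
      using rib_col_Suc[OF finK, of i] i by (auto simp: g_def split: if_splits)
    then show ?thesis using K by (auto simp: levels_def)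
  qed
  moreover have "snd (rib_box n K p) = snd (rib_box n K q) \<longleftrightarrow> g p = g q" if "p \<in> {1..n}" "q \<in> {1..n}" for p q
    using that by (auto simp: g_def rib_box_def)
  ultimately show ?thesis using preserves_mono_fibres_iff[OF u, of g "Suc n" "\<lambda>p. snd (rib_box n K p)"] by simp
qed

lemma conjugate_stabilizer:
  assumes w: "w \<in> symgrp n"
  shows "{\<pi> \<in> symgrp n. \<forall>r. \<pi> ` w ` R r = w ` R r} = (\<lambda>u. w \<circ> u \<circ> inv w) ` {u \<in> symgrp n. \<forall>r. u ` R r = R r}"
proof (intro equalityI subsetI)
  fix \<pi> assume \<pi>: "\<pi> \<in> {\<pi> \<in> symgrp n. \<forall>r. \<pi> ` w ` R r = w ` R r}"
  let ?u = "inv w \<circ> \<pi> \<circ> w"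
  have "?u \<in> symgrp n" using \<pi> w by (intro symgrp_comp symgrp_inv) auto
  moreover have "?u ` R r = R r" for r
  proof -
    have "?u ` R r = inv w ` \<pi> ` w ` R r" by (simp only: image_comp comp_assoc)
    also have "\<dots> = inv w ` w ` R r" using \<pi> by simp
    also have "\<dots> = (inv w \<circ> w) ` R r" by (simp only: image_comp)
    finally show ?thesis by (simp only: symgrp_inv_o(2)[OF w] image_id id_apply)
  qed
  moreover have "\<pi> = w \<circ> ?u \<circ> inv w"
    by (simp only: comp_assoc symgrp_inv_o(1)[OF w] comp_id symgrp_inv_o(4)[OF w])
  ultimately show "\<pi> \<in> (\<lambda>u. w \<circ> u \<circ> inv w) ` {u \<in> symgrp n. \<forall>r. u ` R r = R r}" by blast
next
  fix \<pi> assume "\<pi> \<in> (\<lambda>u. w \<circ> u \<circ> inv w) ` {u \<in> symgrp n. \<forall>r. u ` R r = R r}"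
  then obtain u where u: "u \<in> symgrp n" "\<And>r. u ` R r = R r" "\<pi> = w \<circ> u \<circ> inv w" by auto
  have "\<pi> \<in> symgrp n" unfolding u(3) by (intro symgrp_comp symgrp_inv w u(1))
  moreover have "\<pi> ` w ` R r = w ` R r" for r
  proof -
    have "\<pi> ` w ` R r = (w \<circ> u \<circ> inv w \<circ> w) ` R r" unfolding u(3) by (simp only: image_comp comp_assoc)
    also have "\<dots> = (w \<circ> u) ` R r" by (simp only: comp_assoc symgrp_inv_o(2)[OF w] comp_id)
    also have "\<dots> = w ` u ` R r" by (simp only: image_comp)
    finally show ?thesis by (simp only: u(2))
  qed
  ultimately show "\<pi> \<in> {\<pi> \<in> symgrp n. \<forall>r. \<pi> ` w ` R r = w ` R r}" by blast
qed

lemma row_group_ribbon: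
  assumes K: "K \<subseteq> {1..<n}" and w: "w \<in> symgrp n"
  shows "row_group n (ribbon n K) (rib_tableau n K w) = (\<lambda>u. w \<circ> u \<circ> inv w) ` young n K"
proof -
  have "{u \<in> symgrp n. \<forall>r. u ` {p \<in> {1..n}. fst (rib_box n K p) = r} = {p \<in> {1..n}. fst (rib_box n K p) = r}} = young n K"
    using preserves_rows_iff[OF K] young_symgrp by blast
  then show ?thesis
    unfolding row_group_def rib_tableau_image[OF K]
    using conjugate_stabilizer[OF w, of "\<lambda>r. {p \<in> {1..n}. fst (rib_box n K p) = r}"] by simp
qed

lemma column_group_ribbon:
  assumes K: "K \<subseteq> {1..<n}" and w: "w \<in> symgrp n"
  shows "column_group n (ribbon n K) (rib_tableau n K w) = (\<lambda>u. w \<circ> u \<circ> inv w) ` young n ({1..<n} - K)"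
proof -
  have "{u \<in> symgrp n. \<forall>r. u ` {p \<in> {1..n}. snd (rib_box n K p) = r} = {p \<in> {1..n}. snd (rib_box n K p) = r}} = young n ({1..<n} - K)"
    using preserves_columns_iff[OF K] young_symgrp by blast
  then show ?thesis
    unfolding column_group_def rib_tableau_image[OF K]
    using conjugate_stabilizer[OF w, of "\<lambda>r. {p \<in> {1..n}. snd (rib_box n K p) = r}"] by simp
qed

lemma rib_tabloid_eq:
  assumes K: "K \<subseteq> {1..<n}" and w: "w \<in> symgrp n"
  shows "rib_tabloid n K w = (\<lambda>u. rib_tableau n K (w \<circ> u)) ` young n K"
proof -
  have e: "w \<circ> u \<circ> inv w \<circ> rib_tableau n K w = rib_tableau n K (w \<circ> u)" for u
    by (simp only: rib_tableau_def comp_assoc symgrp_inv_o(3)[OF w])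
  show ?thesis
    unfolding rib_tabloid_def tabloid_of_def row_group_ribbon[OF K w] image_image e ..
qed

text \<open>Tabloids of the ribbon are thus the left cosets of \<open>young n K\<close>, the same
  objects that \<open>coset_ind\<close> describes.\<close>

lemma rib_tabloid_eq_iff:
  assumes K: "K \<subseteq> {1..<n}" and w: "w \<in> symgrp n" "w' \<in> symgrp n"
  shows "rib_tabloid n K w = rib_tabloid n K w' \<longleftrightarrow> inv w \<circ> w' \<in> young n K"
proof
  assume eq: "rib_tabloid n K w = rib_tabloid n K w'"
  have "rib_tableau n K (w' \<circ> id) \<in> rib_tabloid n K w'"
    unfolding rib_tabloid_eq[OF K w(2)] by (rule imageI[OF young_id])
  then have "rib_tableau n K (w' \<circ> id) \<in> (\<lambda>u. rib_tableau n K (w \<circ> u)) ` young n K"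
    unfolding eq[symmetric] rib_tabloid_eq[OF K w(1)] .
  then obtain u where u: "u \<in> young n K" "rib_tableau n K (w' \<circ> id) = rib_tableau n K (w \<circ> u)" by (rule imageE) blast
  then have "w' = w \<circ> u"
    using rib_tableau_inj[OF K w(2) symgrp_comp[OF w(1) young_symgrp[OF u(1)]]] by simp
  then show "inv w \<circ> w' \<in> young n K" using u(1) by (simp only: symgrp_inv_o(3)[OF w(1)])
next
  assume y: "inv w \<circ> w' \<in> young n K"
  let ?y = "inv w \<circ> w'"
  have w': "w' = w \<circ> ?y" by (simp only: symgrp_inv_o(4)[OF w(1)])
  have yG: "?y \<in> symgrp n" using y by (rule young_symgrp)
  have "(\<lambda>u. ?y \<circ> u) ` young n K = young n K"
  proof (intro equalityI subsetI)
    fix v assume "v \<in> (\<lambda>u. ?y \<circ> u) ` young n K"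
    then show "v \<in> young n K" using young_comp[OF y] by blast
  next
    fix v assume "v \<in> young n K"
    then have "inv ?y \<circ> v \<in> young n K" by (rule young_comp[OF young_inv[OF y]])
    then have "?y \<circ> (inv ?y \<circ> v) \<in> (\<lambda>u. ?y \<circ> u) ` young n K" by (rule imageI)
    then show "v \<in> (\<lambda>u. ?y \<circ> u) ` young n K" by (simp only: symgrp_inv_o(4)[OF yG])
  qed
  then have "(\<lambda>u. rib_tableau n K (w \<circ> u)) ` young n K = (\<lambda>u. rib_tableau n K (w \<circ> u)) ` (\<lambda>u. ?y \<circ> u) ` young n K" by simp
  also have "\<dots> = (\<lambda>u. rib_tableau n K ((w \<circ> ?y) \<circ> u)) ` young n K" by (simp only: image_image comp_assoc)
  finally show "rib_tabloid n K w = rib_tabloid n K w'"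
    unfolding rib_tabloid_eq[OF K w(1)] rib_tabloid_eq[OF K w(2)] by (simp only: w'[symmetric])
qed

text \<open>Pullback along the map from permutations to tabloids; it turns tabloid indicators into
  coset indicators.\<close>

definition ribbon_map :: "nat \<Rightarrow> nat set \<Rightarrow> (tabloid \<Rightarrow> complex) \<Rightarrow> permfun" where
  "ribbon_map n K v = (\<lambda>w. if w \<in> symgrp n then v (rib_tabloid n K w) else 0)"

lemma linear_ribbon_map: "Vector_Spaces.linear (\<lambda>c v x. c * v x) (\<lambda>c v x. c * v x) (ribbon_map n K)"
  by unfold_locales (simp_all add: ribbon_map_def fun_eq_iff algebra_simps)

lemma linear_act: "Vector_Spaces.linear (\<lambda>c v x. c * v x) (\<lambda>c v x. c * v x) (act \<pi>)"
  by unfold_locales (simp_all add: act_def fun_eq_iff algebra_simps)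

text \<open>A column permutation of the tableau of \<open>v\<close> is
  \<open>v \<circ> c \<circ> inv v\<close> with \<open>c\<close> in the column Young subgroup; it
  has the sign of \<open>c\<close> and leads to the tableau of \<open>v \<circ> c\<close>.\<close>

lemma ribbon_map_polytabloid:
  assumes K: "K \<subseteq> {1..<n}" and v: "v \<in> symgrp n"
  shows "ribbon_map n K (polytabloid n (ribbon n K) (rib_tableau n K v)) = ribbon_vec n K v"
proof
  fix w
  let ?C = "young n ({1..<n} - K)"
  show "ribbon_map n K (polytabloid n (ribbon n K) (rib_tableau n K v)) w = ribbon_vec n K v w"
  proof (cases "w \<in> symgrp n")
    case True
    have inj: "inj_on (\<lambda>u. v \<circ> u \<circ> inv v) ?C"
    proof (rule inj_onI)
      fix u u' assume "v \<circ> u \<circ> inv v = v \<circ> u' \<circ> inv v"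
      then have "inv v \<circ> (v \<circ> u \<circ> inv v) \<circ> v = inv v \<circ> (v \<circ> u' \<circ> inv v) \<circ> v" by simp
      then show "u = u'" by (simp only: comp_assoc symgrp_inv_o(2)[OF v] symgrp_inv_o(3)[OF v] comp_id)
    qed
    have "ribbon_map n K (polytabloid n (ribbon n K) (rib_tableau n K v)) w =
      (\<Sum>\<kappa>\<in>(\<lambda>u. v \<circ> u \<circ> inv v) ` ?C. of_int (sign \<kappa>) * of_bool (rib_tabloid n K w = tabloid_of n (ribbon n K) (\<kappa> \<circ> rib_tableau n K v)))"
      using True by (simp only: ribbon_map_def polytabloid_def column_group_ribbon[OF K v] if_True)
    also have "\<dots> = (\<Sum>c\<in>?C. of_int (sign (v \<circ> c \<circ> inv v)) * of_bool (rib_tabloid n K w = tabloid_of n (ribbon n K) (v \<circ> c \<circ> inv v \<circ> rib_tableau n K v)))"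
      by (subst sum.reindex[OF inj]) (simp only: o_def)
    also have "\<dots> = (\<Sum>c\<in>?C. of_int (sign c) * coset_ind n K (v \<circ> c) w)"
    proof (rule sum.cong[OF refl])
      fix c assume "c \<in> ?C"
      then have c: "c \<in> symgrp n" by (rule young_symgrp)
      have "sign (v \<circ> c \<circ> inv v) = sign v * sign c * sign v"
        by (simp add: sign_compose symgrp_perm[OF v] symgrp_perm[OF c] permutation_compose permutation_inverse sign_inverse)
      then have s: "sign (v \<circ> c \<circ> inv v) = sign c" by (simp add: mult.assoc mult.left_commute)
      have "v \<circ> c \<circ> inv v \<circ> rib_tableau n K v = rib_tableau n K (v \<circ> c)"
      proof -
        have "v \<circ> c \<circ> inv v \<circ> rib_tableau n K v = v \<circ> (c \<circ> (inv v \<circ> (v \<circ> rib_index n K)))"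
          by (simp only: rib_tableau_def comp_assoc)
        also have "inv v \<circ> (v \<circ> rib_index n K) = rib_index n K"
          by (simp only: comp_assoc[symmetric] symgrp_inv_o(2)[OF v] id_comp)
        finally show ?thesis by (simp only: rib_tableau_def comp_assoc)
      qed
      then have "(rib_tabloid n K w = tabloid_of n (ribbon n K) (v \<circ> c \<circ> inv v \<circ> rib_tableau n K v)) \<longleftrightarrow> rib_tabloid n K (v \<circ> c) = rib_tabloid n K w"
        by (auto simp: rib_tabloid_def)
      also have "\<dots> \<longleftrightarrow> inv (v \<circ> c) \<circ> w \<in> young n K"
        by (rule rib_tabloid_eq_iff[OF K symgrp_comp[OF v c] True])
      finally show "of_int (sign (v \<circ> c \<circ> inv v)) * of_bool (rib_tabloid n K w = tabloid_of n (ribbon n K) (v \<circ> c \<circ> inv v \<circ> rib_tableau n K v)) =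
        of_int (sign c) * (coset_ind n K (v \<circ> c) w :: complex)"
        using True by (simp only: s coset_ind_def simp_thms)
    qed
    finally show ?thesis by (simp only: ribbon_vec_def)
  next
    case False
    then show ?thesis by (simp add: ribbon_map_def ribbon_vec_def coset_ind_def)
  qed
qed

text \<open>As \<open>ribbon_map\<close> sees only values at tabloids of the ribbon, its injectivity
  on the Specht module rests on this support.\<close>

lemma polytabloid_support:
  assumes K: "K \<subseteq> {1..<n}" and v: "v \<in> symgrp n" and T: "T \<notin> rib_tabloid n K ` symgrp n"
  shows "polytabloid n (ribbon n K) (rib_tableau n K v) T = 0"
  unfolding polytabloid_def
proof (intro sum.neutral ballI)
  fix \<kappa> assume "\<kappa> \<in> column_group n (ribbon n K) (rib_tableau n K v)"
  then have k: "\<kappa> \<in> symgrp n" by (simp add: column_group_def)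
  have "tabloid_of n (ribbon n K) (\<kappa> \<circ> rib_tableau n K v) = rib_tabloid n K (\<kappa> \<circ> v)"
    by (simp only: rib_tabloid_def rib_tableau_def comp_assoc)
  then have "T \<noteq> tabloid_of n (ribbon n K) (\<kappa> \<circ> rib_tableau n K v)"
    using T imageI[OF symgrp_comp[OF k v], of "rib_tabloid n K"] by auto
  then show "of_int (sign \<kappa>) * of_bool (T = tabloid_of n (ribbon n K) (\<kappa> \<circ> rib_tableau n K v)) = (0 :: complex)" by simp
qed

lemma translate_rib_tabloid:
  assumes K: "K \<subseteq> {1..<n}" and "w \<in> symgrp n" "\<rho> \<in> symgrp n"
  shows "(\<lambda>t. \<rho> \<circ> t) ` rib_tabloid n K w = rib_tabloid n K (\<rho> \<circ> w)"
  unfolding rib_tabloid_eq[OF K assms(2)] rib_tabloid_eq[OF K symgrp_comp[OF assms(3,2)]] image_image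
  by (simp only: rib_tableau_def comp_assoc)

lemma specht_character_ribbon:
  assumes K: "K \<subseteq> {1..<n}" and \<pi>: "\<pi> \<in> symgrp n"
  shows "specht_character n (ribbon n K) \<pi> = trace_on (cfun.span (ribbon_vec n K ` symgrp n)) (ltrans \<pi>)"
proof -
  let ?S = "polytabloid n (ribbon n K) ` tableaux n (ribbon n K)"
  let ?T = "rib_tabloid n K ` symgrp n"
  let ?Z = "{v. \<forall>T. T \<notin> ?T \<longrightarrow> v T = (0 :: complex)}"
  let ?e = "\<lambda>v. polytabloid n (ribbon n K) (rib_tableau n K v)"
  have S: "?S = ?e ` symgrp n" unfolding tableaux_ribbon[OF K] image_image ..
  have subZ: "cfun.subspace ?Z" by (rule cfun.subspaceI) auto
  have spZ: "cfun.span ?S \<subseteq> ?Z"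
    unfolding S by (rule cfun.span_minimal[OF _ subZ]) (auto intro: polytabloid_support[OF K])
  have injZ: "u = v" if "u \<in> ?Z" "v \<in> ?Z" "ribbon_map n K u = ribbon_map n K v" for u v
  proof
    fix T
    show "u T = v T"
    proof (cases "T \<in> ?T")
      case True
      then obtain w where w: "w \<in> symgrp n" "T = rib_tabloid n K w" by (rule imageE)
      show ?thesis using fun_cong[OF that(3), of w] w by (simp add: ribbon_map_def)
    next
      case False
      then show ?thesis using that(1,2) by simp
    qed
  qed
  have comm: "ribbon_map n K (act \<pi> v) = ltrans \<pi> (ribbon_map n K v)" for v
  proof
    fix w
    show "ribbon_map n K (act \<pi> v) w = ltrans \<pi> (ribbon_map n K v) w"
    proof (cases "w \<in> symgrp n")
      case True
      have "inv \<pi> \<circ> w \<in> symgrp n" by (rule symgrp_comp[OF symgrp_inv[OF \<pi>] True])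
      then show ?thesis
        using translate_rib_tabloid[OF K True symgrp_inv[OF \<pi>]] True by (simp add: ribbon_map_def ltrans_def act_def)
    next
      case False
      have "inv \<pi> \<circ> w \<notin> symgrp n"
      proof
        assume "inv \<pi> \<circ> w \<in> symgrp n"
        then have "\<pi> \<circ> (inv \<pi> \<circ> w) \<in> symgrp n" by (rule symgrp_comp[OF \<pi>])
        then show False using False by (simp only: symgrp_inv_o(4)[OF \<pi>])
      qed
      then show ?thesis using False by (simp add: ribbon_map_def ltrans_def)
    qed
  qed
  have actZ: "act \<pi> v \<in> ?Z" if v: "v \<in> ?Z" for v
  proof (intro CollectI allI impI)
    fix T assume T: "T \<notin> ?T"
    have "(\<lambda>t. inv \<pi> \<circ> t) ` T \<notin> ?T"
    proof
      assume "(\<lambda>t. inv \<pi> \<circ> t) ` T \<in> ?T"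
      then obtain w where w: "w \<in> symgrp n" "(\<lambda>t. inv \<pi> \<circ> t) ` T = rib_tabloid n K w" by (rule imageE)
      have "T = (\<lambda>t. \<pi> \<circ> t) ` (\<lambda>t. inv \<pi> \<circ> t) ` T"
        by (simp add: image_image o_assoc symgrp_inv_o(1)[OF \<pi>])
      also have "\<dots> = rib_tabloid n K (\<pi> \<circ> w)" unfolding w(2) by (rule translate_rib_tabloid[OF K w(1) \<pi>])
      finally show False using T imageI[OF symgrp_comp[OF \<pi> w(1)], of "rib_tabloid n K"] by simp
    qed
    then show "act \<pi> v T = 0" using v by (simp add: act_def)
  qed
  have eZ: "?e v \<in> ?Z" if "v \<in> symgrp n" for v using polytabloid_support[OF K that] by simp
  \<comment> \<open>The two sides are compared after applying the injective
    \<open>ribbon_map\<close>, where the action becomes left translation.\<close>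
  have act_e: "act \<pi> (?e v) = ?e (\<pi> \<circ> v)" if v: "v \<in> symgrp n" for v
  proof (rule injZ[OF actZ[OF eZ[OF v]] eZ[OF symgrp_comp[OF \<pi> v]]])
    show "ribbon_map n K (act \<pi> (?e v)) = ribbon_map n K (?e (\<pi> \<circ> v))"
      by (simp only: comm ribbon_map_polytabloid[OF K v] ribbon_map_polytabloid[OF K symgrp_comp[OF \<pi> v]] ltrans_ribbon_vec[OF \<pi> v])
  qed
  have "trace_on (cfun.span ?S) (act \<pi>) = trace_on (cfun.span (ribbon_map n K ` ?S)) (ltrans \<pi>)"
  proof (rule trace_on_transport[OF _ linear_act linear_ltrans linear_ribbon_map])
    show "finite ?S" unfolding S using finite_symgrp by simp
    show "inj_on (ribbon_map n K) (cfun.span ?S)"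
    proof (rule inj_onI)
      fix u v assume "u \<in> cfun.span ?S" "v \<in> cfun.span ?S" "ribbon_map n K u = ribbon_map n K v"
      then show "u = v" using spZ by (intro injZ) auto
    qed
    show "act \<pi> b \<in> cfun.span ?S" if b: "b \<in> ?S" for b
    proof -
      obtain v where v: "v \<in> symgrp n" "b = ?e v" using b unfolding S by (rule imageE)
      have "?e (\<pi> \<circ> v) \<in> ?S" unfolding S by (rule imageI[OF symgrp_comp[OF \<pi> v(1)]])
      then show ?thesis unfolding v(2) act_e[OF v(1)] by (rule cfun.span_base)
    qed
    show "ribbon_map n K (act \<pi> v) = ltrans \<pi> (ribbon_map n K v)" for v by (rule comm)
  qed
  also have "ribbon_map n K ` ?S = ribbon_vec n K ` symgrp n"
    unfolding S image_image by (rule image_cong[OF refl ribbon_map_polytabloid[OF K]])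
  finally show ?thesis by (simp only: specht_character_def specht_module_def)
qed

section \<open>Foulkes characters as coefficients of powers\<close>

lemma foulkes_eq_sum_traces:
  assumes "n \<ge> 1" "i \<le> n - 1" and \<pi>: "\<pi> \<in> symgrp n"
  shows "foulkes n i \<pi> = (\<Sum>K\<in>{K \<in> Pow {1..<n}. card K = n - 1 - i}.
    trace_on (cfun.span (ribbon_vec n K ` symgrp n)) (ltrans \<pi>))"
proof -
  have "foulkes n i \<pi> = (\<Sum>K\<in>{K \<in> Pow {1..<n}. card K = n - 1 - i}. specht_character n (ribbon n K) \<pi>)"
    unfolding foulkes_def by (rule sum.reindex_bij_betw[OF bij_betw_ribbon[OF assms(1,2)], symmetric])
  also have "\<dots> = (\<Sum>K\<in>{K \<in> Pow {1..<n}. card K = n - 1 - i}.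
      trace_on (cfun.span (ribbon_vec n K ` symgrp n)) (ltrans \<pi>))"
    by (rule sum.cong[OF refl]) (simp add: specht_character_ribbon[OF _ \<pi>])
  finally show ?thesis .
qed

text \<open>Ribbons with equally many horizontal steps share a binomial coefficient and together
  make up one Foulkes character.\<close>

lemma power_num_cycles_eq_sum_foulkes:
  assumes n: "n \<ge> 1" and \<pi>: "\<pi> \<in> symgrp n"
  shows "of_nat x ^ num_cycles n \<pi> = (\<Sum>i=0..n - 1. foulkes n i \<pi> * of_nat ((x + (n - 1 - i)) choose n))"
proof -
  let ?t = "\<lambda>K. trace_on (cfun.span (ribbon_vec n K ` symgrp n)) (ltrans \<pi>)"
  have "of_nat x ^ num_cycles n \<pi> = (\<Sum>K\<in>Pow {1..<n}. ?t K * of_nat ((x + card K) choose n))"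
    by (rule power_num_cycles_eq_sum_ribbon_traces[OF \<pi>])
  also have "\<dots> = (\<Sum>i\<in>{0..n - 1}. \<Sum>K\<in>{K \<in> Pow {1..<n}. n - 1 - card K = i}. ?t K * of_nat ((x + card K) choose n))"
    by (rule sum.group[symmetric]) auto
  also have "\<dots> = (\<Sum>i=0..n - 1. foulkes n i \<pi> * of_nat ((x + (n - 1 - i)) choose n))"
  proof (rule sum.cong[OF refl])
    fix i assume "i \<in> {0..n - 1}"
    then have i: "i \<le> n - 1" by simp
    have "n - 1 - card K = i \<longleftrightarrow> card K = n - 1 - i" if "K \<in> Pow {1..<n}" for K
      using card_mono[of "{1..<n}" K] that i by auto
    then have eq: "{K \<in> Pow {1..<n}. n - 1 - card K = i} = {K \<in> Pow {1..<n}. card K = n - 1 - i}" by blast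
    have "(\<Sum>K\<in>{K \<in> Pow {1..<n}. n - 1 - card K = i}. ?t K * of_nat ((x + card K) choose n)) =
      (\<Sum>K\<in>{K \<in> Pow {1..<n}. card K = n - 1 - i}. ?t K * of_nat ((x + (n - 1 - i)) choose n))"
      unfolding eq by (rule sum.cong[OF refl]) simp
    also have "\<dots> = foulkes n i \<pi> * of_nat ((x + (n - 1 - i)) choose n)"
      by (simp only: foulkes_eq_sum_traces[OF n i \<pi>] sum_distrib_right)
    finally show "(\<Sum>K\<in>{K \<in> Pow {1..<n}. n - 1 - card K = i}. ?t K * of_nat ((x + card K) choose n)) =
      foulkes n i \<pi> * of_nat ((x + (n - 1 - i)) choose n)" .
  qed
  finally show ?thesis .
qed

text \<open>The sum stops at \<open>u = i\<close>: for larger \<open>u\<close> the lower index of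
  the binomial coefficient would be negative, where it is 0 by convention.\<close>

lemma foulkes_formula:
  assumes "n \<ge> 1" "i \<le> n - 1" "\<pi> \<in> symgrp n"
  shows "foulkes n i \<pi> = (\<Sum>u=0..i. (-1) ^ (i - u) * of_nat ((n + 1) choose (i - u)) * of_nat (u + 1) ^ num_cycles n \<pi>)"
  by (rule binomial_inversion[where c = "\<lambda>i. foulkes n i \<pi>", OF power_num_cycles_eq_sum_foulkes[OF assms(1,3)] assms(1,2)])

theorem theorem2p8:
  fixes n i j k :: nat
  assumes "n \<ge> 1" and "i \<le> n - 1" and "j \<le> n - 1" and "k \<le> n - 1"
  shows "bracket n (\<lambda>\<pi>. foulkes n i \<pi> * foulkes n j \<pi>) (foulkes n k) =
    (\<Sum>u=0..i. \<Sum>v=0..j. (-1) ^ (i - u) * (-1) ^ (j - v) *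
       of_nat ((n + 1) choose (i - u)) * of_nat ((n + 1) choose (j - v)) *
       of_nat ((u * v + u + v + n - k) choose n))"
  by (rule bracket_foulkes[OF assms foulkes_formula[OF assms(1)]])

end
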